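(* Let $G$ be a countable discrete group with an outer action on a $II_1$ factor $P$, generated by two of its finite subgroups $H$ and $K$. For the group-type subfactor $N=P^H\subset P\rtimes K=M$, with the tower $M_n$ realized as $M_{S_n}(\mathbb{C})\otimes(P\rtimes L_n)$ as described in the context, the relative commutants are given by $$N'\cap M_n\cong\begin{cases}\mathbb{C},&n=-1,\\ \mathrm{span}\bigl\{E_{\underline{s_1},\underline{s_2}}\otimes l:\ \underline{s_1},\underline{s_2}\in S_n,\ l\in L_n,\ \mu(\underline{s_1})\,l\,\mu(\underline{s_2})^{-1}\in H\bigr\},&n\ge0,\end{cases}$$ $$M'\cap M_n\cong\begin{cases}\mathbb{C},&n=0,\\ \mathrm{span}\Bigl\{\displaystyle\sum_{k\in K}E_{k,kk_0}\otimes E_{\underline{t_1},\underline{t_2}}\otimes l:\ \underline{t_1},\underline{t_2}\in T_{n-1},\ l\in L_n,\ k_0:=\mu(\underline{t_1})\,l\,\mu(\underline{t_2})^{-1}\in K\Bigr\},&n\ge1,\end{cases}$$ where for $n\ge 1$, $M_{S_n}(\mathbb{C})$ is identified with $M_K(\mathbb{C})\otimes M_{T_{n-1}}(\mathbb{C})$, and "$\cong$" is equality under the given realization of $M_n$.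
   Context: An action is outer if every $g\ne e$ acts by an outer automorphism; $k(x)$ denotes the automorphism $k$ applied to $x\in P$. $M_{-1}=N\subset M_0=M\subset M_1\subset\cdots$ is the Jones tower of $N\subset M$. $S_0=T_0=\{e\}$; for $n\ge1$, $S_n=K\times H\times K\times\cdots$ and $T_n=H\times K\times H\times\cdots$ ($n$ factors each), so $S_n=K\times T_{n-1}$; $L_n=K$ if $n$ is even, $L_n=H$ if $n$ is odd, so $S_{n+1}=S_n\times L_n$. $\mu$ denotes the multiplication map from $S_n$ or $T_n$ to $G$. For a finite set $X$, $M_X(\mathbb{C})$ has matrix units $E_{a,b}$, $a,b\in X$, and $M_{X\times Y}(\mathbb{C})=M_X(\mathbb{C})\otimes M_Y(\mathbb{C})$. For $l$ in a finite group $L$, $\lambda_l=\sum_{a\in L}E_{la,a}\in M_L(\mathbb{C})$. Realization of the tower: $M_n=M_{S_n}(\mathbb{C})\otimes(P\rtimes L_n)$ for $n\ge0$, with inclusion $M_n\subset M_{n+1}$ given by $E_{\underline{s},\underline{t}}\otimes x\mapsto\sum_{l\in L_n}E_{\underline{s},\underline{t}}\otimes E_{l,l}\otimes l^{-1}(x)$ for $x\in P$ and $E_{\underline{s},\underline{t}}\otimes l\mapsto E_{\underline{s},\underline{t}}\otimes\lambda_l\otimes1$ for $l\in L_n$. In particular $x\in P\subset M$ is identified with $\sum_{\underline{s}\in S_n}E_{\underline{s},\underline{s}}\otimes\mu(\underline{s})^{-1}(x)\in M_n$, and for $n\ge1$, $k\in K\subset M$ is identified with $\lambda_k\otimes I_{T_{n-1}}\otimes1\in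 M_n$. *)

theory Defs
  imports
    "HOL-Analysis.Bounded_Linear_Function"
    "HOL-Algebra.Generated_Groups"
    "HOL-Library.Function_Algebras"
    "HOL-Library.Countable_Set"
begin

section \<open>Complex Hilbert spaces and their bounded operators\<close>

class complex_hilbert_space = banach +
  fixes scaleC :: "complex \<Rightarrow> 'a \<Rightarrow> 'a"
    and cinner :: "'a \<Rightarrow> 'a \<Rightarrow> complex"
  assumes scaleC_add_right: "scaleC a (x + y) = scaleC a x + scaleC a y"
    and scaleC_add_left: "scaleC (a + b) x = scaleC a x + scaleC b x"
    and scaleC_scaleC: "scaleC a (scaleC b x) = scaleC (a * b) x"
    and scaleC_of_real: "scaleC (complex_of_real r) x = scaleR r x"
    and cinner_commute: "cinner x y = cnj (cinner y x)"
    and cinner_add_left: "cinner (x + y) z = cinner x z + cinner y z"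
    and cinner_scaleC_left: "cinner (scaleC a x) y = a * cinner x y"
    and cinner_self: "cinner x x = complex_of_real ((norm x)\<^sup>2)"

lemma norm_scaleC:
  fixes x :: "'h :: complex_hilbert_space"
  shows "norm (scaleC c x) = cmod c * norm x"
proof -
  have right: "cinner u (scaleC c v) = cnj c * cinner u v" for u v :: 'h
    by (subst (1 2) cinner_commute) (simp add: cinner_scaleC_left)
  have "complex_of_real ((norm (scaleC c x))\<^sup>2) = (c * cnj c) * complex_of_real ((norm x)\<^sup>2)"
    by (simp only: cinner_self [symmetric] cinner_scaleC_left right mult.assoc mult.left_commute)
  also have "\<dots> = complex_of_real ((cmod c * norm x)\<^sup>2)"
    by (simp add: complex_norm_square [symmetric] power_mult_distrib)
  finally have "(norm (scaleC c x))\<^sup>2 = (cmod c * norm x)\<^sup>2"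
    by (simp only: of_real_eq_iff)
  then show ?thesis
    by (simp add: power2_eq_iff_nonneg)
qed

lemma bounded_linear_scaleC:
  "bounded_linear (scaleC c :: 'h \<Rightarrow> 'h :: complex_hilbert_space)"
proof (rule bounded_linear_intro [where K = "cmod c"])
  fix r :: real and x y :: 'h
  show "scaleC c (x + y) = scaleC c x + scaleC c y"
    by (rule scaleC_add_right)
  show "scaleC c (r *\<^sub>R x) = r *\<^sub>R scaleC c x"
    by (simp add: scaleC_of_real [symmetric] scaleC_scaleC mult.commute)
  show "norm (scaleC c x) \<le> norm x * cmod c"
    by (simp add: norm_scaleC)
qed

text \<open>The type \<open>'h \<Rightarrow>\<^sub>L 'h\<close> consists of the real-linear bounded operators, so complex
  linearity is imposed separately.\<close>

definition bounded_ops :: "('h \<Rightarrow>\<^sub>L 'h :: complex_hilbert_space) set" where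
  "bounded_ops = {T. \<forall>c x. blinfun_apply T (scaleC c x) = scaleC c (blinfun_apply T x)}"

definition scaleC_op :: "complex \<Rightarrow> ('h \<Rightarrow>\<^sub>L 'h) \<Rightarrow> ('h \<Rightarrow>\<^sub>L 'h :: complex_hilbert_space)" where
  "scaleC_op c T = Blinfun (\<lambda>x. scaleC c (blinfun_apply T x))"

lemma scaleC_op_apply: "blinfun_apply (scaleC_op c T) x = scaleC c (blinfun_apply T x)"
  unfolding scaleC_op_def
  by (rule bounded_linear_Blinfun_apply [THEN fun_cong])
    (rule bounded_linear_compose [OF bounded_linear_scaleC blinfun.bounded_linear_right])

definition is_adjoint :: "('h \<Rightarrow>\<^sub>L 'h) \<Rightarrow> ('h \<Rightarrow>\<^sub>L 'h :: complex_hilbert_space) \<Rightarrow> bool" where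
  "is_adjoint T T' \<longleftrightarrow>
     (\<forall>x y. cinner (blinfun_apply T x) y = cinner x (blinfun_apply T' y))"


section \<open>Von Neumann algebras, factors of type II$_1$\<close>

definition commutant :: "('h \<Rightarrow>\<^sub>L 'h) set \<Rightarrow> ('h \<Rightarrow>\<^sub>L 'h :: complex_hilbert_space) set" where
  "commutant A = {T \<in> bounded_ops. \<forall>S\<in>A. T o\<^sub>L S = S o\<^sub>L T}"

definition von_neumann_algebra :: "('h \<Rightarrow>\<^sub>L 'h :: complex_hilbert_space) set \<Rightarrow> bool" where
  "von_neumann_algebra A \<longleftrightarrow>
     A \<subseteq> bounded_ops \<and>
     (\<forall>T\<in>A. \<exists>T'\<in>A. is_adjoint T T') \<and>
     commutant (commutant A) = A"

definition factor :: "('h \<Rightarrow>\<^sub>L 'h :: complex_hilbert_space) set \<Rightarrow> bool" where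
  "factor A \<longleftrightarrow>
     von_neumann_algebra A \<and>
     (id_blinfun :: 'h \<Rightarrow>\<^sub>L 'h) \<noteq> 0 \<and>
     A \<inter> commutant A = range (\<lambda>c. scaleC_op c id_blinfun)"

definition projection_in :: "('h \<Rightarrow>\<^sub>L 'h :: complex_hilbert_space) set \<Rightarrow> ('h \<Rightarrow>\<^sub>L 'h) \<Rightarrow> bool" where
  "projection_in A p \<longleftrightarrow> p \<in> A \<and> p o\<^sub>L p = p \<and> is_adjoint p p"

definition abelian_projection_in ::
  "('h \<Rightarrow>\<^sub>L 'h :: complex_hilbert_space) set \<Rightarrow> ('h \<Rightarrow>\<^sub>L 'h) \<Rightarrow> bool" where
  "abelian_projection_in A p \<longleftrightarrow>
     projection_in A p \<and>
     (\<forall>x\<in>A. \<forall>y\<in>A. (p o\<^sub>L x o\<^sub>L p) o\<^sub>L (p o\<^sub>L y o\<^sub>L p) = (p o\<^sub>L y o\<^sub>L p) o\<^sub>L (p o\<^sub>L x o\<^sub>L p))"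

text \<open>Finiteness: the identity is a finite projection, i.e. every isometry in the algebra is
  unitary.\<close>

definition finite_vn :: "('h \<Rightarrow>\<^sub>L 'h :: complex_hilbert_space) set \<Rightarrow> bool" where
  "finite_vn A \<longleftrightarrow>
     (\<forall>v\<in>A. \<forall>v'\<in>A. is_adjoint v v' \<and> v' o\<^sub>L v = id_blinfun \<longrightarrow> v o\<^sub>L v' = id_blinfun)"

definition II1_factor :: "('h \<Rightarrow>\<^sub>L 'h :: complex_hilbert_space) set \<Rightarrow> bool" where
  "II1_factor A \<longleftrightarrow>
     factor A \<and> finite_vn A \<and> (\<forall>p. abelian_projection_in A p \<longrightarrow> p = 0)"


section \<open>Outer actions\<close>

text \<open>Only the values of an automorphism on the algebra itself are relevant.\<close>

definition star_automorphism ::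
  "('h \<Rightarrow>\<^sub>L 'h :: complex_hilbert_space) set \<Rightarrow> (('h \<Rightarrow>\<^sub>L 'h) \<Rightarrow> ('h \<Rightarrow>\<^sub>L 'h)) \<Rightarrow> bool" where
  "star_automorphism A \<theta> \<longleftrightarrow>
     bij_betw \<theta> A A \<and>
     (\<forall>x\<in>A. \<forall>y\<in>A. \<theta> (x + y) = \<theta> x + \<theta> y) \<and>
     (\<forall>c. \<forall>x\<in>A. \<theta> (scaleC_op c x) = scaleC_op c (\<theta> x)) \<and>
     (\<forall>x\<in>A. \<forall>y\<in>A. \<theta> (x o\<^sub>L y) = \<theta> x o\<^sub>L \<theta> y) \<and>
     (\<forall>x\<in>A. \<forall>x'\<in>A. is_adjoint x x' \<longrightarrow> is_adjoint (\<theta> x) (\<theta> x'))"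

definition inner_automorphism ::
  "('h \<Rightarrow>\<^sub>L 'h :: complex_hilbert_space) set \<Rightarrow> (('h \<Rightarrow>\<^sub>L 'h) \<Rightarrow> ('h \<Rightarrow>\<^sub>L 'h)) \<Rightarrow> bool" where
  "inner_automorphism A \<theta> \<longleftrightarrow>
     (\<exists>u\<in>A. \<exists>u'\<in>A. is_adjoint u u' \<and> u' o\<^sub>L u = id_blinfun \<and> u o\<^sub>L u' = id_blinfun \<and>
        (\<forall>x\<in>A. \<theta> x = u o\<^sub>L x o\<^sub>L u'))"

definition group_action_on ::
  "('g, 'm) monoid_scheme \<Rightarrow> ('h \<Rightarrow>\<^sub>L 'h :: complex_hilbert_space) set
     \<Rightarrow> ('g \<Rightarrow> ('h \<Rightarrow>\<^sub>L 'h) \<Rightarrow> ('h \<Rightarrow>\<^sub>L 'h)) \<Rightarrow> bool" where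
  "group_action_on G A \<alpha> \<longleftrightarrow>
     (\<forall>g\<in>carrier G. star_automorphism A (\<alpha> g)) \<and>
     (\<forall>g\<in>carrier G. \<forall>h\<in>carrier G. \<forall>x\<in>A. \<alpha> (g \<otimes>\<^bsub>G\<^esub> h) x = \<alpha> g (\<alpha> h x))"

definition outer_action ::
  "('g, 'm) monoid_scheme \<Rightarrow> ('h \<Rightarrow>\<^sub>L 'h :: complex_hilbert_space) set
     \<Rightarrow> ('g \<Rightarrow> ('h \<Rightarrow>\<^sub>L 'h) \<Rightarrow> ('h \<Rightarrow>\<^sub>L 'h)) \<Rightarrow> bool" where
  "outer_action G A \<alpha> \<longleftrightarrow>
     group_action_on G A \<alpha> \<and>
     (\<forall>g\<in>carrier G. g \<noteq> \<one>\<^bsub>G\<^esub> \<longrightarrow> \<not> inner_automorphism A (\<alpha> g))"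

definition fixed_points ::
  "'g set \<Rightarrow> ('h \<Rightarrow>\<^sub>L 'h :: complex_hilbert_space) set
     \<Rightarrow> ('g \<Rightarrow> ('h \<Rightarrow>\<^sub>L 'h) \<Rightarrow> ('h \<Rightarrow>\<^sub>L 'h)) \<Rightarrow> ('h \<Rightarrow>\<^sub>L 'h) set" where
  "fixed_points H A \<alpha> = {x \<in> A. \<forall>h\<in>H. \<alpha> h x = x}"


section \<open>Index sets\<close>

text \<open>Tuples are lists, so that appending an entry gives \<open>S\<^sub>n\<^sub>+\<^sub>1 = S\<^sub>n \<times> L\<^sub>n\<close>
  and prepending one gives \<open>S\<^sub>n = K \<times> T\<^sub>n\<^sub>-\<^sub>1\<close>; the empty list is the single
  element of \<open>S\<^sub>0 = T\<^sub>0\<close>.\<close>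

definition Lgrp :: "'g set \<Rightarrow> 'g set \<Rightarrow> nat \<Rightarrow> 'g set" where
  "Lgrp H K n = (if even n then K else H)"

definition Sset :: "'g set \<Rightarrow> 'g set \<Rightarrow> nat \<Rightarrow> 'g list set" where
  "Sset H K n = {s. length s = n \<and> (\<forall>i<n. s ! i \<in> (if even i then K else H))}"

definition Tset :: "'g set \<Rightarrow> 'g set \<Rightarrow> nat \<Rightarrow> 'g list set" where
  "Tset H K n = {t. length t = n \<and> (\<forall>i<n. t ! i \<in> (if even i then H else K))}"

lemma Sset_Suc: "Sset H K (Suc n) = {s @ [a] | s a. s \<in> Sset H K n \<and> a \<in> Lgrp H K n}"
proof (intro Set.set_eqI iffI)
  fix u assume u: "u \<in> Sset H K (Suc n)"
  then obtain s a where sa: "u = s @ [a]" "length s = n"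
    by (auto simp: Sset_def length_Suc_conv_rev)
  have "s ! i \<in> (if even i then K else H)" if "i < n" for i
    using u sa that by (fastforce simp: Sset_def nth_append dest: spec [of _ i])
  moreover have "a \<in> Lgrp H K n"
    using u sa by (auto simp: Sset_def Lgrp_def nth_append dest: spec [of _ n])
  ultimately show "u \<in> {s @ [a] | s a. s \<in> Sset H K n \<and> a \<in> Lgrp H K n}"
    using sa by (auto simp: Sset_def)
next
  fix u assume "u \<in> {s @ [a] | s a. s \<in> Sset H K n \<and> a \<in> Lgrp H K n}"
  then show "u \<in> Sset H K (Suc n)"
    by (auto simp: Sset_def Lgrp_def nth_append less_Suc_eq)
qed

lemma Sset_Suc_Tset: "Sset H K (Suc n) = {k # t | k t. k \<in> K \<and> t \<in> Tset H K n}"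
  by (auto simp: Sset_def Tset_def length_Suc_conv nth_Cons All_less_Suc2)

definition mu :: "('g, 'm) monoid_scheme \<Rightarrow> 'g list \<Rightarrow> 'g" where
  "mu G s = foldr (\<lambda>a b. a \<otimes>\<^bsub>G\<^esub> b) s \<one>\<^bsub>G\<^esub>"


section \<open>The realization of the tower\<close>

text \<open>For a finite group \<open>L\<close> every element of \<open>P \<rtimes> L\<close> is uniquely a finite
  sum \<open>\<Sum> x\<^sub>l l\<close> with \<open>x\<^sub>l \<in> P\<close>, where \<open>l x l\<^sup>-\<^sup>1 = l(x)\<close>.
  Accordingly \<open>f\<close> stands for the sum of all
  \<open>E\<^sub>s\<^sub>,\<^sub>t \<otimes> (f s t l) l\<close>, with zero coefficients outside
  \<open>S\<^sub>n \<times> S\<^sub>n \<times> L\<^sub>n\<close>. Addition is the pointwise one; the pointwise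
  product of functions is not used.\<close>

type_synonym ('g, 'h) elt = "'g list \<Rightarrow> 'g list \<Rightarrow> 'g \<Rightarrow> ('h \<Rightarrow>\<^sub>L 'h)"

definition scaleC_elt ::
  "complex \<Rightarrow> ('g, 'h) elt \<Rightarrow> ('g, 'h :: complex_hilbert_space) elt" where
  "scaleC_elt c f = (\<lambda>s t l. scaleC_op c (f s t l))"

lemma vector_space_scaleC_elt:
  "vector_space (scaleC_elt :: complex \<Rightarrow> ('g, 'h) elt \<Rightarrow> ('g, 'h :: complex_hilbert_space) elt)"
proof
  fix a b :: complex and x y :: "('g, 'h) elt"
  show "scaleC_elt a (x + y) = scaleC_elt a x + scaleC_elt a y"
    by (intro ext blinfun_eqI)
      (simp add: scaleC_elt_def scaleC_op_apply blinfun.add_left scaleC_add_right)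
  show "scaleC_elt (a + b) x = scaleC_elt a x + scaleC_elt b x"
    by (intro ext blinfun_eqI)
      (simp add: scaleC_elt_def scaleC_op_apply blinfun.add_left scaleC_add_left)
  show "scaleC_elt a (scaleC_elt b x) = scaleC_elt (a * b) x"
    by (intro ext blinfun_eqI) (simp add: scaleC_elt_def scaleC_op_apply scaleC_scaleC)
  show "scaleC_elt 1 x = x"
    by (intro ext blinfun_eqI)
      (use scaleC_of_real [of 1] in \<open>simp add: scaleC_elt_def scaleC_op_apply\<close>)
qed

abbreviation cspan :: "('g, 'h) elt set \<Rightarrow> ('g, 'h :: complex_hilbert_space) elt set" where
  "cspan \<equiv> module.span scaleC_elt"

text \<open>\<open>unit_el s t x l\<close> is \<open>E\<^sub>s\<^sub>,\<^sub>t \<otimes> x l\<close>.\<close>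

definition unit_el ::
  "'g list \<Rightarrow> 'g list \<Rightarrow> ('h \<Rightarrow>\<^sub>L 'h) \<Rightarrow> 'g \<Rightarrow> ('g, 'h :: complex_hilbert_space) elt" where
  "unit_el s t x l = (\<lambda>s' t' l'. if s' = s \<and> t' = t \<and> l' = l then x else 0)"

definition tower ::
  "'g set \<Rightarrow> 'g set \<Rightarrow> ('h \<Rightarrow>\<^sub>L 'h :: complex_hilbert_space) set \<Rightarrow> nat \<Rightarrow> ('g, 'h) elt set" where
  "tower H K P n =
     {f. \<forall>s t l. f s t l \<in> P \<and>
        (\<not> (s \<in> Sset H K n \<and> t \<in> Sset H K n \<and> l \<in> Lgrp H K n) \<longrightarrow> f s t l = 0)}"

text \<open>The product determined by
  \<open>(E\<^sub>s\<^sub>,\<^sub>r \<otimes> x a) (E\<^sub>r\<^sub>,\<^sub>t \<otimes> y b) = E\<^sub>s\<^sub>,\<^sub>t \<otimes> x a(y) ab\<close>.\<close>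

definition tower_mult ::
  "('g, 'm) monoid_scheme \<Rightarrow> 'g set \<Rightarrow> 'g set \<Rightarrow> ('g \<Rightarrow> ('h \<Rightarrow>\<^sub>L 'h) \<Rightarrow> ('h \<Rightarrow>\<^sub>L 'h))
     \<Rightarrow> nat \<Rightarrow> ('g, 'h) elt \<Rightarrow> ('g, 'h) elt \<Rightarrow> ('g, 'h :: complex_hilbert_space) elt" where
  "tower_mult G H K \<alpha> n f g =
     (\<lambda>s t l.
        if s \<in> Sset H K n \<and> t \<in> Sset H K n \<and> l \<in> Lgrp H K n
        then \<Sum>r\<in>Sset H K n. \<Sum>a\<in>Lgrp H K n. f s r a o\<^sub>L \<alpha> a (g r t (inv\<^bsub>G\<^esub> a \<otimes>\<^bsub>G\<^esub> l))
        else 0)"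

text \<open>The inclusion of level \<open>n\<close> into level \<open>n + 1\<close>. Each summand
  \<open>E\<^sub>s\<^sub>,\<^sub>t \<otimes> x l\<close>, where \<open>x = f s t l\<close>, is the product of
  \<open>E\<^sub>s\<^sub>,\<^sub>t \<otimes> x\<close>, which goes to
  \<open>\<Sum>\<^sub>a E\<^sub>s\<^sub>,\<^sub>t \<otimes> E\<^sub>a\<^sub>,\<^sub>a \<otimes> a\<^sup>-\<^sup>1(x)\<close>,
  and \<open>E\<^sub>t\<^sub>,\<^sub>t \<otimes> l\<close>, which goes to
  \<open>\<Sum>\<^sub>a E\<^sub>t\<^sub>,\<^sub>t \<otimes> E\<^sub>l\<^sub>a\<^sub>,\<^sub>a \<otimes> 1\<close>.\<close>

definition tower_incl ::
  "('g, 'm) monoid_scheme \<Rightarrow> 'g set \<Rightarrow> 'g set \<Rightarrow> ('g \<Rightarrow> ('h \<Rightarrow>\<^sub>L 'h) \<Rightarrow> ('h \<Rightarrow>\<^sub>L 'h))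
     \<Rightarrow> nat \<Rightarrow> ('g, 'h) elt \<Rightarrow> ('g, 'h :: complex_hilbert_space) elt" where
  "tower_incl G H K \<alpha> n f =
     (\<Sum>s\<in>Sset H K n. \<Sum>t\<in>Sset H K n. \<Sum>l\<in>Lgrp H K n.
        tower_mult G H K \<alpha> (Suc n)
          (\<Sum>a\<in>Lgrp H K n. unit_el (s @ [a]) (t @ [a]) (\<alpha> (inv\<^bsub>G\<^esub> a) (f s t l)) \<one>\<^bsub>G\<^esub>)
          (\<Sum>a\<in>Lgrp H K n. unit_el (t @ [l \<otimes>\<^bsub>G\<^esub> a]) (t @ [a]) id_blinfun \<one>\<^bsub>G\<^esub>))"

text \<open>The inclusion of \<open>M = M\<^sub>0\<close> into \<open>M\<^sub>n\<close>.\<close>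

primrec tower_embed ::
  "('g, 'm) monoid_scheme \<Rightarrow> 'g set \<Rightarrow> 'g set \<Rightarrow> ('g \<Rightarrow> ('h \<Rightarrow>\<^sub>L 'h) \<Rightarrow> ('h \<Rightarrow>\<^sub>L 'h))
     \<Rightarrow> nat \<Rightarrow> ('g, 'h) elt \<Rightarrow> ('g, 'h :: complex_hilbert_space) elt" where
  "tower_embed G H K \<alpha> 0 f = f"
| "tower_embed G H K \<alpha> (Suc n) f = tower_incl G H K \<alpha> n (tower_embed G H K \<alpha> n f)"

definition subfactor_M ::
  "'g set \<Rightarrow> 'g set \<Rightarrow> ('h \<Rightarrow>\<^sub>L 'h :: complex_hilbert_space) set \<Rightarrow> ('g, 'h) elt set" where
  "subfactor_M H K P = tower H K P 0"

definition subfactor_N ::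
  "('g, 'm) monoid_scheme \<Rightarrow> 'g set \<Rightarrow> ('h \<Rightarrow>\<^sub>L 'h :: complex_hilbert_space) set
     \<Rightarrow> ('g \<Rightarrow> ('h \<Rightarrow>\<^sub>L 'h) \<Rightarrow> ('h \<Rightarrow>\<^sub>L 'h)) \<Rightarrow> ('g, 'h) elt set" where
  "subfactor_N G H P \<alpha> = (\<lambda>x. unit_el [] [] x \<one>\<^bsub>G\<^esub>) ` fixed_points H P \<alpha>"

text \<open>\<open>B' \<inter> A\<close> with respect to a given product.\<close>

definition relative_commutant :: "('e \<Rightarrow> 'e \<Rightarrow> 'e) \<Rightarrow> 'e set \<Rightarrow> 'e set \<Rightarrow> 'e set" where
  "relative_commutant m B A = {a \<in> A. \<forall>b\<in>B. m a b = m b a}"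

end

(*
  Entry by entry, an element of M_n commutes with N iff each coefficient f(s,t,l), moved by
  mu(s), is some y in P with y g(x) = x y for all x in P^H, where g = mu(s) l mu(t)^-1. Writing
  x as the sum of h(z) over h in H yields a relation sum_i a_i s_i(z) b_i = 0 on all of P, with
  automorphisms s_i from the action. For such a relation consider, in a finite direct sum of copies
  of the Hilbert space, the projection onto the orthogonal complement of the vectors
  (s_i(z) b_i xi)_i: by the bicommutant theorem its matrix entries lie in P, they intertwine the
  s_i, and by outerness they are scalars vanishing unless s_i = s_j. This forces y to be a scalar,
  and y = 0 unless g lies in H. For M the same argument with H replaced by the trivial group
  treats P, and commuting with the group K in addition makes the coefficients invariant under
  translation of the first coordinate.
*)
theory Submission
  imports Defs
begin

section \<open>Semi-inner products and the Riesz representation\<close>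

text \<open>An operator intertwining the elements of P^H need not intertwine those of P, so
  outerness says nothing about y directly; averages over H bring all of P back, at the price of
  several automorphisms in one relation. No single term of such a relation can be isolated
  algebraically, which is why it is read as a statement about vectors: the projection fixes (a_i^*
  eta)_i and kills (b_i xi)_i. Once its matrix q is known to be scalar, this leaves linear equations
  over the complex numbers, q a^* = a^* and q b = 0. The row of q at the automorphism g couples at
  most two terms of y g(x) = x y: the one with g on the left side and, when g lies in H, the one
  with g on the right side. Two equations in y and its adjoint remain, and they give the claim.

  The Riesz representation serves twice: for the projection, and for adjoints of operators in the
  commutant of P. In the tower, every element of M has its coefficients at the unit of the crossed
  product from level 1 on, so products with it are essentially matrix products.\<close>

locale semi_inner =
  fixes sm :: "complex \<Rightarrow> 'v::ab_group_add \<Rightarrow> 'v" and ip :: "'v \<Rightarrow> 'v \<Rightarrow> complex"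
  assumes ip_add_left: "ip (x + y) z = ip x z + ip y z"
    and ip_sm_left: "ip (sm c x) y = c * ip x y"
    and ip_commute: "ip x y = cnj (ip y x)"
    and ip_nonneg: "0 \<le> Re (ip x x)"
begin

lemma ip_add_right: "ip x (y + z) = ip x y + ip x z"
  using ip_add_left [of y z x] ip_commute [of x y] ip_commute [of x z] ip_commute [of x "y + z"]
  by simp

lemma ip_sm_right: "ip x (sm c y) = cnj c * ip x y"
  using ip_sm_left [of c y x] ip_commute [of x y] ip_commute [of x "sm c y"] by simp

lemma ip_zero_left: "ip 0 z = 0"
  using ip_add_left [of 0 0 z] by simp

lemma ip_minus_left: "ip (- x) z = - ip x z"
  using ip_add_left [of x "- x" z] by (simp add: ip_zero_left add_eq_0_iff2)

lemma ip_diff_left: "ip (x - y) z = ip x z - ip y z"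
  using ip_add_left [of x "- y" z] by (simp add: ip_minus_left)

lemma ip_diff_right: "ip z (x - y) = ip z x - ip z y"
  using ip_diff_left [of x y z] ip_commute [of z x] ip_commute [of z y] ip_commute [of z "x - y"]
  by simp

lemma ip_zero_right: "ip z 0 = 0"
  using ip_diff_right [of z 0 0] by simp

lemma ip_minus_right: "ip z (- x) = - ip z x"
  using ip_diff_right [of z 0 x] by (simp add: ip_zero_right)

lemma Re_ip_commute: "Re (ip x y) = Re (ip y x)"
  by (subst ip_commute) simp

text \<open>The form is nonnegative at x - t <x, y> y for all real t; this is a parabola in t,
  evaluated at its minimum 1 / <y, y>.\<close>

lemma cauchy_schwarz: "(cmod (ip x y))\<^sup>2 \<le> Re (ip x x) * Re (ip y y)"
proof -
  let ?z = "ip x y"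
  have quad: "0 \<le> Re (ip x x) - 2 * t * (cmod ?z)\<^sup>2 + t\<^sup>2 * (cmod ?z)\<^sup>2 * Re (ip y y)" for t :: real
  proof -
    \<comment> \<open>The factor \<open>?z\<close> makes both cross terms the same real number, so a
      real parameter suffices.\<close>
    let ?c = "- of_real t * ?z"
    have im: "Im (ip y y) = 0"
      using ip_commute [of y y] by (simp add: complex_eq_iff)
    have "ip (x + sm ?c y) (x + sm ?c y)
        = ip x x + cnj ?c * ?z + ?c * cnj ?z + ?c * cnj ?c * ip y y"
      using ip_commute [of y x]
      by (simp add: ip_add_left ip_add_right ip_sm_left ip_sm_right algebra_simps)
    also have "\<dots> = ip x x - of_real (2 * t * (cmod ?z)\<^sup>2) + of_real (t\<^sup>2 * (cmod ?z)\<^sup>2) * ip y y"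
      by (simp add: complex_norm_square [symmetric] mult.assoc [symmetric] del: of_real_power)
        (simp add: complex_norm_square [symmetric] power2_eq_square algebra_simps)
    finally have "Re (ip (x + sm ?c y) (x + sm ?c y))
        = Re (ip x x) - 2 * t * (cmod ?z)\<^sup>2 + t\<^sup>2 * (cmod ?z)\<^sup>2 * Re (ip y y)"
      using im by simp
    then show ?thesis
      using ip_nonneg by metis
  qed
  show ?thesis
  proof (cases "Re (ip y y) = 0")
    case True
    show ?thesis
    proof (rule ccontr)
      assume "\<not> ?thesis"
      then have pos: "(cmod ?z)\<^sup>2 > 0" using True by simp
      \<comment> \<open>Without a quadratic term the parabola is a line, and at the chosen t its
        value is - Re <x, x> - 2.\<close>
      show False
        using quad [of "(Re (ip x x) + 1) / (cmod ?z)\<^sup>2"] pos True ip_nonneg [of x] by auto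
    qed
  next
    case False
    then have pos: "Re (ip y y) > 0" using ip_nonneg [of y] by simp
    show ?thesis
      using quad [of "1 / Re (ip y y)"] pos by (simp add: field_simps power2_eq_square)
  qed
qed

lemma ip_tendsto_left:
  assumes "(\<lambda>n. Re (ip (X n - p) (X n - p))) \<longlonglongrightarrow> 0"
  shows "(\<lambda>n. ip (X n) v) \<longlonglongrightarrow> ip p v"
proof -
  have "(\<lambda>n. Re (ip (X n - p) (X n - p)) * Re (ip v v)) \<longlonglongrightarrow> 0"
    using tendsto_mult_left_zero [OF assms] .
  then have "(\<lambda>n. (cmod (ip (X n - p) v))\<^sup>2) \<longlonglongrightarrow> 0"
    by (rule tendsto_sandwich [rotated 3, where f = "\<lambda>_. 0"])
      (auto intro: always_eventually cauchy_schwarz)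
  then have "(\<lambda>n. sqrt ((cmod (ip (X n - p) v))\<^sup>2)) \<longlonglongrightarrow> 0"
    using tendsto_real_sqrt [of _ 0] by fastforce
  then have "(\<lambda>n. ip (X n) v - ip p v) \<longlonglongrightarrow> 0"
    by (simp add: tendsto_norm_zero_iff ip_diff_left)
  then show ?thesis
    using LIM_zero_iff by blast
qed

text \<open>The representing vector minimizes \<open>\<langle>v, v\<rangle> - 2 Re (\<phi> v)\<close>; by the parallelogram law
  a minimizing sequence is a Cauchy sequence.\<close>

lemma riesz:
  assumes V0: "0 \<in> V"
    and Vadd: "\<And>u v. u \<in> V \<Longrightarrow> v \<in> V \<Longrightarrow> u + v \<in> V"
    and Vsm: "\<And>c v. v \<in> V \<Longrightarrow> sm c v \<in> V"
    and complete: "\<And>X. (\<And>n. X n \<in> V) \<Longrightarrow>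
      (\<And>e. e > 0 \<Longrightarrow> \<exists>N::nat. \<forall>m\<ge>N. \<forall>n\<ge>N. Re (ip (X m - X n) (X m - X n)) < e) \<Longrightarrow>
      \<exists>p\<in>V. (\<lambda>n. Re (ip (X n - p) (X n - p))) \<longlonglongrightarrow> 0"
    and padd: "\<And>u v. u \<in> V \<Longrightarrow> v \<in> V \<Longrightarrow> \<phi> (u + v) = \<phi> u + \<phi> v"
    and psm: "\<And>c v. v \<in> V \<Longrightarrow> \<phi> (sm c v) = c * \<phi> v"
    and bound: "\<And>v. v \<in> V \<Longrightarrow> (cmod (\<phi> v))\<^sup>2 \<le> C * Re (ip v v)" and C: "0 \<le> C"
  shows "\<exists>p\<in>V. \<forall>v\<in>V. \<phi> v = ip v p"
proof -
  define F where "F v = Re (ip v v) - 2 * Re (\<phi> v)" for v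
  \<comment> \<open>The inequality of arithmetic and geometric means gives 2 |\<phi> v| \<le> C +
    <v, v>, so \<open>F\<close> has an infimum.\<close>
  have Fbound: "- C \<le> F v" if "v \<in> V" for v
  proof -
    have "(Re (\<phi> v))\<^sup>2 \<le> (cmod (\<phi> v))\<^sup>2"
      by (simp add: cmod_power2)
    with bound [OF that] have s: "(Re (\<phi> v))\<^sup>2 \<le> C * Re (ip v v)" by linarith
    have "4 * (C * Re (ip v v)) \<le> (C + Re (ip v v))\<^sup>2"
      using zero_le_power2 [of "C - Re (ip v v)"] by (simp add: power2_eq_square algebra_simps)
    then have "(2 * Re (\<phi> v))\<^sup>2 \<le> (C + Re (ip v v))\<^sup>2"
      using s by (simp add: power_mult_distrib)
    moreover have "0 \<le> C + Re (ip v v)"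
      using C ip_nonneg [of v] by simp
    ultimately show ?thesis
      using abs_le_square_iff [of "2 * Re (\<phi> v)" "C + Re (ip v v)"] by (simp add: F_def)
  qed
  define m where "m = Inf (F ` V)"
  have bdd: "bdd_below (F ` V)" using Fbound by (auto simp: bdd_below_def)
  have m: "m \<le> F v" if "v \<in> V" for v
    unfolding m_def using bdd that by (simp add: cInf_lower)
  have "\<exists>v\<in>V. F v < m + 1 / real (Suc n)" for n
    using cInf_lessD [of "F ` V" "m + 1 / real (Suc n)"] V0 unfolding m_def by auto
  then obtain X where X: "X n \<in> V" "F (X n) < m + 1 / real (Suc n)" for n
    by metis
  have cauchy: "Re (ip (u - v) (u - v)) \<le> 2 * (F u + F v - 2 * m)" if "u \<in> V" "v \<in> V" for u v
  proof -
    \<comment> \<open>The midpoint cannot go below the infimum \<open>m\<close>, which bounds u - v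
      through the parallelogram law.\<close>
    let ?w = "sm (1/2) (u + v)"
    have "F ?w = 1/4 * Re (ip (u + v) (u + v)) - Re (\<phi> u) - Re (\<phi> v)"
      by (simp add: F_def psm padd Vadd that ip_sm_left ip_sm_right field_simps)
    moreover have "m \<le> F ?w" using m Vsm Vadd that by blast
    ultimately show ?thesis
      by (simp add: F_def ip_add_left ip_add_right ip_diff_left ip_diff_right algebra_simps)
  qed
  have "\<exists>p\<in>V. (\<lambda>n. Re (ip (X n - p) (X n - p))) \<longlonglongrightarrow> 0"
  proof (rule complete)
    fix e :: real assume e: "e > 0"
    obtain N where N: "1 / real (Suc N) < e / 4"
      using reals_Archimedean [of "e / 4"] e by (auto simp: inverse_eq_divide)
    have le: "F (X k) < m + e / 4" if "N \<le> k" for k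
    proof -
      have "1 / real (Suc k) \<le> 1 / real (Suc N)" using that by (simp add: field_simps)
      then show ?thesis using X(2) [of k] N by linarith
    qed
    have "Re (ip (X i - X j) (X i - X j)) < e" if "N \<le> i" "N \<le> j" for i j
      using cauchy [OF X(1) X(1), of i j] le [OF that(1)] le [OF that(2)] by simp
    then show "\<exists>N. \<forall>i\<ge>N. \<forall>j\<ge>N. Re (ip (X i - X j) (X i - X j)) < e" by blast
  qed (rule X)
  then obtain p where p: "p \<in> V" and lim: "(\<lambda>n. Re (ip (X n - p) (X n - p))) \<longlonglongrightarrow> 0" by blast
  have re: "Re (\<phi> v) = Re (ip v p)" if v: "v \<in> V" for v
  proof -
    define d where "d = Re (ip p v) - Re (\<phi> v)"
    \<comment> \<open>Perturbing \<open>X n\<close> by t v cannot go below \<open>m\<close> either.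
      The summand 1 / (n + 1) is the error with which \<open>X n\<close> attains the infimum, and it
      vanishes in the limit.\<close>
    have ineq: "0 \<le> t\<^sup>2 * Re (ip v v) + 2 * t * d" for t :: real
    proof -
      let ?f = "\<lambda>n. t\<^sup>2 * Re (ip v v) + 2 * t * (Re (ip (X n) v) - Re (\<phi> v)) + 1 / real (Suc n)"
      have "?f \<longlonglongrightarrow> t\<^sup>2 * Re (ip v v) + 2 * t * d + 0"
        unfolding d_def
        by (intro tendsto_intros ip_tendsto_left lim LIMSEQ_Suc lim_1_over_n)
      moreover have "0 \<le> ?f n" for n
      proof -
        have "F (X n + sm (of_real t) v)
          = F (X n) + t\<^sup>2 * Re (ip v v) + 2 * t * (Re (ip (X n) v) - Re (\<phi> v))"
          using Re_ip_commute [of v "X n"]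
          by (simp add: F_def psm padd Vsm X v ip_add_left ip_add_right ip_sm_left ip_sm_right
              power2_eq_square algebra_simps)
        then show ?thesis
          using m [OF Vadd [OF X(1) Vsm [OF v]], of n "of_real t"] X(2) [of n] by simp
      qed
      ultimately show ?thesis
        using LIMSEQ_le_const [of ?f] by fastforce
    qed
    have "d = 0"
    proof (rule ccontr)
      assume d: "d \<noteq> 0"
      \<comment> \<open>The summand 1 keeps the denominator positive when <v, v> = 0, which a
        semidefinite form allows for nonzero v.\<close>
      let ?N = "Re (ip v v) + 1"
      have N: "?N > 0" using ip_nonneg [of v] by simp
      define t where "t = - d / ?N"
      have t: "t \<noteq> 0" "d = - t * ?N" using N d by (auto simp: t_def)
      have "t\<^sup>2 * Re (ip v v) + 2 * t * d = - (t\<^sup>2 * (Re (ip v v) + 2))"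
        by (simp add: t(2) power2_eq_square algebra_simps)
      also have "\<dots> < 0" using t(1) N by simp
      finally show False using ineq [of t] by linarith
    qed
    then show ?thesis using Re_ip_commute [of p v] by (simp add: d_def)
  qed
  \<comment> \<open>The real part at i v is minus the imaginary part at v, so \<open>re\<close> at
    both vectors determines the complex value.\<close>
  have "\<phi> v = ip v p" if v: "v \<in> V" for v
    using re [OF v] re [OF Vsm [OF v], of \<i>] by (simp add: complex_eq_iff psm v ip_sm_left)
  with p show ?thesis by blast
qed

end

section \<open>Complex Hilbert spaces\<close>

interpretation hilb: semi_inner scaleC "cinner :: 'h \<Rightarrow> 'h :: complex_hilbert_space \<Rightarrow> complex"
  by unfold_locales
    (rule cinner_add_left, rule cinner_scaleC_left, rule cinner_commute, simp add: cinner_self)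

lemma Re_cinner_self: "Re (cinner x x) = (norm x)\<^sup>2"
  by (simp add: cinner_self)

lemma cmod_cinner_le: "cmod (cinner x y) \<le> norm x * norm y"
  using hilb.cauchy_schwarz [of x y] unfolding Re_cinner_self
  by - (rule power2_le_imp_le, simp_all add: power_mult_distrib)

lemma scaleC_one [simp]: "scaleC 1 x = x"
  using scaleC_of_real [of 1 x] by simp

lemma scaleC_zero_left [simp]: "scaleC 0 x = 0"
  using scaleC_of_real [of 0 x] by simp

lemma scaleC_zero_right [simp]: "scaleC c 0 = 0"
  using scaleC_scaleC [of c 0 0] by simp

lemma cinner_extensional:
  assumes "\<And>z. cinner x z = cinner y z"
  shows "x = y"
proof -
  have "cinner (x - y) (x - y) = 0"
    using assms [of "x - y"] by (simp only: hilb.ip_diff_left diff_self)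
  then show "x = y" by (simp add: cinner_self)
qed

lemma cinner_extensional':
  assumes "\<And>z. cinner z x = cinner z y"
  shows "x = y"
proof (rule cinner_extensional)
  show "cinner x z = cinner y z" for z
    using assms [of z] cinner_commute [of x z] cinner_commute [of y z] by simp
qed

section \<open>Finite direct sums of a Hilbert space\<close>

lemma semi_inner_fun:
  "semi_inner (\<lambda>c v i. scaleC c (v i))
     (\<lambda>u v :: 'i \<Rightarrow> 'h :: complex_hilbert_space. \<Sum>i\<in>I. cinner (u i) (v i))"
proof
  fix x y z :: "'i \<Rightarrow> 'h" and c
  show "(\<Sum>i\<in>I. cinner ((x + y) i) (z i)) = (\<Sum>i\<in>I. cinner (x i) (z i)) + (\<Sum>i\<in>I. cinner (y i) (z i))"
    by (simp add: cinner_add_left sum.distrib)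
  show "(\<Sum>i\<in>I. cinner (scaleC c (x i)) (y i)) = c * (\<Sum>i\<in>I. cinner (x i) (y i))"
    by (simp add: cinner_scaleC_left sum_distrib_left)
  show "(\<Sum>i\<in>I. cinner (x i) (y i)) = cnj (\<Sum>i\<in>I. cinner (y i) (x i))"
    unfolding cnj_sum by (intro sum.cong refl cinner_commute)
  show "0 \<le> Re (\<Sum>i\<in>I. cinner (x i) (x i))"
    by (simp add: Re_cinner_self sum_nonneg)
qed

text \<open>The direct sum over \<open>I\<close> is modelled inside the functions on the whole index
  type. Values outside \<open>I\<close> are invisible to the form, hence the setting of semidefinite
  forms.\<close>

definition fip :: "'i set \<Rightarrow> ('i \<Rightarrow> 'h) \<Rightarrow> ('i \<Rightarrow> 'h :: complex_hilbert_space) \<Rightarrow> complex" where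
  "fip I u v = (\<Sum>i\<in>I. cinner (u i) (v i))"

interpretation fh: semi_inner "\<lambda>c v i. scaleC c (v i)"
    "fip I :: ('i \<Rightarrow> 'h) \<Rightarrow> ('i \<Rightarrow> 'h :: complex_hilbert_space) \<Rightarrow> complex" for I
  unfolding fip_def by (rule semi_inner_fun)

text \<open>The support condition makes the form definite here, so that representing vectors are
  unique. With \<open>W\<close> empty this is the whole direct sum.\<close>

definition orth_compl :: "'i set \<Rightarrow> ('i \<Rightarrow> 'h) set \<Rightarrow> ('i \<Rightarrow> 'h :: complex_hilbert_space) set" where
  "orth_compl I W = {v. (\<forall>i. i \<notin> I \<longrightarrow> v i = 0) \<and> (\<forall>w\<in>W. fip I v w = 0)}"

lemma Re_fip_self: "Re (fip I u u) = (\<Sum>i\<in>I. (norm (u i))\<^sup>2)"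
  by (simp add: fip_def Re_cinner_self)

lemma orth_compl_zero: "0 \<in> orth_compl I W"
  by (simp add: orth_compl_def fh.ip_zero_left)

lemma orth_compl_add: "u \<in> orth_compl I W \<Longrightarrow> v \<in> orth_compl I W \<Longrightarrow> u + v \<in> orth_compl I W"
  by (simp add: orth_compl_def fh.ip_add_left)

lemma orth_compl_diff: "u \<in> orth_compl I W \<Longrightarrow> v \<in> orth_compl I W \<Longrightarrow> u - v \<in> orth_compl I W"
  by (simp add: orth_compl_def fh.ip_diff_left)

lemma orth_compl_scaleC: "v \<in> orth_compl I W \<Longrightarrow> (\<lambda>i. scaleC c (v i)) \<in> orth_compl I W"
  by (simp add: orth_compl_def fh.ip_sm_left)

text \<open>Convergence is coordinatewise. The limit is set to 0 outside \<open>I\<close> to meet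
  the support condition, and orthogonality to \<open>W\<close> survives because the form is
  continuous.\<close>

lemma orth_compl_complete:
  fixes X :: "nat \<Rightarrow> 'i \<Rightarrow> 'h :: complex_hilbert_space"
  assumes I: "finite I" and X: "\<And>n. X n \<in> orth_compl I W"
    and cauchy: "\<And>e. e > 0 \<Longrightarrow> \<exists>N. \<forall>m\<ge>N. \<forall>n\<ge>N. Re (fip I (X m - X n) (X m - X n)) < e"
  shows "\<exists>p\<in>orth_compl I W. (\<lambda>n. Re (fip I (X n - p) (X n - p))) \<longlonglongrightarrow> 0"
proof -
  have "Cauchy (\<lambda>n. X n i)" if i: "i \<in> I" for i
  proof (rule CauchyI)
    fix e :: real assume e: "0 < e"
    then obtain N where N: "\<forall>m\<ge>N. \<forall>n\<ge>N. Re (fip I (X m - X n) (X m - X n)) < e\<^sup>2"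
      using cauchy [of "e\<^sup>2"] by auto
    have "norm (X m i - X n i) < e" if "m \<ge> N" "n \<ge> N" for m n
    proof -
      have "(norm (X m i - X n i))\<^sup>2 \<le> Re (fip I (X m - X n) (X m - X n))"
        using member_le_sum [OF i, of "\<lambda>i. (norm (X m i - X n i))\<^sup>2"] I by (simp add: Re_fip_self)
      also have "\<dots> < e\<^sup>2" using N that by blast
      finally show ?thesis using e by (meson less_imp_le power_less_imp_less_base)
    qed
    then show "\<exists>M. \<forall>m\<ge>M. \<forall>n\<ge>M. norm (X m i - X n i) < e" by blast
  qed
  then have "\<forall>i. \<exists>l. (i \<in> I \<longrightarrow> (\<lambda>n. X n i) \<longlonglongrightarrow> l) \<and> (i \<notin> I \<longrightarrow> l = 0)"
    using Cauchy_convergent unfolding convergent_def by blast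
  then obtain p where p: "i \<in> I \<Longrightarrow> (\<lambda>n. X n i) \<longlonglongrightarrow> p i" "i \<notin> I \<Longrightarrow> p i = 0" for i
    by metis
  have "(\<lambda>n. \<Sum>i\<in>I. (norm (X n i - p i))\<^sup>2) \<longlonglongrightarrow> (\<Sum>i\<in>I. (norm (p i - p i))\<^sup>2)"
    by (intro tendsto_intros p)
  then have lim: "(\<lambda>n. Re (fip I (X n - p) (X n - p))) \<longlonglongrightarrow> 0"
    by (simp add: Re_fip_self)
  have "fip I p w = 0" if "w \<in> W" for w
  proof -
    have "(\<lambda>n. fip I (X n) w) \<longlonglongrightarrow> fip I p w"
      by (rule fh.ip_tendsto_left [OF lim])
    moreover have "fip I (X n) w = 0" for n
      using X that by (simp add: orth_compl_def)
    ultimately show ?thesis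
      using LIMSEQ_unique [of "\<lambda>_. 0" "fip I p w" 0] by simp
  qed
  then have "p \<in> orth_compl I W" using p(2) by (simp add: orth_compl_def)
  with lim show ?thesis by blast
qed

lemma orth_compl_riesz:
  fixes W :: "('i \<Rightarrow> 'h :: complex_hilbert_space) set"
  assumes I: "finite I"
    and add: "\<And>u v. u \<in> orth_compl I W \<Longrightarrow> v \<in> orth_compl I W \<Longrightarrow> \<phi> (u + v) = \<phi> u + \<phi> v"
    and sc: "\<And>c v. v \<in> orth_compl I W \<Longrightarrow> \<phi> (\<lambda>i. scaleC c (v i)) = c * \<phi> v"
    and bound: "\<And>v. v \<in> orth_compl I W \<Longrightarrow> (cmod (\<phi> v))\<^sup>2 \<le> C * Re (fip I v v)" and C: "0 \<le> C"
  shows "\<exists>p\<in>orth_compl I W. \<forall>v\<in>orth_compl I W. \<phi> v = fip I v p"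
  by (rule fh.riesz [OF orth_compl_zero orth_compl_add orth_compl_scaleC orth_compl_complete])
    (use assms in auto)

text \<open>The projection of \<open>u\<close> is the vector representing the functional v |-> <v,
  u> on the complement of \<open>W\<close>; neither the closed span of \<open>W\<close> nor an
  orthogonal decomposition has to be constructed.\<close>

lemma orth_projection:
  fixes u :: "'i \<Rightarrow> 'h :: complex_hilbert_space"
  assumes I: "finite I"
  shows "\<exists>!p. p \<in> orth_compl I W \<and> (\<forall>v\<in>orth_compl I W. fip I v u = fip I v p)"
proof (rule ex_ex1I)
  have "(cmod (fip I v u))\<^sup>2 \<le> Re (fip I u u) * Re (fip I v v)" for v
    using fh.cauchy_schwarz [of I v u] by (simp add: mult.commute)
  then have "\<exists>p\<in>orth_compl I W. \<forall>v\<in>orth_compl I W. fip I v u = fip I v p"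
    by (intro orth_compl_riesz [where C = "Re (fip I u u)"] I)
      (auto simp: fh.ip_add_left fh.ip_sm_left fh.ip_nonneg)
  then show "\<exists>p. p \<in> orth_compl I W \<and> (\<forall>v\<in>orth_compl I W. fip I v u = fip I v p)" by blast
next
  fix p p'
  assume p: "p \<in> orth_compl I W \<and> (\<forall>v\<in>orth_compl I W. fip I v u = fip I v p)"
    and p': "p' \<in> orth_compl I W \<and> (\<forall>v\<in>orth_compl I W. fip I v u = fip I v p')"
  have "p - p' \<in> orth_compl I W" using p p' by (simp add: orth_compl_diff)
  then have "fip I (p - p') (p - p') = 0"
    using p p' unfolding fh.ip_diff_right by fastforce
  then have "(\<Sum>i\<in>I. (norm (p i - p' i))\<^sup>2) = 0"
    using Re_fip_self [of I "p - p'"] by simp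
  then have "\<forall>i\<in>I. (norm (p i - p' i))\<^sup>2 = 0"
    using sum_nonneg_eq_0_iff [OF I, of "\<lambda>i. (norm (p i - p' i))\<^sup>2"] by simp
  then show "p = p'"
    using p p' by (intro ext) (auto simp: orth_compl_def)
qed

section \<open>Complex-linear bounded operators and their adjoints\<close>

lemma bounded_ops_scaleC: "T \<in> bounded_ops \<Longrightarrow> blinfun_apply T (scaleC c x) = scaleC c (blinfun_apply T x)"
  by (simp add: bounded_ops_def)

lemma bounded_opsI:
  fixes f :: "'h \<Rightarrow> 'h :: complex_hilbert_space"
  assumes "\<And>x y. f (x + y) = f x + f y" "\<And>c x. f (scaleC c x) = scaleC c (f x)"
    and "\<And>x. norm (f x) \<le> norm x * C"
  shows "\<exists>T\<in>bounded_ops. blinfun_apply T = f"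
proof -
  have "bounded_linear f"
    by (rule bounded_linear_intro [where K = C]) (use assms in \<open>auto simp: scaleC_of_real [symmetric]\<close>)
  then have "blinfun_apply (Blinfun f) = f" by (rule bounded_linear_Blinfun_apply)
  moreover from this have "Blinfun f \<in> bounded_ops" using assms(2) by (simp add: bounded_ops_def)
  ultimately show ?thesis by blast
qed

lemma is_adjoint_sym: "is_adjoint T T' \<Longrightarrow> is_adjoint T' T"
  unfolding is_adjoint_def
proof (intro allI)
  fix x y
  assume "\<forall>x y. cinner (blinfun_apply T x) y = cinner x (blinfun_apply T' y)"
  then have "cinner (blinfun_apply T y) x = cinner y (blinfun_apply T' x)" by blast
  then show "cinner (blinfun_apply T' x) y = cinner x (blinfun_apply T y)"
    using cinner_commute [of y "blinfun_apply T' x"] cinner_commute [of "blinfun_apply T y" x] by simp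
qed

text \<open>The value of the adjoint at y is the vector representing the functional x |-> <T x,
  y>.\<close>

lemma adjoint_exists:
  fixes T :: "'h \<Rightarrow>\<^sub>L 'h :: complex_hilbert_space"
  assumes T: "T \<in> bounded_ops"
  shows "\<exists>T'\<in>bounded_ops. is_adjoint T T'"
proof -
  have "\<exists>p. \<forall>x. cinner (blinfun_apply T x) y = cinner x p" for y
  proof -
    \<comment> \<open>The Hilbert space itself, as the direct sum over a one-point index type with
      no orthogonality condition.\<close>
    let ?V = "orth_compl UNIV {} :: (unit \<Rightarrow> 'h) set"
    have "\<exists>p\<in>?V. \<forall>v\<in>?V. cinner (blinfun_apply T (v ())) y = fip UNIV v p"
    proof (rule orth_compl_riesz)
      fix v :: "unit \<Rightarrow> 'h"
      have "cmod (cinner (blinfun_apply T (v ())) y) \<le> norm (blinfun_apply T (v ())) * norm y"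
        by (rule cmod_cinner_le)
      also have "\<dots> \<le> (norm T * norm (v ())) * norm y"
        by (intro mult_right_mono norm_blinfun norm_ge_zero)
      finally have "(cmod (cinner (blinfun_apply T (v ())) y))\<^sup>2 \<le> ((norm T * norm (v ())) * norm y)\<^sup>2"
        by (intro power_mono) auto
      then show "(cmod (cinner (blinfun_apply T (v ())) y))\<^sup>2 \<le> (norm T * norm y)\<^sup>2 * Re (fip UNIV v v)"
        by (simp add: Re_fip_self power_mult_distrib UNIV_unit mult.commute mult.left_commute)
    qed (auto simp: blinfun.add_right cinner_add_left cinner_scaleC_left bounded_ops_scaleC T)
    then obtain p :: "unit \<Rightarrow> 'h" where "\<forall>v\<in>?V. cinner (blinfun_apply T (v ())) y = fip UNIV v p"
      by blast
    then have "cinner (blinfun_apply T x) y = cinner x (p ())" for x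
      by (drule_tac x = "\<lambda>_. x" in bspec) (auto simp: orth_compl_def fip_def UNIV_unit)
    then show ?thesis by blast
  qed
  then obtain f where f: "cinner (blinfun_apply T x) y = cinner x (f y)" for x y by metis
  have "\<exists>T'\<in>bounded_ops. blinfun_apply T' = f"
  proof (rule bounded_opsI)
    show "f (x + y) = f x + f y" for x y
      by (rule cinner_extensional') (simp add: f [symmetric] hilb.ip_add_right)
    show "f (scaleC c x) = scaleC c (f x)" for c x
      by (rule cinner_extensional') (simp add: f [symmetric] hilb.ip_sm_right)
    show "norm (f y) \<le> norm y * norm T" for y
    proof (cases "f y = 0")
      case False
      have "(norm (f y))\<^sup>2 = Re (cinner (blinfun_apply T (f y)) y)"
        by (simp add: f Re_cinner_self)
      also have "\<dots> \<le> norm (blinfun_apply T (f y)) * norm y"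
        using cmod_cinner_le complex_Re_le_cmod order_trans by blast
      also have "\<dots> \<le> (norm T * norm (f y)) * norm y"
        by (intro mult_right_mono norm_blinfun norm_ge_zero)
      finally show ?thesis using False by (simp add: power2_eq_square mult.commute)
    qed simp
  qed
  then obtain T' where "T' \<in> bounded_ops" "blinfun_apply T' = f" by blast
  then show ?thesis using f by (auto simp: is_adjoint_def)
qed

section \<open>Factors with an outer action\<close>

lemma blinfun_compose_eqD:
  "a o\<^sub>L b = c o\<^sub>L d \<Longrightarrow> blinfun_apply a (blinfun_apply b x) = blinfun_apply c (blinfun_apply d x)"
  by (drule arg_cong [where f = "\<lambda>T. blinfun_apply T x"]) simp

text \<open>With \<open>A = P\<close> this keeps adjoints of elements of the commutant inside the
  commutant; the definition of a von Neumann algebra asserts this for the algebra only.\<close>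

lemma commutant_adjoint:
  assumes A: "\<And>S. S \<in> A \<Longrightarrow> \<exists>S'\<in>A. is_adjoint S S'"
    and T: "T \<in> commutant A" and T': "T' \<in> bounded_ops" "is_adjoint T T'"
  shows "T' \<in> commutant A"
  unfolding commutant_def mem_Collect_eq
proof (intro conjI ballI)
  show "T' \<in> bounded_ops" by fact
  fix S assume "S \<in> A"
  then obtain S' where S': "S' \<in> A" "is_adjoint S S'" using A by blast
  have comm: "blinfun_apply T (blinfun_apply S' x) = blinfun_apply S' (blinfun_apply T x)" for x
    by (rule blinfun_compose_eqD) (use T S'(1) in \<open>simp add: commutant_def\<close>)
  have adjT: "cinner x (blinfun_apply T' y) = cinner (blinfun_apply T x) y"
    and adjS: "cinner x (blinfun_apply S y) = cinner (blinfun_apply S' x) y" for x y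
    using T'(2) is_adjoint_sym [OF S'(2)] by (simp_all add: is_adjoint_def)
  show "T' o\<^sub>L S = S o\<^sub>L T'"
    by (intro blinfun_eqI cinner_extensional') (simp add: adjT adjS comm)
qed

lemma blinfun_compose_assoc: "(a o\<^sub>L b) o\<^sub>L c = a o\<^sub>L (b o\<^sub>L c)"
  by (rule blinfun_eqI) simp

lemma blinfun_compose_add_left: "(a + b) o\<^sub>L c = (a o\<^sub>L c) + (b o\<^sub>L c)"
  by (rule blinfun_eqI) (simp add: blinfun.add_left)

lemma blinfun_compose_add_right: "c o\<^sub>L (a + b) = (c o\<^sub>L a) + (c o\<^sub>L b)"
  by (rule blinfun_eqI) (simp add: blinfun.add_left blinfun.add_right)

lemma scaleC_op_compose_left: "scaleC_op c a o\<^sub>L b = scaleC_op c (a o\<^sub>L b)"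
  by (rule blinfun_eqI) (simp add: scaleC_op_apply)

lemma scaleC_op_compose_right:
  "a \<in> bounded_ops \<Longrightarrow> a o\<^sub>L scaleC_op c b = scaleC_op c (a o\<^sub>L b)"
  by (rule blinfun_eqI) (simp add: scaleC_op_apply bounded_ops_scaleC)

lemma scaleC_op_scaleC_op: "scaleC_op a (scaleC_op b x) = scaleC_op (a * b) x"
  by (rule blinfun_eqI) (simp add: scaleC_op_apply scaleC_scaleC)

lemma scaleC_op_one [simp]: "scaleC_op 1 x = x"
  by (rule blinfun_eqI) (simp add: scaleC_op_apply)

lemma scaleC_op_zero_left [simp]: "scaleC_op 0 x = 0"
  by (rule blinfun_eqI) (simp add: scaleC_op_apply)

lemma scaleC_op_zero_right [simp]: "scaleC_op c 0 = 0"
  by (rule blinfun_eqI) (simp add: scaleC_op_apply)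

lemma scaleC_op_add: "scaleC_op (a + b) x = scaleC_op a x + scaleC_op b x"
  by (rule blinfun_eqI) (simp add: scaleC_op_apply blinfun.add_left scaleC_add_left)

lemma is_adjoint_scaleC: "is_adjoint a a' \<Longrightarrow> is_adjoint (scaleC_op c a) (scaleC_op (cnj c) a')"
  by (simp add: is_adjoint_def scaleC_op_apply cinner_scaleC_left hilb.ip_sm_right)

lemma is_adjoint_unique: "is_adjoint a b \<Longrightarrow> is_adjoint a c \<Longrightarrow> b = c"
  by (intro blinfun_eqI cinner_extensional') (simp add: is_adjoint_def)

section \<open>Closure properties of the factor and of the automorphisms\<close>

locale outer_factor = group G for G :: "('g, 'm) monoid_scheme" +
  fixes P :: "('h \<Rightarrow>\<^sub>L 'h :: complex_hilbert_space) set"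
    and \<alpha> :: "'g \<Rightarrow> ('h \<Rightarrow>\<^sub>L 'h) \<Rightarrow> ('h \<Rightarrow>\<^sub>L 'h)"
  assumes P: "factor P" and outer: "outer_action G P \<alpha>"
begin

lemma bicommutant: "commutant (commutant P) = P"
  using P by (simp add: factor_def von_neumann_algebra_def)

lemma P_bounded_ops: "x \<in> P \<Longrightarrow> x \<in> bounded_ops"
  using P by (auto simp: factor_def von_neumann_algebra_def)

lemma P_adjoint: "x \<in> P \<Longrightarrow> \<exists>x'\<in>P. is_adjoint x x'"
  using P by (simp add: factor_def von_neumann_algebra_def)

text \<open>Through the bicommutant, membership in P is a commutation property. All closure
  properties of P, and later the membership of the matrix entries of the projection, are obtained
  this way.\<close>

lemma P_I: "T \<in> bounded_ops \<Longrightarrow> (\<And>S. S \<in> commutant P \<Longrightarrow> T o\<^sub>L S = S o\<^sub>L T) \<Longrightarrow> T \<in> P"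
  by (subst bicommutant [symmetric]) (simp add: commutant_def)

lemma P_commutes: "T \<in> P \<Longrightarrow> S \<in> commutant P \<Longrightarrow> T o\<^sub>L S = S o\<^sub>L T"
  by (simp add: commutant_def)

lemma P_id: "id_blinfun \<in> P"
  by (rule P_I) (simp_all add: bounded_ops_def blinfun_eqI)

lemma P_zero: "0 \<in> P"
  by (rule P_I) (simp_all add: bounded_ops_def)

lemma P_add: "x \<in> P \<Longrightarrow> y \<in> P \<Longrightarrow> x + y \<in> P"
  by (rule P_I)
    (use P_bounded_ops in \<open>auto simp: bounded_ops_def blinfun.add_left scaleC_add_right
      blinfun_compose_add_left blinfun_compose_add_right P_commutes\<close>)

lemma P_comp: "x \<in> P \<Longrightarrow> y \<in> P \<Longrightarrow> x o\<^sub>L y \<in> P"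
proof (rule P_I)
  assume xy: "x \<in> P" "y \<in> P"
  then show "x o\<^sub>L y \<in> bounded_ops" using P_bounded_ops by (auto simp: bounded_ops_def)
  fix S assume "S \<in> commutant P"
  then have comm: "x o\<^sub>L S = S o\<^sub>L x" "y o\<^sub>L S = S o\<^sub>L y"
    using xy P_commutes by blast+
  have "(x o\<^sub>L y) o\<^sub>L S = (x o\<^sub>L S) o\<^sub>L y" by (simp only: blinfun_compose_assoc comm(2))
  then show "(x o\<^sub>L y) o\<^sub>L S = S o\<^sub>L (x o\<^sub>L y)" by (simp only: blinfun_compose_assoc comm(1))
qed

lemma P_scaleC: "x \<in> P \<Longrightarrow> scaleC_op c x \<in> P"
proof (rule P_I)
  assume x: "x \<in> P"
  show "scaleC_op c x \<in> bounded_ops"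
    using P_bounded_ops [OF x] by (auto simp: bounded_ops_def scaleC_op_apply scaleC_scaleC mult.commute)
  fix S assume S: "S \<in> commutant P"
  then have "S \<in> bounded_ops" by (simp add: commutant_def)
  then show "scaleC_op c x o\<^sub>L S = S o\<^sub>L scaleC_op c x"
    by (simp add: scaleC_op_compose_left scaleC_op_compose_right P_commutes [OF x S])
qed

lemma P_sum: "(\<And>i. i \<in> I \<Longrightarrow> f i \<in> P) \<Longrightarrow> sum f I \<in> P"
  by (induction I rule: infinite_finite_induct) (auto simp: P_zero P_add)

lemma center: "x \<in> P \<Longrightarrow> (\<And>y. y \<in> P \<Longrightarrow> x o\<^sub>L y = y o\<^sub>L x) \<Longrightarrow> \<exists>c. x = scaleC_op c id_blinfun"
proof -
  assume x: "x \<in> P" "\<And>y. y \<in> P \<Longrightarrow> x o\<^sub>L y = y o\<^sub>L x"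
  then have "x \<in> P \<inter> commutant P" using P_bounded_ops by (simp add: commutant_def)
  then show ?thesis using P by (auto simp: factor_def)
qed

lemma action: "group_action_on G P \<alpha>"
  using outer by (simp add: outer_action_def)

lemma automorphism: "g \<in> carrier G \<Longrightarrow> star_automorphism P (\<alpha> g)"
  using action by (simp add: group_action_on_def)

lemma \<alpha>_mult: "g \<in> carrier G \<Longrightarrow> h \<in> carrier G \<Longrightarrow> x \<in> P \<Longrightarrow> \<alpha> (g \<otimes>\<^bsub>G\<^esub> h) x = \<alpha> g (\<alpha> h x)"
  using action by (simp add: group_action_on_def)

lemma \<alpha>_P: "g \<in> carrier G \<Longrightarrow> x \<in> P \<Longrightarrow> \<alpha> g x \<in> P"
  by (drule automorphism) (simp add: star_automorphism_def bij_betw_def image_iff set_eq_iff, blast)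

lemma \<alpha>_inj: "g \<in> carrier G \<Longrightarrow> x \<in> P \<Longrightarrow> y \<in> P \<Longrightarrow> \<alpha> g x = \<alpha> g y \<Longrightarrow> x = y"
  by (drule automorphism) (simp add: star_automorphism_def bij_betw_def inj_on_def)

text \<open>Multiplicativity makes the automorphism of the unit idempotent, and an injective
  idempotent map is the identity.\<close>

lemma \<alpha>_one: "x \<in> P \<Longrightarrow> \<alpha> \<one>\<^bsub>G\<^esub> x = x"
proof -
  assume x: "x \<in> P"
  have "\<alpha> \<one>\<^bsub>G\<^esub> (\<alpha> \<one>\<^bsub>G\<^esub> x) = \<alpha> \<one>\<^bsub>G\<^esub> x"
    using \<alpha>_mult [of "\<one>\<^bsub>G\<^esub>" "\<one>\<^bsub>G\<^esub>" x] x by simp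
  then show ?thesis
    by (rule \<alpha>_inj [rotated 3]) (simp_all add: x \<alpha>_P)
qed

lemma \<alpha>_inv: "g \<in> carrier G \<Longrightarrow> x \<in> P \<Longrightarrow> \<alpha> g (\<alpha> (inv\<^bsub>G\<^esub> g) x) = x"
  by (subst \<alpha>_mult [symmetric]) (simp_all add: \<alpha>_one)

lemma \<alpha>_inv': "g \<in> carrier G \<Longrightarrow> x \<in> P \<Longrightarrow> \<alpha> (inv\<^bsub>G\<^esub> g) (\<alpha> g x) = x"
  by (subst \<alpha>_mult [symmetric]) (simp_all add: \<alpha>_one)

lemma \<alpha>_add: "g \<in> carrier G \<Longrightarrow> x \<in> P \<Longrightarrow> y \<in> P \<Longrightarrow> \<alpha> g (x + y) = \<alpha> g x + \<alpha> g y"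
  by (drule automorphism) (simp add: star_automorphism_def)

lemma \<alpha>_comp: "g \<in> carrier G \<Longrightarrow> x \<in> P \<Longrightarrow> y \<in> P \<Longrightarrow> \<alpha> g (x o\<^sub>L y) = \<alpha> g x o\<^sub>L \<alpha> g y"
  by (drule automorphism) (simp add: star_automorphism_def)

lemma \<alpha>_scaleC: "g \<in> carrier G \<Longrightarrow> x \<in> P \<Longrightarrow> \<alpha> g (scaleC_op c x) = scaleC_op c (\<alpha> g x)"
  by (drule automorphism) (simp add: star_automorphism_def)

lemma \<alpha>_adjoint:
  "g \<in> carrier G \<Longrightarrow> x \<in> P \<Longrightarrow> x' \<in> P \<Longrightarrow> is_adjoint x x' \<Longrightarrow> is_adjoint (\<alpha> g x) (\<alpha> g x')"
  by (drule automorphism) (simp add: star_automorphism_def)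

lemma \<alpha>_zero: "g \<in> carrier G \<Longrightarrow> \<alpha> g 0 = 0"
proof -
  assume "g \<in> carrier G"
  then have "\<alpha> g (0 + 0) = \<alpha> g 0 + \<alpha> g 0" by (intro \<alpha>_add P_zero)
  then show ?thesis by (simp only: add_0_left add_cancel_right_right)
qed

lemma \<alpha>_sum:
  "g \<in> carrier G \<Longrightarrow> (\<And>i. i \<in> I \<Longrightarrow> f i \<in> P) \<Longrightarrow> \<alpha> g (sum f I) = (\<Sum>i\<in>I. \<alpha> g (f i))"
  by (induction I rule: infinite_finite_induct) (auto simp: \<alpha>_zero \<alpha>_add P_sum)

text \<open>The image of the identity acts as a unit on the range of the automorphism, and this
  range contains the identity.\<close>

lemma \<alpha>_id: "g \<in> carrier G \<Longrightarrow> \<alpha> g id_blinfun = id_blinfun"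
proof -
  assume g: "g \<in> carrier G"
  then have i: "inv\<^bsub>G\<^esub> g \<in> carrier G" by simp
  have "\<alpha> g (id_blinfun o\<^sub>L \<alpha> (inv\<^bsub>G\<^esub> g) id_blinfun) = \<alpha> g id_blinfun o\<^sub>L id_blinfun"
    using \<alpha>_comp [OF g P_id \<alpha>_P [OF i P_id]] \<alpha>_inv [OF g P_id] by simp
  moreover have "id_blinfun o\<^sub>L \<alpha> (inv\<^bsub>G\<^esub> g) id_blinfun = \<alpha> (inv\<^bsub>G\<^esub> g) id_blinfun"
    "\<alpha> g id_blinfun o\<^sub>L id_blinfun = \<alpha> g id_blinfun"
    by (simp_all add: blinfun_eqI)
  ultimately show ?thesis using \<alpha>_inv [OF g P_id] by simp
qed

text \<open>A nonzero intertwiner has scalar \<open>y\<^sup>* y\<close> and \<open>y y\<^sup>*\<close>, so it is a multiple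
  of a unitary implementing the automorphism.\<close>

lemma intertwiner:
  assumes y: "y \<in> P" and g: "g \<in> carrier G"
    and inter: "\<And>x. x \<in> P \<Longrightarrow> y o\<^sub>L \<alpha> g x = x o\<^sub>L y"
  shows "(\<exists>c. y = scaleC_op c id_blinfun) \<and> (g \<noteq> \<one>\<^bsub>G\<^esub> \<longrightarrow> y = 0)"
proof (cases "g = \<one>\<^bsub>G\<^esub>")
  case True
  have "y o\<^sub>L x = x o\<^sub>L y" if "x \<in> P" for x
    using inter [OF that] \<alpha>_one [OF that] True by simp
  then show ?thesis using True center [OF y] by blast
next
  case False
  have gi: "inv\<^bsub>G\<^esub> g \<in> carrier G" using g by simp
  obtain y' where y': "y' \<in> P" "is_adjoint y y'" using P_adjoint y by blast
  \<comment> \<open>The adjoint of the hypothesis, tested on vectors because adjoints are given as a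
    relation and not as an operation.\<close>
  have inter': "y' o\<^sub>L x = \<alpha> g x o\<^sub>L y'" if x: "x \<in> P" for x
  proof -
    obtain x' where x': "x' \<in> P" "is_adjoint x x'" using P_adjoint x by blast
    have ax: "cinner (blinfun_apply (\<alpha> g x') u) v = cinner u (blinfun_apply (\<alpha> g x) v)" for u v
      using \<alpha>_adjoint [OF g x'(1) x is_adjoint_sym [OF x'(2)]] by (simp add: is_adjoint_def)
    have ay: "cinner (blinfun_apply y u) v = cinner u (blinfun_apply y' v)" for u v
      using y'(2) by (simp add: is_adjoint_def)
    have bx: "cinner (blinfun_apply x' u) v = cinner u (blinfun_apply x v)" for u v
      using is_adjoint_sym [OF x'(2)] by (simp add: is_adjoint_def)
    have c: "blinfun_apply y (blinfun_apply (\<alpha> g x') u) = blinfun_apply x' (blinfun_apply y u)" for u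
      by (rule blinfun_compose_eqD) (rule inter [OF x'(1)])
    show ?thesis
    proof (intro blinfun_eqI cinner_extensional')
      fix u v
      have "cinner u (blinfun_apply (\<alpha> g x) (blinfun_apply y' v))
          = cinner (blinfun_apply y (blinfun_apply (\<alpha> g x') u)) v"
        by (simp only: ax [symmetric] ay)
      then show "cinner u (blinfun_apply (y' o\<^sub>L x) v) = cinner u (blinfun_apply (\<alpha> g x o\<^sub>L y') v)"
        by (simp add: c ay bx)
    qed
  qed
  have "\<exists>c. y' o\<^sub>L y = scaleC_op c id_blinfun"
  proof (rule center [OF P_comp [OF y'(1) y]])
    fix x assume "x \<in> P"
    \<comment> \<open>The product y' y commutes with the range of the automorphism, which is all of
      P.\<close>
    define z where "z = \<alpha> (inv\<^bsub>G\<^esub> g) x"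
    have z: "z \<in> P" "\<alpha> g z = x" using \<alpha>_P \<alpha>_inv gi g \<open>x \<in> P\<close> by (simp_all add: z_def)
    have "(y' o\<^sub>L y) o\<^sub>L x = y' o\<^sub>L (z o\<^sub>L y)"
      using inter [OF z(1)] z(2) by (simp add: blinfun_compose_assoc)
    also have "\<dots> = (y' o\<^sub>L z) o\<^sub>L y" by (simp add: blinfun_compose_assoc)
    also have "\<dots> = x o\<^sub>L (y' o\<^sub>L y)"
      by (simp only: inter' [OF z(1)] z(2) blinfun_compose_assoc)
    finally show "(y' o\<^sub>L y) o\<^sub>L x = x o\<^sub>L (y' o\<^sub>L y)" .
  qed
  then obtain c where c: "y' o\<^sub>L y = scaleC_op c id_blinfun" by blast
  have "\<exists>c. y o\<^sub>L y' = scaleC_op c id_blinfun"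
  proof (rule center [OF P_comp [OF y y'(1)]])
    fix x assume x: "x \<in> P"
    have "(y o\<^sub>L y') o\<^sub>L x = (y o\<^sub>L \<alpha> g x) o\<^sub>L y'"
      by (simp only: blinfun_compose_assoc inter' [OF x])
    then show "(y o\<^sub>L y') o\<^sub>L x = x o\<^sub>L (y o\<^sub>L y')"
      by (simp only: inter [OF x] blinfun_compose_assoc)
  qed
  then obtain d where d: "y o\<^sub>L y' = scaleC_op d id_blinfun" by blast
  have "y = 0"
  proof (rule ccontr)
    assume "y \<noteq> 0"
    then obtain \<xi> where \<xi>: "blinfun_apply y \<xi> \<noteq> 0"
      by (metis blinfun_eqI zero_blinfun.rep_eq)
    then have \<xi>0: "\<xi> \<noteq> 0" by auto
    \<comment> \<open>Bracketing y y' y in both ways at \<xi> gives c y \<xi> = d y \<xi>, with y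
      \<xi> nonzero.\<close>
    have "(c - d) = 0"
    proof (rule ccontr)
      assume cd: "c - d \<noteq> 0"
      have "blinfun_apply (y o\<^sub>L (y' o\<^sub>L y)) \<xi> = blinfun_apply ((y o\<^sub>L y') o\<^sub>L y) \<xi>"
        by (simp add: blinfun_compose_assoc)
      then have "scaleC c (blinfun_apply y \<xi>) = scaleC d (blinfun_apply y \<xi>)"
        unfolding c d by (simp add: scaleC_op_apply bounded_ops_scaleC [OF P_bounded_ops [OF y]])
      then have "scaleC (c - d) (blinfun_apply y \<xi>) = 0"
        using scaleC_add_left [of "c - d" d "blinfun_apply y \<xi>"] by simp
      then show False using \<xi> cd norm_scaleC [of "c - d" "blinfun_apply y \<xi>"] by simp
    qed
    then have d: "y o\<^sub>L y' = scaleC_op c id_blinfun" using d by simp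
    \<comment> \<open>The identity <y \<xi>, y \<xi>> = <\<xi>, y' y \<xi>> shows that the scalar is
      a positive real number, so that y' divided by its root is unitary.\<close>
    have "complex_of_real ((norm (blinfun_apply y \<xi>))\<^sup>2) = cinner \<xi> (blinfun_apply (y' o\<^sub>L y) \<xi>)"
      using y'(2) unfolding is_adjoint_def cinner_self [symmetric] by simp
    also have "\<dots> = cnj c * complex_of_real ((norm \<xi>)\<^sup>2)"
      unfolding c by (simp add: scaleC_op_apply hilb.ip_sm_right cinner_self)
    finally have "cnj c = complex_of_real ((norm (blinfun_apply y \<xi>))\<^sup>2 / (norm \<xi>)\<^sup>2)"
      using \<xi>0 by (simp add: field_simps)
    then have "c = complex_of_real ((norm (blinfun_apply y \<xi>))\<^sup>2 / (norm \<xi>)\<^sup>2)"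
      by (metis complex_cnj_cnj complex_cnj_complex_of_real)
    then obtain r where r: "c = complex_of_real r" "r > 0"
      using \<xi> \<xi>0 by (metis divide_pos_pos zero_less_norm_iff zero_less_power)
    define t where "t = complex_of_real (1 / sqrt r)"
    have t: "t * t * c = 1" "cnj t = t"
      using r by (simp_all add: t_def flip: of_real_mult)
    \<comment> \<open>The unitary comes from y' and not from y: the relation \<open>inter'\<close>
      reads y' x = \<alpha>_g(x) y'.\<close>
    define u u' where "u = scaleC_op t y'" and "u' = scaleC_op t y"
    have mem: "u \<in> P" "u' \<in> P" by (simp_all add: u_def u'_def P_scaleC y y'(1))
    have adj: "is_adjoint u u'"
      using is_adjoint_scaleC [OF is_adjoint_sym [OF y'(2)], of t] by (simp add: u_def u'_def t(2))
    have yb: "y \<in> bounded_ops" "y' \<in> bounded_ops" using y y'(1) P_bounded_ops by blast+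
    have one: "u' o\<^sub>L u = id_blinfun" "u o\<^sub>L u' = id_blinfun"
      by (simp_all add: u_def u'_def scaleC_op_compose_left scaleC_op_compose_right yb c d
          scaleC_op_scaleC_op t(1) flip: mult.assoc)
    have "\<alpha> g x = u o\<^sub>L x o\<^sub>L u'" if x: "x \<in> P" for x
    proof -
      have "u o\<^sub>L x = \<alpha> g x o\<^sub>L u"
        by (simp add: u_def scaleC_op_compose_left inter' [OF x]
            scaleC_op_compose_right P_bounded_ops \<alpha>_P g x)
      then have "u o\<^sub>L x o\<^sub>L u' = \<alpha> g x o\<^sub>L (u o\<^sub>L u')" by (simp add: blinfun_compose_assoc)
      also have "\<dots> = \<alpha> g x" unfolding one by (simp add: blinfun_eqI)
      finally show ?thesis by simp
    qed
    then have "inner_automorphism P (\<alpha> g)"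
      unfolding inner_automorphism_def using mem adj one by blast
    then show False using outer g False by (auto simp: outer_action_def)
  qed
  moreover have "0 = scaleC_op 0 (id_blinfun :: 'h \<Rightarrow>\<^sub>L 'h)" by simp
  ultimately show ?thesis by metis
qed

text \<open>Replacing x by its image under the automorphism of h^-1 leaves a single automorphism,
  that of g h^-1.\<close>

lemma intertwiner2:
  assumes y: "y \<in> P" and gh: "g \<in> carrier G" "h \<in> carrier G"
    and inter: "\<And>x. x \<in> P \<Longrightarrow> y o\<^sub>L \<alpha> g x = \<alpha> h x o\<^sub>L y"
  shows "(\<exists>c. y = scaleC_op c id_blinfun) \<and> (g \<noteq> h \<longrightarrow> y = 0)"
proof -
  have "y o\<^sub>L \<alpha> (g \<otimes>\<^bsub>G\<^esub> inv\<^bsub>G\<^esub> h) x = x o\<^sub>L y" if "x \<in> P" for x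
    using inter [of "\<alpha> (inv\<^bsub>G\<^esub> h) x"] gh that by (simp add: \<alpha>_mult \<alpha>_P \<alpha>_inv)
  moreover have "g \<otimes>\<^bsub>G\<^esub> inv\<^bsub>G\<^esub> h = \<one>\<^bsub>G\<^esub> \<Longrightarrow> g = h"
    using gh by (metis inv_closed inv_equality inv_inv)
  ultimately show ?thesis using intertwiner [OF y, of "g \<otimes>\<^bsub>G\<^esub> inv\<^bsub>G\<^esub> h"] gh by auto
qed

text \<open>The matrix \<open>q\<close> is the projection onto the orthogonal complement of all vectors
  \<open>(\<alpha>\<^bsub>g i\<^esub>(x) b\<^sub>i \<xi>)\<^sub>i\<close>. It commutes with the commutant of \<open>P\<close> and with the diagonal
  operators \<open>(\<alpha>\<^bsub>g i\<^esub>(x))\<^sub>i\<close>, so its entries are intertwiners in \<open>P\<close>; the relation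
  says that \<open>(a\<^sub>i\<^sup>* \<eta>)\<^sub>i\<close> lies in its range.\<close>

lemma skew_relation:
  fixes I :: "'i set"
  assumes I: "finite I" and g: "\<And>i. i \<in> I \<Longrightarrow> g i \<in> carrier G"
    and a: "\<And>i. i \<in> I \<Longrightarrow> is_adjoint (a i) (a' i)" and b: "\<And>i. i \<in> I \<Longrightarrow> b i \<in> P"
    and rel: "\<And>x. x \<in> P \<Longrightarrow> (\<Sum>i\<in>I. a i o\<^sub>L \<alpha> (g i) x o\<^sub>L b i) = 0"
  obtains q :: "'i \<Rightarrow> 'i \<Rightarrow> complex" where
    "\<And>i j. i \<in> I \<Longrightarrow> j \<in> I \<Longrightarrow> g i \<noteq> g j \<Longrightarrow> q i j = 0"
    "\<And>i. i \<in> I \<Longrightarrow> (\<Sum>j\<in>I. scaleC_op (q i j) (b j)) = 0"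
    "\<And>i. i \<in> I \<Longrightarrow> (\<Sum>j\<in>I. scaleC_op (q i j) (a' j)) = a' i"
proof -
  define W where "W = {\<lambda>i. blinfun_apply (\<alpha> (g i) x) (blinfun_apply (b i) \<xi>) | x \<xi>. x \<in> P}"
  define V where "V = orth_compl I W"
  define Q where "Q u = (THE p. p \<in> V \<and> (\<forall>v\<in>V. fip I v u = fip I v p))" for u
  have Q: "Q u \<in> V \<and> (\<forall>v\<in>V. fip I v u = fip I v (Q u))" for u
    unfolding Q_def V_def by (rule theI' [OF orth_projection [OF I, of W u]])
  have QV: "Q u \<in> V" and Q_ip: "v \<in> V \<Longrightarrow> fip I v (Q u) = fip I v u" for u v
    using Q [of u] by simp_all
  \<comment> \<open>Uniqueness of the projected vector; linearity of \<open>Q\<close> and its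
    commutation with diagonal operators are all derived from it.\<close>
  have Q_eq: "Q u = p" if "p \<in> V" "\<And>v. v \<in> V \<Longrightarrow> fip I v u = fip I v p" for u p
    using orth_projection [OF I, of W u] Q [of u] that unfolding V_def by (metis (no_types))
  have V0: "0 \<in> V" and Vadd: "u \<in> V \<Longrightarrow> v \<in> V \<Longrightarrow> u + v \<in> V"
    and Vsc: "v \<in> V \<Longrightarrow> (\<lambda>i. scaleC c (v i)) \<in> V" for u v c
    unfolding V_def by (rule orth_compl_zero orth_compl_add orth_compl_scaleC; assumption)+
  have Q_add: "Q (u + v) = Q u + Q v" for u v
    by (rule Q_eq) (simp_all add: fh.ip_add_right QV Q_ip Vadd)
  have Q_sc: "Q (\<lambda>i. scaleC c (u i)) = (\<lambda>i. scaleC c (Q u i))" for c u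
    by (rule Q_eq) (simp_all add: fh.ip_sm_right QV Q_ip Vsc)
  have Q_zero: "Q 0 = 0"
    by (rule Q_eq) (use V0 in auto)
  have Q_sum: "Q (sum f J) = (\<Sum>j\<in>J. Q (f j))" for f :: "'i \<Rightarrow> 'i \<Rightarrow> 'h" and J
    by (induction J rule: infinite_finite_induct) (simp_all only: sum.infinite sum.empty sum.insert Q_add Q_zero not_False_eq_True)
  have Q_cong: "Q u = Q v" if "\<And>i. i \<in> I \<Longrightarrow> u i = v i" for u v
  proof (rule Q_eq [OF QV])
    fix w assume "w \<in> V"
    then have "fip I w (Q v) = fip I w v" by (rule Q_ip)
    then show "fip I w u = fip I w (Q v)"
      using that by (simp add: fip_def)
  qed
  have fsum: "(sum f J) i = (\<Sum>j\<in>J. f j i)" for f :: "'i \<Rightarrow> 'i \<Rightarrow> 'h" and J i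
    by (induction J rule: infinite_finite_induct) simp_all
  define \<delta> where "\<delta> j \<xi> = (\<lambda>i. if i = j then \<xi> else 0)" for j :: 'i and \<xi> :: 'h
  have "\<exists>T\<in>bounded_ops. blinfun_apply T = (\<lambda>\<xi>. Q (\<delta> j \<xi>) i)" if ij: "i \<in> I" "j \<in> I" for i j
  proof (rule bounded_opsI [where C = 1])
    show "Q (\<delta> j (x + y)) i = Q (\<delta> j x) i + Q (\<delta> j y) i" for x y
    proof -
      have "\<delta> j (x + y) = \<delta> j x + \<delta> j y" by (auto simp: \<delta>_def)
      then show ?thesis by (simp only: Q_add plus_fun_apply)
    qed
    show "Q (\<delta> j (scaleC c x)) i = scaleC c (Q (\<delta> j x) i)" for c x
    proof -
      have "\<delta> j (scaleC c x) = (\<lambda>k. scaleC c (\<delta> j x k))" by (auto simp: \<delta>_def)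
      then show ?thesis by (simp only: Q_sc)
    qed
    show "norm (Q (\<delta> j x) i) \<le> norm x * 1" for x
    proof -
      let ?p = "Q (\<delta> j x)"
      have nn: "Re (fip I ?p ?p) \<ge> 0" by (rule fh.ip_nonneg)
      \<comment> \<open>Projections are contractive: <p, p> = <p, u> and Cauchy-Schwarz give <p, p>
        \<le> <u, u>.\<close>
      have "fip I ?p ?p = fip I ?p (\<delta> j x)" by (rule Q_ip [OF QV])
      then have "(Re (fip I ?p ?p))\<^sup>2 \<le> (cmod (fip I ?p (\<delta> j x)))\<^sup>2"
        by (simp add: cmod_power2)
      also have "\<dots> \<le> Re (fip I ?p ?p) * Re (fip I (\<delta> j x) (\<delta> j x))"
        by (rule fh.cauchy_schwarz)
      finally have le: "Re (fip I ?p ?p) \<le> Re (fip I (\<delta> j x) (\<delta> j x))"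
        using nn fh.ip_nonneg [of I "\<delta> j x"]
        by (cases "Re (fip I ?p ?p) = 0") (auto simp: power2_eq_square)
      have "(norm (?p i))\<^sup>2 \<le> Re (fip I ?p ?p)"
        unfolding Re_fip_self using ij I by (intro member_le_sum) auto
      also have "\<dots> \<le> Re (fip I (\<delta> j x) (\<delta> j x))" by (rule le)
      also have "\<dots> = (norm x)\<^sup>2"
        using ij I by (simp add: Re_fip_self \<delta>_def if_distrib [where f = norm] if_distrib [where f = "\<lambda>t. t\<^sup>2"]
            cong: if_cong)
      finally show ?thesis by (simp add: power2_le_iff_abs_le)
    qed
  qed
  then obtain T where T: "T i j \<in> bounded_ops" "blinfun_apply (T i j) = (\<lambda>\<xi>. Q (\<delta> j \<xi>) i)"
    if "i \<in> I" "j \<in> I" for i j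
    by metis
  have Q_T: "Q u i = (\<Sum>j\<in>I. blinfun_apply (T i j) (u j))" if i: "i \<in> I" for u i
  proof -
    have "Q u = Q (\<Sum>j\<in>I. \<delta> j (u j))"
      by (rule Q_cong) (simp add: fsum \<delta>_def I)
    then have "Q u i = (\<Sum>j\<in>I. Q (\<delta> j (u j)) i)" by (simp only: Q_sum fsum)
    then show ?thesis using i by (simp add: T)
  qed
  \<comment> \<open>If a diagonal operator and its adjoint both map \<open>W\<close> into itself,
    then both also preserve the complement, and the operator commutes with the projection. Images
    need to agree with a vector of \<open>W\<close> on \<open>I\<close> only.\<close>
  have commute: "blinfun_apply (T i j) (blinfun_apply (S j) \<xi>) = blinfun_apply (S i) (blinfun_apply (T i j) \<xi>)"
    if ij: "i \<in> I" "j \<in> I" and adj: "\<And>i. i \<in> I \<Longrightarrow> is_adjoint (S i) (S' i)"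
      and inv: "\<And>w. w \<in> W \<Longrightarrow> \<exists>w'\<in>W. \<forall>i\<in>I. w' i = blinfun_apply (S i) (w i)"
      and inv': "\<And>w. w \<in> W \<Longrightarrow> \<exists>w'\<in>W. \<forall>i\<in>I. w' i = blinfun_apply (S' i) (w i)"
    for S S' :: "'i \<Rightarrow> 'h \<Rightarrow>\<^sub>L 'h" and i j \<xi>
  proof -
    have move: "fip I (\<lambda>i. if i \<in> I then blinfun_apply (S i) (v i) else 0) w
        = fip I v (\<lambda>i. if i \<in> I then blinfun_apply (S' i) (w i) else 0)"
      if "\<And>i. i \<in> I \<Longrightarrow> is_adjoint (S i) (S' i)" for S S' :: "'i \<Rightarrow> 'h \<Rightarrow>\<^sub>L 'h" and v w
      unfolding fip_def by (intro sum.cong) (use that in \<open>auto simp: is_adjoint_def\<close>)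
    have Vinv: "(\<lambda>i. if i \<in> I then blinfun_apply (S i) (v i) else 0) \<in> V"
      if v: "v \<in> V" and adj: "\<And>i. i \<in> I \<Longrightarrow> is_adjoint (S i) (S' i)"
        and inv': "\<And>w. w \<in> W \<Longrightarrow> \<exists>w'\<in>W. \<forall>i\<in>I. w' i = blinfun_apply (S' i) (w i)"
      for S S' :: "'i \<Rightarrow> 'h \<Rightarrow>\<^sub>L 'h" and v
      unfolding V_def orth_compl_def mem_Collect_eq
    proof (intro conjI ballI)
      fix w assume "w \<in> W"
      then obtain w' where w': "w' \<in> W" "\<forall>i\<in>I. w' i = blinfun_apply (S' i) (w i)" using inv' by blast
      have "fip I v (\<lambda>i. if i \<in> I then blinfun_apply (S' i) (w i) else 0) = fip I v w'"
        unfolding fip_def by (intro sum.cong) (simp_all add: w'(2))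
      also have "\<dots> = 0" using v w'(1) by (simp add: V_def orth_compl_def)
      finally show "fip I (\<lambda>i. if i \<in> I then blinfun_apply (S i) (v i) else 0) w = 0"
        by (simp add: move [OF adj])
    qed simp
    let ?S = "\<lambda>v i. if i \<in> I then blinfun_apply (S i) (v i) else 0"
      and ?S' = "\<lambda>v i. if i \<in> I then blinfun_apply (S' i) (v i) else 0"
    have adj': "is_adjoint (S' i) (S i)" if "i \<in> I" for i
      using adj [OF that] by (rule is_adjoint_sym)
    have "Q (?S u) = ?S (Q u)" for u
    proof (rule Q_eq)
      show "?S (Q u) \<in> V" by (rule Vinv [OF QV adj inv'])
      fix v assume "v \<in> V"
      then have "?S' v \<in> V" by (rule Vinv [OF _ adj' inv])
      then have "fip I (?S' v) u = fip I (?S' v) (Q u)" by (simp only: Q_ip)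
      then show "fip I v (?S u) = fip I v (?S (Q u))"
        by (simp only: move [OF adj'])
    qed
    moreover have "\<delta> j (blinfun_apply (S j) \<xi>) = ?S (\<delta> j \<xi>)"
      using ij by (auto simp: \<delta>_def blinfun.zero_right)
    ultimately show ?thesis using ij by (simp add: T)
  qed
  have T_P: "T i j \<in> P" if ij: "i \<in> I" "j \<in> I" for i j
  proof (rule P_I [OF T(1) [OF ij]])
    fix S assume S: "S \<in> commutant P"
    then have "S \<in> bounded_ops" by (simp add: commutant_def)
    then obtain S' where S': "S' \<in> bounded_ops" "is_adjoint S S'" using adjoint_exists by blast
    have SC': "S' \<in> commutant P" by (rule commutant_adjoint [OF P_adjoint S S'])
    have inv: "\<exists>w'\<in>W. \<forall>i\<in>I. w' i = blinfun_apply R (w i)" if w: "w \<in> W" and R: "R \<in> commutant P" for w R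
    proof -
      obtain x \<xi> where x: "x \<in> P" "w = (\<lambda>i. blinfun_apply (\<alpha> (g i) x) (blinfun_apply (b i) \<xi>))"
        using w by (auto simp: W_def)
      have c: "blinfun_apply R (blinfun_apply p \<eta>) = blinfun_apply p (blinfun_apply R \<eta>)" if "p \<in> P" for p \<eta>
        by (rule blinfun_compose_eqD) (simp add: P_commutes that R)
      show ?thesis
      proof
        \<comment> \<open>As \<open>R\<close> commutes with all elements of P standing before \<xi>,
          it merely replaces \<xi> by R \<xi>.\<close>
        show "(\<lambda>i. blinfun_apply (\<alpha> (g i) x) (blinfun_apply (b i) (blinfun_apply R \<xi>))) \<in> W"
          using x(1) by (auto simp: W_def)
      qed (simp add: x c \<alpha>_P g b)
    qed
    show "T i j o\<^sub>L S = S o\<^sub>L T i j"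
      by (rule blinfun_eqI, simp, rule commute [OF ij, of "\<lambda>_. S" "\<lambda>_. S'"])
        (simp_all add: S' inv S SC')
  qed
  have T_inter: "T i j o\<^sub>L \<alpha> (g j) z = \<alpha> (g i) z o\<^sub>L T i j" if ij: "i \<in> I" "j \<in> I" and z: "z \<in> P" for i j z
  proof -
    obtain z' where z': "z' \<in> P" "is_adjoint z z'" using P_adjoint z by blast
    have inv: "\<exists>w'\<in>W. \<forall>i\<in>I. w' i = blinfun_apply (\<alpha> (g i) y) (w i)" if w: "w \<in> W" and y: "y \<in> P" for w y
    proof -
      obtain x \<xi> where x: "x \<in> P" "w = (\<lambda>i. blinfun_apply (\<alpha> (g i) x) (blinfun_apply (b i) \<xi>))"
        using w by (auto simp: W_def)
      show ?thesis
      proof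
        \<comment> \<open>By multiplicativity the diagonal operator of y merely replaces x by the
          product y x.\<close>
        show "(\<lambda>i. blinfun_apply (\<alpha> (g i) (y o\<^sub>L x)) (blinfun_apply (b i) \<xi>)) \<in> W"
          using P_comp [OF y x(1)] by (auto simp: W_def)
      qed (simp add: x y g \<alpha>_comp)
    qed
    show ?thesis
      by (rule blinfun_eqI, simp, rule commute [OF ij, of "\<lambda>i. \<alpha> (g i) z" "\<lambda>i. \<alpha> (g i) z'"])
        (simp_all add: inv z z' g \<alpha>_adjoint)
  qed
  have "\<exists>c. T i j = scaleC_op c id_blinfun \<and> (g i \<noteq> g j \<longrightarrow> c = 0)" if ij: "i \<in> I" "j \<in> I" for i j
  proof (cases "g i = g j")
    case True
    then show ?thesis using intertwiner2 [OF T_P [OF ij] g g T_inter [OF ij]] ij by blast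
  next
    case False
    then have "T i j = 0" using intertwiner2 [OF T_P [OF ij] g g T_inter [OF ij]] ij by metis
    then show ?thesis by (intro exI [of _ 0]) simp
  qed
  then obtain q where q: "T i j = scaleC_op (q i j) id_blinfun" "g i \<noteq> g j \<Longrightarrow> q i j = 0"
    if "i \<in> I" "j \<in> I" for i j
    by metis
  have Q_q: "Q u i = (\<Sum>j\<in>I. scaleC (q i j) (u j))" if "i \<in> I" for u i
    unfolding Q_T [OF that] by (intro sum.cong) (simp_all add: q(1) that scaleC_op_apply)
  show thesis
  proof (rule that)
    show "g i \<noteq> g j \<Longrightarrow> q i j = 0" if "i \<in> I" "j \<in> I" for i j
      using q(2) that by blast
  next
    fix i assume i: "i \<in> I"
    show "(\<Sum>j\<in>I. scaleC_op (q i j) (b j)) = 0"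
    proof (rule blinfun_eqI)
      fix \<xi>
      \<comment> \<open>Taking x to be the identity puts (b_j \<xi>)_j into \<open>W\<close>, up to
        the trivial factor \<alpha>(id).\<close>
      let ?u = "\<lambda>j. blinfun_apply (\<alpha> (g j) id_blinfun) (blinfun_apply (b j) \<xi>)"
      have "?u \<in> W" using P_id by (auto simp: W_def)
      then have "fip I v ?u = 0" if "v \<in> V" for v
        using that by (simp add: V_def orth_compl_def)
      then have "Q ?u = 0"
        by (intro Q_eq V0) (simp_all only: fh.ip_zero_right)
      then have "0 = (\<Sum>j\<in>I. scaleC (q i j) (?u j))" using Q_q [OF i, of ?u] by simp
      also have "\<dots> = (\<Sum>j\<in>I. scaleC (q i j) (blinfun_apply (b j) \<xi>))"
        by (intro sum.cong) (simp_all add: \<alpha>_id g)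
      finally show "blinfun_apply (\<Sum>j\<in>I. scaleC_op (q i j) (b j)) \<xi> = blinfun_apply 0 \<xi>"
        by (simp add: blinfun.sum_left scaleC_op_apply)
    qed
    show "(\<Sum>j\<in>I. scaleC_op (q i j) (a' j)) = a' i"
    proof (rule blinfun_eqI)
      fix \<eta>
      let ?u = "\<lambda>j. if j \<in> I then blinfun_apply (a' j) \<eta> else 0"
      have "fip I ?u w = 0" if "w \<in> W" for w
      proof -
        obtain x \<xi> where x: "x \<in> P" "w = (\<lambda>i. blinfun_apply (\<alpha> (g i) x) (blinfun_apply (b i) \<xi>))"
          using \<open>w \<in> W\<close> by (auto simp: W_def)
        have "fip I ?u w = (\<Sum>i\<in>I. cinner \<eta> (blinfun_apply (a i o\<^sub>L \<alpha> (g i) x o\<^sub>L b i) \<xi>))"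
          unfolding fip_def
        proof (intro sum.cong refl)
          fix j assume j: "j \<in> I"
          have "is_adjoint (a' j) (a j)" using a [OF j] by (rule is_adjoint_sym)
          then show "cinner (?u j) (w j) = cinner \<eta> (blinfun_apply (a j o\<^sub>L \<alpha> (g j) x o\<^sub>L b j) \<xi>)"
            using j by (simp add: is_adjoint_def x)
        qed
        also have "\<dots> = cinner \<eta> (blinfun_apply (\<Sum>i\<in>I. a i o\<^sub>L \<alpha> (g i) x o\<^sub>L b i) \<xi>)"
          by (induction I rule: infinite_finite_induct) (simp_all add: hilb.ip_add_right blinfun.add_left hilb.ip_zero_right)
        finally show ?thesis
          by (simp add: rel [OF x(1)] hilb.ip_zero_right)
      qed
      then have "?u \<in> V" by (simp add: V_def orth_compl_def)
      then have "Q ?u = ?u" by (intro Q_eq) auto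
      then have "blinfun_apply (a' i) \<eta> = (\<Sum>j\<in>I. scaleC (q i j) (?u j))"
        using Q_q [OF i, of ?u] i by simp
      then show "blinfun_apply (\<Sum>j\<in>I. scaleC_op (q i j) (a' j)) \<eta> = blinfun_apply (a' i) \<eta>"
        by (simp add: blinfun.sum_left scaleC_op_apply)
    qed
  qed
qed

end

section \<open>Averages over a finite subgroup and intertwiners of its fixed points\<close>

lemma (in group) mult_inv_eq_one_iff:
  "a \<in> carrier G \<Longrightarrow> b \<in> carrier G \<Longrightarrow> a \<otimes> inv b = \<one> \<longleftrightarrow> a = b"
  by (metis inv_closed inv_equality inv_inv r_inv)

lemma (in group) mult_inv_cancel:
  "a \<in> carrier G \<Longrightarrow> b \<in> carrier G \<Longrightarrow> a \<otimes> (inv a \<otimes> b) = b"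
  by (simp flip: m_assoc)

lemma (in group) subgroup_l_mult_bij:
  assumes "subgroup H G" "k \<in> H"
  shows "bij_betw (\<lambda>h. k \<otimes> h) H H"
proof (rule bij_betw_byWitness [where f' = "\<lambda>h. inv k \<otimes> h"])
  have [simp]: "h \<in> H \<Longrightarrow> h \<in> carrier G" for h using assms(1) by (rule subgroup.mem_carrier)
  show "\<forall>h\<in>H. inv k \<otimes> (k \<otimes> h) = h" "\<forall>h\<in>H. k \<otimes> (inv k \<otimes> h) = h"
    using assms(2) by (simp_all flip: m_assoc)
  show "(\<lambda>h. k \<otimes> h) ` H \<subseteq> H" "(\<lambda>h. inv k \<otimes> h) ` H \<subseteq> H"
    using assms by (auto simp: subgroup.m_closed subgroup.m_inv_closed)
qed

context outer_factor
begin

lemma sum_orbit_fixed: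
  assumes H: "subgroup H G" and x: "x \<in> P"
  shows "(\<Sum>h\<in>H. \<alpha> h x) \<in> fixed_points H P \<alpha>"
  unfolding fixed_points_def mem_Collect_eq
proof (intro conjI ballI)
  have c: "h \<in> H \<Longrightarrow> h \<in> carrier G" for h using H by (rule subgroup.mem_carrier)
  show "(\<Sum>h\<in>H. \<alpha> h x) \<in> P" by (intro P_sum \<alpha>_P c x)
  fix k assume k: "k \<in> H"
  have "\<alpha> k (\<Sum>h\<in>H. \<alpha> h x) = (\<Sum>h\<in>H. \<alpha> (k \<otimes>\<^bsub>G\<^esub> h) x)"
    using k x c by (simp add: \<alpha>_sum \<alpha>_mult \<alpha>_P)
  also have "\<dots> = (\<Sum>h\<in>H. \<alpha> h x)"
    by (rule sum.reindex_bij_betw [OF subgroup_l_mult_bij [OF H k]])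
  finally show "\<alpha> k (\<Sum>h\<in>H. \<alpha> h x) = (\<Sum>h\<in>H. \<alpha> h x)" .
qed

lemma id_nonzero: "(id_blinfun :: 'h \<Rightarrow>\<^sub>L 'h) \<noteq> 0"
  using P by (simp add: factor_def)

lemma scaleC_op_id_eq_0: "scaleC_op c (id_blinfun :: 'h \<Rightarrow>\<^sub>L 'h) = 0 \<Longrightarrow> c = 0"
proof (rule ccontr)
  assume "scaleC_op c (id_blinfun :: 'h \<Rightarrow>\<^sub>L 'h) = 0" "c \<noteq> 0"
  then have "scaleC_op (inverse c * c) (id_blinfun :: 'h \<Rightarrow>\<^sub>L 'h) = 0"
    by (metis scaleC_op_scaleC_op scaleC_op_zero_right)
  then show False using \<open>c \<noteq> 0\<close> id_nonzero by simp
qed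

text \<open>Inserting \<open>\<Sum>\<^sub>h h(x)\<close> for a fixed point turns the hypothesis into a skew relation
  between the automorphisms \<open>g h\<close> and \<open>h\<close>, valid on all of \<open>P\<close>.\<close>

lemma fixed_point_intertwiner:
  assumes y: "y \<in> P" and g: "g \<in> carrier G" and H: "subgroup H G" and fin: "finite H"
    and inter: "\<And>x. x \<in> fixed_points H P \<alpha> \<Longrightarrow> y o\<^sub>L \<alpha> g x = x o\<^sub>L y"
  shows "(\<exists>c. y = scaleC_op c id_blinfun) \<and> (g \<notin> H \<longrightarrow> y = 0)"
proof -
  have [simp]: "h \<in> H \<Longrightarrow> h \<in> carrier G" for h using H by (rule subgroup.mem_carrier)
  obtain y' where y': "y' \<in> P" "is_adjoint y y'" using P_adjoint y by blast
  \<comment> \<open>The Boolean records the side of the relation: True for the terms y (g h)(x),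
    False for the terms -h(x) y brought over from the other side.\<close>
  define I where "I = H \<times> (UNIV :: bool set)"
  define gg where "gg i = (if snd i then g \<otimes>\<^bsub>G\<^esub> fst i else fst i)" for i :: "'g \<times> bool"
  define a where "a i = (if snd i then y else - id_blinfun)" for i :: "'g \<times> bool"
  define a' where "a' i = (if snd i then y' else - id_blinfun)" for i :: "'g \<times> bool"
  define b where "b i = (if snd i then id_blinfun else y)" for i :: "'g \<times> bool"
  have finI: "finite I" by (simp add: I_def fin)
  have rel: "(\<Sum>i\<in>I. a i o\<^sub>L \<alpha> (gg i) x o\<^sub>L b i) = 0" if x: "x \<in> P" for x
  proof -
    let ?t = "\<Sum>h\<in>H. \<alpha> h x"
    have "\<alpha> g ?t = (\<Sum>h\<in>H. \<alpha> (g \<otimes>\<^bsub>G\<^esub> h) x)"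
      using g x by (simp add: \<alpha>_sum \<alpha>_mult \<alpha>_P)
    then have "y o\<^sub>L (\<Sum>h\<in>H. \<alpha> (g \<otimes>\<^bsub>G\<^esub> h) x) = ?t o\<^sub>L y"
      using inter [OF sum_orbit_fixed [OF H x]] by simp
    then have t: "blinfun_apply y (\<Sum>h\<in>H. blinfun_apply (\<alpha> (g \<otimes>\<^bsub>G\<^esub> h) x) \<xi>)
        = (\<Sum>h\<in>H. blinfun_apply (\<alpha> h x) (blinfun_apply y \<xi>))" for \<xi>
      by (drule_tac arg_cong [where f = "\<lambda>T. blinfun_apply T \<xi>"]) (simp add: blinfun.sum_left)
    show ?thesis
    proof (rule blinfun_eqI)
      fix \<xi>
      have "blinfun_apply (\<Sum>i\<in>I. a i o\<^sub>L \<alpha> (gg i) x o\<^sub>L b i) \<xi>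
          = (\<Sum>h\<in>H. \<Sum>e\<in>UNIV. blinfun_apply (a (h, e) o\<^sub>L \<alpha> (gg (h, e)) x o\<^sub>L b (h, e)) \<xi>)"
        unfolding I_def by (simp add: blinfun.sum_left sum.cartesian_product)
      also have "\<dots> = (\<Sum>h\<in>H. blinfun_apply y (blinfun_apply (\<alpha> (g \<otimes>\<^bsub>G\<^esub> h) x) \<xi>)
          - blinfun_apply (\<alpha> h x) (blinfun_apply y \<xi>))"
        by (intro sum.cong refl) (simp add: UNIV_bool a_def b_def gg_def blinfun.minus_left)
      also have "\<dots> = 0"
        using t [of \<xi>] by (simp add: sum_subtractf blinfun.sum_right)
      finally show "blinfun_apply (\<Sum>i\<in>I. a i o\<^sub>L \<alpha> (gg i) x o\<^sub>L b i) \<xi> = blinfun_apply 0 \<xi>"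
        by simp
    qed
  qed
  have adj: "is_adjoint (a i) (a' i)" for i
    using y'(2) by (simp add: a_def a'_def is_adjoint_def blinfun.minus_left
        hilb.ip_minus_left hilb.ip_minus_right)
  have ggc: "gg i \<in> carrier G" and bP: "b i \<in> P" if "i \<in> I" for i
    using that g y P_id by (auto simp: gg_def b_def I_def)
  obtain q where q: "\<And>i j. i \<in> I \<Longrightarrow> j \<in> I \<Longrightarrow> gg i \<noteq> gg j \<Longrightarrow> q i j = 0"
      "\<And>i. i \<in> I \<Longrightarrow> (\<Sum>j\<in>I. scaleC_op (q i j) (b j)) = 0"
      "\<And>i. i \<in> I \<Longrightarrow> (\<Sum>j\<in>I. scaleC_op (q i j) (a' j)) = a' i"
    using skew_relation [OF finI ggc adj bP rel] by blast
  let ?i = "(\<one>\<^bsub>G\<^esub>, True)" and ?j = "(g, False)"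
  have i: "?i \<in> I" using H by (simp add: I_def subgroup.one_closed)
  \<comment> \<open>Row \<open>?i\<close> has the automorphism of g, its group entry being the unit.
    The only other index with the same automorphism is \<open>?j\<close>, and it belongs to
    \<open>I\<close> exactly when g lies in H.\<close>
  have zero: "q ?i j = 0" if "j \<in> I" "j \<noteq> ?i" "j \<noteq> ?j" for j
    using that g by (intro q(1) [OF i]) (auto simp: I_def gg_def)
  have y0: "y = 0" if "y' = 0"
    using is_adjoint_sym [OF y'(2)] that
    by (intro is_adjoint_unique [of 0]) (simp_all add: is_adjoint_def hilb.ip_zero_left hilb.ip_zero_right)
  have zero_scalar: "0 = scaleC_op 0 (id_blinfun :: 'h \<Rightarrow>\<^sub>L 'h)" by simp
  show ?thesis
  proof (cases "g \<in> H")
    case True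
    then have j: "?j \<in> I" by (simp add: I_def)
    have two: "(\<Sum>j\<in>I. scaleC_op (q ?i j) (f j)) = scaleC_op (q ?i ?i) (f ?i) + scaleC_op (q ?i ?j) (f ?j)"
      for f :: "_ \<Rightarrow> 'h \<Rightarrow>\<^sub>L 'h"
    proof -
      have "(\<Sum>j\<in>I. scaleC_op (q ?i j) (f j)) = (\<Sum>j\<in>{?i, ?j}. scaleC_op (q ?i j) (f j))"
        using i j zero by (intro sum.mono_neutral_right finI) auto
      then show ?thesis by simp
    qed
    have r1: "scaleC_op (q ?i ?i) id_blinfun + scaleC_op (q ?i ?j) y = 0"
      using q(2) [OF i] two [of b] by (simp add: b_def)
    have r2: "scaleC_op (q ?i ?i) y' + scaleC_op (q ?i ?j) (- id_blinfun) = y'"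
      using q(3) [OF i] two [of a'] by (simp add: a'_def)
    \<comment> \<open>If the off-diagonal entry is nonzero, \<open>r1\<close> can be solved for y.
      Otherwise \<open>r1\<close> makes the diagonal entry 0 as well, and \<open>r2\<close> then
      reads 0 = y'.\<close>
    have "\<exists>c. y = scaleC_op c id_blinfun"
    proof (cases "q ?i ?j = 0")
      case True
      then have "q ?i ?i = 0" using r1 scaleC_op_id_eq_0 by simp
      then have "y = 0" using r2 True y0 by simp
      then show ?thesis using zero_scalar by metis
    next
      case False
      define d where "d = inverse (q ?i ?j)"
      have "scaleC_op (q ?i ?j) y = scaleC_op (- q ?i ?i) id_blinfun"
        using r1 scaleC_op_add [of "q ?i ?i" "- q ?i ?i" id_blinfun]
        by (metis add_left_cancel add.right_inverse scaleC_op_zero_left)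
      then have "scaleC_op d (scaleC_op (q ?i ?j) y) = scaleC_op d (scaleC_op (- q ?i ?i) id_blinfun)"
        by simp
      then show ?thesis using False by (auto simp: scaleC_op_scaleC_op d_def)
    qed
    then show ?thesis using True by blast
  next
    case False
    then have j: "?j \<notin> I" by (simp add: I_def)
    have one: "(\<Sum>j\<in>I. scaleC_op (q ?i j) (f j)) = scaleC_op (q ?i ?i) (f ?i)"
      for f :: "_ \<Rightarrow> 'h \<Rightarrow>\<^sub>L 'h"
    proof -
      have "(\<Sum>j\<in>I. scaleC_op (q ?i j) (f j)) = (\<Sum>j\<in>{?i}. scaleC_op (q ?i j) (f j))"
      proof (intro sum.mono_neutral_right finI ballI)
        fix k assume k: "k \<in> I - {?i}"
        then have "k \<noteq> ?j" using j by blast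
        with k show "scaleC_op (q ?i k) (f k) = 0" using zero [of k] by simp
      qed (use i in simp)
      then show ?thesis by simp
    qed
    \<comment> \<open>Without a partner in its row, the equation for \<open>b\<close> says that a
      multiple of the identity is 0; the equation for \<open>a'\<close> then gives y' = 0.\<close>
    have "q ?i ?i = 0"
      using q(2) [OF i] one [of b] scaleC_op_id_eq_0 by (simp add: b_def)
    then have "y' = 0" using q(3) [OF i] one [of a'] by (simp add: a'_def)
    then show ?thesis using y0 zero_scalar by metis
  qed
qed

end

section \<open>Multiplication and inclusions in the tower\<close>

interpretation elt: vector_space "scaleC_elt :: complex \<Rightarrow> ('g, 'h) elt \<Rightarrow> ('g, 'h :: complex_hilbert_space) elt"
  by (rule vector_space_scaleC_elt)

lemma scaleC_elt_apply: "scaleC_elt c f s t l = scaleC_op c (f s t l)"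
  by (simp add: scaleC_elt_def)

lemma scaleC_elt_unit_el: "scaleC_elt c (unit_el s t x l) = unit_el s t (scaleC_op c x) l"
  by (auto simp: scaleC_elt_def unit_el_def fun_eq_iff)

lemma sum_elt_apply: "(sum f A) s t l = (\<Sum>a\<in>A. f a s t l)" for f :: "'a \<Rightarrow> ('g, 'h :: complex_hilbert_space) elt"
  by (induction A rule: infinite_finite_induct) simp_all

lemma sum_elt_apply3:
  "(\<Sum>u\<in>A. \<Sum>v\<in>B. \<Sum>w\<in>C. f u v w) s t l = (\<Sum>u\<in>A. \<Sum>v\<in>B. \<Sum>w\<in>C. f u v w s t l)"
  for f :: "'a \<Rightarrow> 'b \<Rightarrow> 'c \<Rightarrow> ('g, 'h :: complex_hilbert_space) elt"
  by (simp only: sum_elt_apply)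

lemma sum3_delta:
  assumes "finite A" "finite B" "finite C" "u \<in> A" "v \<in> B" "w \<in> C"
  shows "(\<Sum>x\<in>A. \<Sum>y\<in>B. \<Sum>z\<in>C. if x = u \<and> y = v \<and> z = w then g x y z else 0) = g u v w"
proof -
  have "(\<Sum>z\<in>C. if x = u \<and> y = v \<and> z = w then g x y z else 0)
      = (if y = v then if x = u then g u v w else 0 else 0)" for x y
    using assms by (cases "x = u"; cases "y = v") simp_all
  then show ?thesis using assms by simp
qed

lemma finite_Lgrp: "finite H \<Longrightarrow> finite K \<Longrightarrow> finite (Lgrp H K n)"
  by (simp add: Lgrp_def)

lemma finite_Sset: "finite H \<Longrightarrow> finite K \<Longrightarrow> finite (Sset H K n)"
proof (induction n)
  case 0
  have "Sset H K 0 = {[]}" by (auto simp: Sset_def)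
  then show ?case by simp
next
  case (Suc n)
  have "Sset H K (Suc n) = (\<lambda>(s, a). s @ [a]) ` (Sset H K n \<times> Lgrp H K n)"
    by (auto simp: Sset_Suc)
  then show ?case using Suc by (simp add: finite_Lgrp)
qed

lemma Tset_eq_Sset: "Tset H K = Sset K H"
  by (intro ext) (simp add: Tset_def Sset_def)

lemma mu_Nil [simp]: "mu G [] = \<one>\<^bsub>G\<^esub>"
  by (simp add: mu_def)

lemma mu_Cons [simp]: "mu G (k # t) = k \<otimes>\<^bsub>G\<^esub> mu G t"
  by (simp add: mu_def)

lemma (in group) mu_closed: "set s \<subseteq> carrier G \<Longrightarrow> mu G s \<in> carrier G"
  by (induction s) simp_all

lemma (in group) mu_snoc:
  "set s \<subseteq> carrier G \<Longrightarrow> a \<in> carrier G \<Longrightarrow> mu G (s @ [a]) = mu G s \<otimes>\<^bsub>G\<^esub> a"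
  by (induction s) (simp_all add: mu_closed m_assoc)

section \<open>Coordinates in the tower and products with elements supported at the unit\<close>

locale group_type_tower = outer_factor G P \<alpha>
  for G :: "('g, 'm) monoid_scheme" and P :: "('h \<Rightarrow>\<^sub>L 'h :: complex_hilbert_space) set" and \<alpha> +
  fixes H K :: "'g set"
  assumes H: "subgroup H G" and finite_H: "finite H" and K: "subgroup K G" and finite_K: "finite K"
begin

abbreviation "S \<equiv> Sset H K"
abbreviation "L \<equiv> Lgrp H K"
abbreviation "tmul \<equiv> tower_mult G H K \<alpha>"

lemma fin [simp]: "finite (S n)" "finite (L n)"
  by (simp_all add: finite_Sset finite_Lgrp finite_H finite_K)

lemma subgroup_L: "subgroup (L n) G"
  by (simp add: Lgrp_def H K)

lemma L_carrier [simp]: "a \<in> L n \<Longrightarrow> a \<in> carrier G"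
  using subgroup_L by (rule subgroup.mem_carrier)

lemma K_carrier [simp]: "a \<in> K \<Longrightarrow> a \<in> carrier G"
  using K by (rule subgroup.mem_carrier)

lemma one_L [simp]: "\<one>\<^bsub>G\<^esub> \<in> L n"
  using subgroup_L by (rule subgroup.one_closed)

lemma L_mult [simp]: "a \<in> L n \<Longrightarrow> b \<in> L n \<Longrightarrow> a \<otimes>\<^bsub>G\<^esub> b \<in> L n"
  using subgroup_L by (rule subgroup.m_closed)

lemma L_inv [simp]: "a \<in> L n \<Longrightarrow> inv\<^bsub>G\<^esub> a \<in> L n"
  using subgroup_L by (rule subgroup.m_inv_closed)

lemma S_carrier: "s \<in> S n \<Longrightarrow> set s \<subseteq> carrier G"
  using H K by (fastforce simp: Sset_def in_set_conv_nth split: if_splits dest: subgroup.mem_carrier)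

lemma mu_S [simp]: "s \<in> S n \<Longrightarrow> mu G s \<in> carrier G"
  by (intro mu_closed S_carrier)

lemma S_snoc: "s @ [a] \<in> S (Suc n) \<longleftrightarrow> s \<in> S n \<and> a \<in> L n"
  by (auto simp: Sset_Suc)

lemma S_Cons: "k # t \<in> S (Suc n) \<longleftrightarrow> k \<in> K \<and> t \<in> Tset H K n"
  by (auto simp: Sset_Suc_Tset)

lemma S_0: "S 0 = {[]}"
  by (auto simp: Sset_def)

lemma tower_P: "f \<in> tower H K P n \<Longrightarrow> f s t l \<in> P"
  by (simp add: tower_def)

lemma tower_outside:
  "f \<in> tower H K P n \<Longrightarrow> \<not> (s \<in> S n \<and> t \<in> S n \<and> l \<in> L n) \<Longrightarrow> f s t l = 0"
  by (simp add: tower_def)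

text \<open>\<open>M(\<complex>) \<otimes> P\<close>: support at the unit of the crossed product.\<close>

definition in_base :: "('g, 'h) elt \<Rightarrow> bool" where
  "in_base f \<longleftrightarrow> (\<forall>s t l. f s t l \<in> P \<and> (l \<noteq> \<one>\<^bsub>G\<^esub> \<longrightarrow> f s t l = 0))"

text \<open>With the right factor supported at the unit only a = l contributes, and moving l past
  that factor leaves its automorphism there.\<close>

lemma mult_base_right:
  assumes b: "in_base b" and s: "s \<in> S n" "t \<in> S n" "l \<in> L n"
  shows "tmul n f b s t l = (\<Sum>r\<in>S n. f s r l o\<^sub>L \<alpha> l (b r t \<one>\<^bsub>G\<^esub>))"
proof -
  have "(\<Sum>a\<in>L n. f s r a o\<^sub>L \<alpha> a (b r t (inv\<^bsub>G\<^esub> a \<otimes>\<^bsub>G\<^esub> l))) = f s r l o\<^sub>L \<alpha> l (b r t \<one>\<^bsub>G\<^esub>)" for r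
  proof -
    have "(\<Sum>a\<in>L n. f s r a o\<^sub>L \<alpha> a (b r t (inv\<^bsub>G\<^esub> a \<otimes>\<^bsub>G\<^esub> l)))
        = (\<Sum>a\<in>{l}. f s r a o\<^sub>L \<alpha> a (b r t (inv\<^bsub>G\<^esub> a \<otimes>\<^bsub>G\<^esub> l)))"
    proof (intro sum.mono_neutral_right ballI)
      fix a assume a: "a \<in> L n - {l}"
      then have ac: "a \<in> carrier G" using L_carrier by blast
      have "inv\<^bsub>G\<^esub> a \<otimes>\<^bsub>G\<^esub> l \<noteq> \<one>\<^bsub>G\<^esub>"
        using s a ac L_carrier by (metis DiffE inv_closed inv_equality inv_inv singletonI)
      then show "f s r a o\<^sub>L \<alpha> a (b r t (inv\<^bsub>G\<^esub> a \<otimes>\<^bsub>G\<^esub> l)) = 0"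
        using b by (simp add: in_base_def \<alpha>_zero ac)
    qed (use s in simp_all)
    then show ?thesis using s by simp
  qed
  then show ?thesis using s by (simp add: tower_mult_def)
qed

lemma mult_base_left:
  assumes b: "in_base b" and f: "\<And>s t l. f s t l \<in> P" and s: "s \<in> S n" "t \<in> S n" "l \<in> L n"
  shows "tmul n b f s t l = (\<Sum>r\<in>S n. b s r \<one>\<^bsub>G\<^esub> o\<^sub>L f r t l)"
proof -
  have "(\<Sum>a\<in>L n. b s r a o\<^sub>L \<alpha> a (f r t (inv\<^bsub>G\<^esub> a \<otimes>\<^bsub>G\<^esub> l))) = b s r \<one>\<^bsub>G\<^esub> o\<^sub>L f r t l" for r
  proof -
    have "(\<Sum>a\<in>L n. b s r a o\<^sub>L \<alpha> a (f r t (inv\<^bsub>G\<^esub> a \<otimes>\<^bsub>G\<^esub> l)))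
        = (\<Sum>a\<in>{\<one>\<^bsub>G\<^esub>}. b s r a o\<^sub>L \<alpha> a (f r t (inv\<^bsub>G\<^esub> a \<otimes>\<^bsub>G\<^esub> l)))"
      using b by (intro sum.mono_neutral_right) (auto simp: in_base_def)
    then show ?thesis using s f by (simp add: \<alpha>_one)
  qed
  then show ?thesis using s by (simp add: tower_mult_def)
qed

text \<open>At row s @ [b] the first factor forces the intermediate index t0 @ [b]; at column t @
  [c] the second one forces t0 @ [l0 c]. The resulting condition b = l0 c is solved for l0, so that
  the sum over l0 picks a single term.\<close>

lemma tower_incl_summand:
  assumes s0: "s0 \<in> S n" "t0 \<in> S n" "l0 \<in> L n" and x: "x \<in> P"
    and s: "s \<in> S n" "t \<in> S n" "b \<in> L n" "c \<in> L n" "l \<in> L (Suc n)"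
  shows "tmul (Suc n)
      (\<Sum>a\<in>L n. unit_el (s0 @ [a]) (t0 @ [a]) (\<alpha> (inv\<^bsub>G\<^esub> a) x) \<one>\<^bsub>G\<^esub>)
      (\<Sum>a\<in>L n. unit_el (t0 @ [l0 \<otimes>\<^bsub>G\<^esub> a]) (t0 @ [a]) id_blinfun \<one>\<^bsub>G\<^esub>) (s @ [b]) (t @ [c]) l
    = (if s = s0 \<and> t = t0 \<and> l = \<one>\<^bsub>G\<^esub> \<and> l0 = b \<otimes>\<^bsub>G\<^esub> inv\<^bsub>G\<^esub> c then \<alpha> (inv\<^bsub>G\<^esub> b) x else 0)"
    (is "tmul (Suc n) ?A ?B _ _ _ = _")
proof -
  have A: "?A (s @ [b]) r l' = (if r = t0 @ [b] then if s = s0 \<and> l' = \<one>\<^bsub>G\<^esub> then \<alpha> (inv\<^bsub>G\<^esub> b) x else 0 else 0)" for r l'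
  proof -
    have "?A (s @ [b]) r l' = (\<Sum>a\<in>L n. if a = b then
        if r = t0 @ [b] then if s = s0 \<and> l' = \<one>\<^bsub>G\<^esub> then \<alpha> (inv\<^bsub>G\<^esub> b) x else 0 else 0 else 0)"
      unfolding sum_elt_apply unit_el_def by (intro sum.cong) auto
    then show ?thesis using s by simp
  qed
  have B: "?B r (t @ [c]) l' = (if r = t0 @ [l0 \<otimes>\<^bsub>G\<^esub> c] \<and> t = t0 \<and> l' = \<one>\<^bsub>G\<^esub> then id_blinfun else 0)" for r l'
  proof -
    have "?B r (t @ [c]) l' = (\<Sum>a\<in>L n. if a = c then
        if r = t0 @ [l0 \<otimes>\<^bsub>G\<^esub> c] \<and> t = t0 \<and> l' = \<one>\<^bsub>G\<^esub> then id_blinfun else 0 else 0)"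
      unfolding sum_elt_apply unit_el_def by (intro sum.cong) auto
    then show ?thesis using s by simp
  qed
  have Abase: "in_base ?A"
    unfolding in_base_def sum_elt_apply unit_el_def
    using x by (auto intro!: P_sum \<alpha>_P sum.neutral simp: P_zero)
  have BP: "?B s t l \<in> P" for s t l
    unfolding sum_elt_apply unit_el_def by (intro P_sum) (simp add: P_id P_zero)
  have "tmul (Suc n) ?A ?B (s @ [b]) (t @ [c]) l
      = (\<Sum>r\<in>S (Suc n). ?A (s @ [b]) r \<one>\<^bsub>G\<^esub> o\<^sub>L ?B r (t @ [c]) l)"
    by (intro mult_base_left Abase BP) (simp_all add: S_snoc s)
  also have "\<dots> = (\<Sum>r\<in>S (Suc n). if r = t0 @ [b] then
      if s = s0 \<and> t = t0 \<and> l = \<one>\<^bsub>G\<^esub> \<and> b = l0 \<otimes>\<^bsub>G\<^esub> c then \<alpha> (inv\<^bsub>G\<^esub> b) x else 0 else 0)"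
    unfolding A B by (intro sum.cong) (auto simp: blinfun_eqI)
  also have "\<dots> = (if s = s0 \<and> t = t0 \<and> l = \<one>\<^bsub>G\<^esub> \<and> b = l0 \<otimes>\<^bsub>G\<^esub> c then \<alpha> (inv\<^bsub>G\<^esub> b) x else 0)"
    using s s0 by (simp add: S_snoc)
  also have "b = l0 \<otimes>\<^bsub>G\<^esub> c \<longleftrightarrow> l0 = b \<otimes>\<^bsub>G\<^esub> inv\<^bsub>G\<^esub> c"
    using s s0 by (metis L_carrier inv_solve_right)
  finally show ?thesis .
qed

lemma tower_incl_snoc:
  assumes f: "f \<in> tower H K P n" and s: "s \<in> S n" "t \<in> S n" "b \<in> L n" "c \<in> L n" "l \<in> L (Suc n)"
  shows "tower_incl G H K \<alpha> n f (s @ [b]) (t @ [c]) l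
    = (if l = \<one>\<^bsub>G\<^esub> then \<alpha> (inv\<^bsub>G\<^esub> b) (f s t (b \<otimes>\<^bsub>G\<^esub> inv\<^bsub>G\<^esub> c)) else 0)"
proof -
  have "tower_incl G H K \<alpha> n f (s @ [b]) (t @ [c]) l
      = (\<Sum>s0\<in>S n. \<Sum>t0\<in>S n. \<Sum>l0\<in>L n. if s = s0 \<and> t = t0 \<and> l = \<one>\<^bsub>G\<^esub> \<and> l0 = b \<otimes>\<^bsub>G\<^esub> inv\<^bsub>G\<^esub> c
          then \<alpha> (inv\<^bsub>G\<^esub> b) (f s0 t0 l0) else 0)"
    unfolding tower_incl_def sum_elt_apply3
    by (intro sum.cong refl tower_incl_summand tower_P [OF f] s)
  also have "\<dots> = (if l = \<one>\<^bsub>G\<^esub> then \<alpha> (inv\<^bsub>G\<^esub> b) (f s t (b \<otimes>\<^bsub>G\<^esub> inv\<^bsub>G\<^esub> c)) else 0)"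
  proof (cases "l = \<one>\<^bsub>G\<^esub>")
    case True
    have "(s = s0 \<and> t = t0 \<and> l = \<one>\<^bsub>G\<^esub> \<and> l0 = b \<otimes>\<^bsub>G\<^esub> inv\<^bsub>G\<^esub> c)
        \<longleftrightarrow> (s0 = s \<and> t0 = t \<and> l0 = b \<otimes>\<^bsub>G\<^esub> inv\<^bsub>G\<^esub> c)" for s0 t0 l0
      using True by auto
    then show ?thesis
      using True s sum3_delta [of "S n" "S n" "L n" s t "b \<otimes>\<^bsub>G\<^esub> inv\<^bsub>G\<^esub> c"
          "\<lambda>s0 t0 l0. \<alpha> (inv\<^bsub>G\<^esub> b) (f s0 t0 l0)"]
      by simp
  qed simp
  finally show ?thesis .
qed

lemma tower_incl_outside:
  assumes "\<not> (s \<in> S (Suc n) \<and> t \<in> S (Suc n) \<and> l \<in> L (Suc n))"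
  shows "tower_incl G H K \<alpha> n f s t l = 0"
  using assms unfolding tower_incl_def sum_elt_apply3 by (intro sum.neutral ballI) (auto simp: tower_mult_def)

text \<open>The image of M at level n \<ge> 1 in closed form: x goes to the diagonal with entries
  mu(s)^-1(x), and k to \<lambda>_k in the first coordinate, so x k has entries only where the tails
  agree and the heads satisfy hd s = k (hd t). At level 0 the lists have no head and the formula is
  not meant.\<close>

definition embM :: "nat \<Rightarrow> ('g, 'h) elt \<Rightarrow> ('g, 'h) elt" where
  "embM n f = (\<lambda>s t l. if s \<in> S n \<and> t \<in> S n \<and> l = \<one>\<^bsub>G\<^esub> \<and> tl s = tl t
     then \<alpha> (inv\<^bsub>G\<^esub> (mu G s)) (f [] [] (hd s \<otimes>\<^bsub>G\<^esub> inv\<^bsub>G\<^esub> (hd t))) else 0)"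

lemma embM_base:
  assumes "f \<in> tower H K P 0"
  shows "in_base (embM n f)"
  unfolding in_base_def embM_def
  by (auto simp: P_zero intro!: \<alpha>_P tower_P [OF assms])

lemma embM_tower:
  assumes "f \<in> tower H K P 0"
  shows "embM n f \<in> tower H K P n"
  unfolding tower_def embM_def
  by (auto simp: P_zero intro!: \<alpha>_P tower_P [OF assms])

text \<open>Only the inclusion of level 0 into level 1 turns group elements into matrices.
  Afterwards all coefficients sit at the unit, and an inclusion appends the same entry to row and
  column.\<close>

lemma tower_embed_M:
  assumes f: "f \<in> tower H K P 0"
  shows "tower_embed G H K \<alpha> (Suc n) f = embM (Suc n) f"
proof (induction n)
  case 0
  show ?case
  proof (intro ext)
    fix s t l
    show "tower_embed G H K \<alpha> (Suc 0) f s t l = embM (Suc 0) f s t l"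
    proof (cases "s \<in> S (Suc 0) \<and> t \<in> S (Suc 0) \<and> l \<in> L (Suc 0)")
      case True
      then obtain b c where b: "s = [] @ [b]" "t = [] @ [c]" "b \<in> L 0" "c \<in> L 0"
        by (auto simp: Sset_Suc S_0)
      have "tower_incl G H K \<alpha> 0 f ([] @ [b]) ([] @ [c]) l
          = (if l = \<one>\<^bsub>G\<^esub> then \<alpha> (inv\<^bsub>G\<^esub> b) (f [] [] (b \<otimes>\<^bsub>G\<^esub> inv\<^bsub>G\<^esub> c)) else 0)"
        using True b by (intro tower_incl_snoc f) (simp_all add: S_0)
      then show ?thesis using True b by (simp add: embM_def)
    next
      case False
      then show ?thesis by (auto simp: tower_incl_outside embM_def)
    qed
  qed
next
  case (Suc n)
  show ?case
  proof (intro ext)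
    fix s t l
    show "tower_embed G H K \<alpha> (Suc (Suc n)) f s t l = embM (Suc (Suc n)) f s t l"
    proof (cases "s \<in> S (Suc (Suc n)) \<and> t \<in> S (Suc (Suc n)) \<and> l \<in> L (Suc (Suc n))")
      case True
      then obtain s' t' b c where b: "s = s' @ [b]" "t = t' @ [c]" "b \<in> L (Suc n)" "c \<in> L (Suc n)"
          "s' \<in> S (Suc n)" "t' \<in> S (Suc n)"
        by (auto simp: Sset_Suc [of _ _ "Suc n"])
      have ne: "s' \<noteq> []" "t' \<noteq> []" using b by (auto simp: Sset_def)
      \<comment> \<open>Support at the unit in level n + 1 becomes equality of the newly appended
        entries.\<close>
      have eq1: "b \<otimes>\<^bsub>G\<^esub> inv\<^bsub>G\<^esub> c = \<one>\<^bsub>G\<^esub> \<longleftrightarrow> b = c"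
        using b by (metis L_carrier inv_closed inv_equality inv_inv r_inv)
      have mu: "inv\<^bsub>G\<^esub> (mu G s) = inv\<^bsub>G\<^esub> b \<otimes>\<^bsub>G\<^esub> inv\<^bsub>G\<^esub> (mu G s')"
        using b by (simp add: mu_snoc S_carrier inv_mult_group)
      have "tower_incl G H K \<alpha> (Suc n) (embM (Suc n) f) (s' @ [b]) (t' @ [c]) l
          = (if l = \<one>\<^bsub>G\<^esub> then \<alpha> (inv\<^bsub>G\<^esub> b) (embM (Suc n) f s' t' (b \<otimes>\<^bsub>G\<^esub> inv\<^bsub>G\<^esub> c)) else 0)"
        using True b by (intro tower_incl_snoc embM_tower f) simp_all
      also have "\<dots> = embM (Suc (Suc n)) f s t l"
        using b ne True eq1 mu
        by (auto simp: embM_def S_snoc \<alpha>_mult \<alpha>_zero tower_P [OF f])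
      finally show ?thesis using Suc b by simp
    next
      case False
      then show ?thesis by (auto simp: tower_incl_outside embM_def)
    qed
  qed
qed

definition diag :: "nat \<Rightarrow> ('h \<Rightarrow>\<^sub>L 'h) \<Rightarrow> ('g, 'h) elt" where
  "diag n x = (\<lambda>s t l. if s \<in> S n \<and> t = s \<and> l = \<one>\<^bsub>G\<^esub> then \<alpha> (inv\<^bsub>G\<^esub> (mu G s)) x else 0)"

lemma unit_el_tower: "x \<in> P \<Longrightarrow> s \<in> S n \<Longrightarrow> t \<in> S n \<Longrightarrow> l \<in> L n \<Longrightarrow> unit_el s t x l \<in> tower H K P n"
  by (auto simp: unit_el_def tower_def P_zero)

lemma tower_embed_P:
  assumes x: "x \<in> P"
  shows "tower_embed G H K \<alpha> n (unit_el [] [] x \<one>\<^bsub>G\<^esub>) = diag n x"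
proof (cases n)
  case 0
  then show ?thesis using x by (auto simp: diag_def unit_el_def S_0 \<alpha>_one fun_eq_iff)
next
  case (Suc m)
  have u: "unit_el [] [] x \<one>\<^bsub>G\<^esub> \<in> tower H K P 0"
    using x by (intro unit_el_tower) (simp_all add: S_0)
  \<comment> \<open>Since x has its only coefficient at the unit, the heads must agree along with
    the tails, which leaves the diagonal.\<close>
  have "tl s = tl t \<and> hd s \<otimes>\<^bsub>G\<^esub> inv\<^bsub>G\<^esub> (hd t) = \<one>\<^bsub>G\<^esub> \<longleftrightarrow> t = s" if st: "s \<in> S n" "t \<in> S n" for s t
  proof -
    obtain k s' where s: "s = k # s'" "k \<in> K" using st unfolding Suc Sset_Suc_Tset by auto
    obtain k' t' where t: "t = k' # t'" "k' \<in> K" using st unfolding Suc Sset_Suc_Tset by auto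
    have "k \<otimes>\<^bsub>G\<^esub> inv\<^bsub>G\<^esub> k' = \<one>\<^bsub>G\<^esub> \<longleftrightarrow> k' = k"
      using s t by (metis K_carrier inv_closed inv_equality inv_inv r_inv)
    then show ?thesis using s t by auto
  qed
  then have "embM n (unit_el [] [] x \<one>\<^bsub>G\<^esub>) = diag n x"
    by (intro ext) (auto simp: embM_def diag_def unit_el_def \<alpha>_zero)
  then show ?thesis using tower_embed_M [OF u, of m] Suc by simp
qed

lemma diag_base: "x \<in> P \<Longrightarrow> in_base (diag n x)"
  by (auto simp: in_base_def diag_def P_zero \<alpha>_P)

text \<open>Multiplication by a diagonal element supported at the unit does not mix coefficients, so
  there is one equation for each triple (s, t, l). The automorphism of mu(s) is injective on P, and
  applying it frees x on the right-hand side.\<close>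

lemma commutes_diag_iff:
  assumes f: "f \<in> tower H K P n" and x: "x \<in> P"
  shows "tmul n f (diag n x) = tmul n (diag n x) f \<longleftrightarrow>
    (\<forall>s\<in>S n. \<forall>t\<in>S n. \<forall>l\<in>L n.
       \<alpha> (mu G s) (f s t l) o\<^sub>L \<alpha> (mu G s \<otimes>\<^bsub>G\<^esub> l \<otimes>\<^bsub>G\<^esub> inv\<^bsub>G\<^esub> (mu G t)) x
         = x o\<^sub>L \<alpha> (mu G s) (f s t l))"
proof -
  note fP = tower_P [OF f]
  have right: "tmul n f (diag n x) s t l = f s t l o\<^sub>L \<alpha> l (\<alpha> (inv\<^bsub>G\<^esub> (mu G t)) x)"
    if s: "s \<in> S n" "t \<in> S n" "l \<in> L n" for s t l
  proof -
    have "tmul n f (diag n x) s t l = (\<Sum>r\<in>S n. if r = t then f s t l o\<^sub>L \<alpha> l (\<alpha> (inv\<^bsub>G\<^esub> (mu G t)) x) else 0)"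
      unfolding mult_base_right [OF diag_base [OF x] s]
      by (intro sum.cong) (use s in \<open>auto simp: diag_def \<alpha>_zero\<close>)
    then show ?thesis using s by simp
  qed
  have left: "tmul n (diag n x) f s t l = \<alpha> (inv\<^bsub>G\<^esub> (mu G s)) x o\<^sub>L f s t l"
    if s: "s \<in> S n" "t \<in> S n" "l \<in> L n" for s t l
  proof -
    have "tmul n (diag n x) f s t l = (\<Sum>r\<in>S n. if r = s then \<alpha> (inv\<^bsub>G\<^esub> (mu G s)) x o\<^sub>L f s t l else 0)"
      unfolding mult_base_left [OF diag_base [OF x] fP s]
      by (intro sum.cong) (use s in \<open>auto simp: diag_def\<close>)
    then show ?thesis using s by simp
  qed
  have entry: "tmul n f (diag n x) s t l = tmul n (diag n x) f s t l \<longleftrightarrow>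
      \<alpha> (mu G s) (f s t l) o\<^sub>L \<alpha> (mu G s \<otimes>\<^bsub>G\<^esub> l \<otimes>\<^bsub>G\<^esub> inv\<^bsub>G\<^esub> (mu G t)) x = x o\<^sub>L \<alpha> (mu G s) (f s t l)"
    if s: "s \<in> S n" "t \<in> S n" "l \<in> L n" for s t l
  proof -
    have xP: "\<alpha> l (\<alpha> (inv\<^bsub>G\<^esub> (mu G t)) x) \<in> P" "\<alpha> (inv\<^bsub>G\<^esub> (mu G s)) x \<in> P"
      using s x by (simp_all add: \<alpha>_P)
    have "tmul n f (diag n x) s t l = tmul n (diag n x) f s t l \<longleftrightarrow>
        \<alpha> (mu G s) (f s t l o\<^sub>L \<alpha> l (\<alpha> (inv\<^bsub>G\<^esub> (mu G t)) x))
          = \<alpha> (mu G s) (\<alpha> (inv\<^bsub>G\<^esub> (mu G s)) x o\<^sub>L f s t l)"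
      unfolding right [OF s] left [OF s]
      using \<alpha>_inj [of "mu G s", OF _ P_comp [OF fP xP(1)] P_comp [OF xP(2) fP]] s by auto
    also have "\<alpha> (mu G s) (f s t l o\<^sub>L \<alpha> l (\<alpha> (inv\<^bsub>G\<^esub> (mu G t)) x))
        = \<alpha> (mu G s) (f s t l) o\<^sub>L \<alpha> (mu G s \<otimes>\<^bsub>G\<^esub> l \<otimes>\<^bsub>G\<^esub> inv\<^bsub>G\<^esub> (mu G t)) x"
      using s x fP xP by (simp add: \<alpha>_comp \<alpha>_mult \<alpha>_P)
    also have "\<alpha> (mu G s) (\<alpha> (inv\<^bsub>G\<^esub> (mu G s)) x o\<^sub>L f s t l) = x o\<^sub>L \<alpha> (mu G s) (f s t l)"
      using s x fP xP by (simp add: \<alpha>_comp \<alpha>_inv)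
    finally show ?thesis .
  qed
  show ?thesis
  proof
    assume "tmul n f (diag n x) = tmul n (diag n x) f"
    then show "\<forall>s\<in>S n. \<forall>t\<in>S n. \<forall>l\<in>L n.
       \<alpha> (mu G s) (f s t l) o\<^sub>L \<alpha> (mu G s \<otimes>\<^bsub>G\<^esub> l \<otimes>\<^bsub>G\<^esub> inv\<^bsub>G\<^esub> (mu G t)) x
         = x o\<^sub>L \<alpha> (mu G s) (f s t l)"
      by (simp flip: entry)
  next
    assume *: "\<forall>s\<in>S n. \<forall>t\<in>S n. \<forall>l\<in>L n.
       \<alpha> (mu G s) (f s t l) o\<^sub>L \<alpha> (mu G s \<otimes>\<^bsub>G\<^esub> l \<otimes>\<^bsub>G\<^esub> inv\<^bsub>G\<^esub> (mu G t)) x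
         = x o\<^sub>L \<alpha> (mu G s) (f s t l)"
    show "tmul n f (diag n x) = tmul n (diag n x) f"
    proof (intro ext)
      fix s t l
      show "tmul n f (diag n x) s t l = tmul n (diag n x) f s t l"
      proof (cases "s \<in> S n \<and> t \<in> S n \<and> l \<in> L n")
        case True
        then show ?thesis using entry * by blast
      next
        case False
        show ?thesis unfolding tower_mult_def if_not_P [OF False] by (rule refl)
      qed
    qed
  qed
qed

end

section \<open>Relative commutants\<close>

context group_type_tower
begin

lemma fixed_points_trivial: "fixed_points {\<one>\<^bsub>G\<^esub>} P \<alpha> = P"
  by (auto simp: fixed_points_def \<alpha>_one)

lemma scalar_P: "scaleC_op c id_blinfun \<in> P"
  by (intro P_scaleC P_id)

lemma \<alpha>_scalar: "g \<in> carrier G \<Longrightarrow> \<alpha> g (scaleC_op c id_blinfun) = scaleC_op c id_blinfun"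
  by (simp add: \<alpha>_scaleC P_id \<alpha>_id)

lemma scalar_commutes: "x \<in> P \<Longrightarrow> scaleC_op c id_blinfun o\<^sub>L x = x o\<^sub>L scaleC_op c id_blinfun"
  by (rule blinfun_eqI) (simp add: scaleC_op_apply bounded_ops_scaleC P_bounded_ops)

text \<open>The commutant of the image of P^A in coordinates; the parameter A lets N and P share one
  computation.\<close>

definition scalar_elts :: "nat \<Rightarrow> 'g set \<Rightarrow> ('g, 'h) elt set" where
  "scalar_elts n A = {f \<in> tower H K P n. \<forall>s\<in>S n. \<forall>t\<in>S n. \<forall>l\<in>L n.
     (\<exists>c. f s t l = scaleC_op c id_blinfun) \<and>
     (mu G s \<otimes>\<^bsub>G\<^esub> l \<otimes>\<^bsub>G\<^esub> inv\<^bsub>G\<^esub> (mu G t) \<notin> A \<longrightarrow> f s t l = 0)}"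

lemma scalar_eltsD:
  assumes "f \<in> scalar_elts n A" "s \<in> S n" "t \<in> S n" "l \<in> L n"
  shows "\<exists>c. f s t l = scaleC_op c id_blinfun"
    and "mu G s \<otimes>\<^bsub>G\<^esub> l \<otimes>\<^bsub>G\<^esub> inv\<^bsub>G\<^esub> (mu G t) \<notin> A \<Longrightarrow> f s t l = 0"
  using assms by (simp_all add: scalar_elts_def)

text \<open>Automorphisms fix scalars, so a coefficient is scalar as soon as its translate by mu(s)
  is. Conversely, where the group element lies in A it fixes x, and scalars commute with x;
  elsewhere both sides are 0.\<close>

lemma commutes_fixed_points_iff:
  assumes A: "subgroup A G" "finite A" and f: "f \<in> tower H K P n"
  shows "(\<forall>x\<in>fixed_points A P \<alpha>. tmul n f (diag n x) = tmul n (diag n x) f) \<longleftrightarrow> f \<in> scalar_elts n A"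
proof
  assume comm: "\<forall>x\<in>fixed_points A P \<alpha>. tmul n f (diag n x) = tmul n (diag n x) f"
  have "(\<exists>c. f s t l = scaleC_op c id_blinfun) \<and>
     (mu G s \<otimes>\<^bsub>G\<^esub> l \<otimes>\<^bsub>G\<^esub> inv\<^bsub>G\<^esub> (mu G t) \<notin> A \<longrightarrow> f s t l = 0)"
    if s: "s \<in> S n" "t \<in> S n" "l \<in> L n" for s t l
  proof -
    let ?g = "mu G s \<otimes>\<^bsub>G\<^esub> l \<otimes>\<^bsub>G\<^esub> inv\<^bsub>G\<^esub> (mu G t)" and ?y = "\<alpha> (mu G s) (f s t l)"
    have mu: "mu G s \<in> carrier G" using s by simp
    have g: "?g \<in> carrier G" and y: "?y \<in> P" using s by (simp_all add: \<alpha>_P tower_P [OF f])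
    have "?y o\<^sub>L \<alpha> ?g x = x o\<^sub>L ?y" if x: "x \<in> fixed_points A P \<alpha>" for x
    proof -
      have "x \<in> P" using x by (simp add: fixed_points_def)
      from commutes_diag_iff [OF f this] comm x s show ?thesis by blast
    qed
    then have res: "(\<exists>c. ?y = scaleC_op c id_blinfun) \<and> (?g \<notin> A \<longrightarrow> ?y = 0)"
      by (rule fixed_point_intertwiner [OF y g A])
    have y_inv: "f s t l = \<alpha> (inv\<^bsub>G\<^esub> (mu G s)) ?y"
      by (rule \<alpha>_inv' [OF mu tower_P [OF f], symmetric])
    show ?thesis
    proof
      from res obtain c where "?y = scaleC_op c id_blinfun" by blast
      then show "\<exists>c. f s t l = scaleC_op c id_blinfun"
        using y_inv mu \<alpha>_scalar by (metis inv_closed)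
      show "?g \<notin> A \<longrightarrow> f s t l = 0"
        using res y_inv mu \<alpha>_zero by (metis inv_closed)
    qed
  qed
  then show "f \<in> scalar_elts n A" using f by (simp add: scalar_elts_def)
next
  assume sc: "f \<in> scalar_elts n A"
  show "\<forall>x\<in>fixed_points A P \<alpha>. tmul n f (diag n x) = tmul n (diag n x) f"
  proof
    fix x assume x: "x \<in> fixed_points A P \<alpha>"
    then have xP: "x \<in> P" by (simp add: fixed_points_def)
    have "\<alpha> (mu G s) (f s t l) o\<^sub>L \<alpha> (mu G s \<otimes>\<^bsub>G\<^esub> l \<otimes>\<^bsub>G\<^esub> inv\<^bsub>G\<^esub> (mu G t)) x
        = x o\<^sub>L \<alpha> (mu G s) (f s t l)"
      if s: "s \<in> S n" "t \<in> S n" "l \<in> L n" for s t l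
    proof (cases "mu G s \<otimes>\<^bsub>G\<^esub> l \<otimes>\<^bsub>G\<^esub> inv\<^bsub>G\<^esub> (mu G t) \<in> A")
      case True
      then have "\<alpha> (mu G s \<otimes>\<^bsub>G\<^esub> l \<otimes>\<^bsub>G\<^esub> inv\<^bsub>G\<^esub> (mu G t)) x = x"
        using x by (simp add: fixed_points_def)
      moreover obtain c where "f s t l = scaleC_op c id_blinfun"
        using scalar_eltsD(1) [OF sc s] by blast
      moreover have "mu G s \<in> carrier G" using s by simp
      ultimately show ?thesis by (simp add: \<alpha>_scalar scalar_commutes xP)
    next
      case False
      then have "f s t l = 0" by (rule scalar_eltsD(2) [OF sc s])
      moreover have "mu G s \<in> carrier G" using s by simp
      ultimately show ?thesis by (simp add: \<alpha>_zero blinfun_eqI)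
    qed
    then show "tmul n f (diag n x) = tmul n (diag n x) f"
      using commutes_diag_iff [OF f xP] by blast
  qed
qed

lemma relative_commutant_N:
  "relative_commutant (tmul n) (tower_embed G H K \<alpha> n ` subfactor_N G H P \<alpha>) (tower H K P n)
    = scalar_elts n H"
proof -
  have emb: "tower_embed G H K \<alpha> n ` subfactor_N G H P \<alpha> = diag n ` fixed_points H P \<alpha>"
    unfolding subfactor_N_def image_image
    by (intro image_cong refl tower_embed_P) (simp add: fixed_points_def)
  show ?thesis
    unfolding relative_commutant_def emb ball_simps
    using commutes_fixed_points_iff [OF H finite_H] by (auto simp: scalar_elts_def)
qed

section \<open>Spanning sets and the commutants at level 0\<close>

lemma subspace_tower: "elt.subspace (tower H K P n)"
  unfolding elt.subspace_def tower_def
  by (auto simp: P_zero P_add P_scaleC scaleC_elt_apply)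

lemma subspace_scalar_elts: "elt.subspace (scalar_elts n A)"
  unfolding elt.subspace_def
proof (intro conjI ballI allI)
  show "0 \<in> scalar_elts n A"
    using elt.subspace_0 [OF subspace_tower] by (auto simp: scalar_elts_def intro: exI [of _ 0])
  show "f + g \<in> scalar_elts n A" if "f \<in> scalar_elts n A" "g \<in> scalar_elts n A" for f g
    using that elt.subspace_add [OF subspace_tower, of f n g]
    by (fastforce simp: scalar_elts_def scaleC_op_add [symmetric])
  show "scaleC_elt c f \<in> scalar_elts n A" if "f \<in> scalar_elts n A" for c f
    using that elt.subspace_scale [OF subspace_tower, of f n c]
    by (fastforce simp: scalar_elts_def scaleC_elt_apply scaleC_op_scaleC_op)
qed

lemma tower_eqI:
  assumes "f \<in> tower H K P n" "g \<in> tower H K P n"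
    and "\<And>s t l. s \<in> S n \<Longrightarrow> t \<in> S n \<Longrightarrow> l \<in> L n \<Longrightarrow> f s t l = g s t l"
  shows "f = g"
proof (intro ext)
  show "f s t l = g s t l" for s t l
    using assms tower_outside [OF assms(1)] tower_outside [OF assms(2)]
    by (cases "s \<in> S n \<and> t \<in> S n \<and> l \<in> L n") auto
qed

text \<open>An element of the tower is the finite sum of its entries; here each entry is either a
  scalar multiple of a generator or 0.\<close>

lemma span_scalar_elts:
  "cspan {unit_el s1 s2 id_blinfun l | s1 s2 l. s1 \<in> S n \<and> s2 \<in> S n \<and> l \<in> L n \<and>
      mu G s1 \<otimes>\<^bsub>G\<^esub> l \<otimes>\<^bsub>G\<^esub> inv\<^bsub>G\<^esub> (mu G s2) \<in> A} = scalar_elts n A" (is "cspan ?B = _")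
proof
  have "?B \<subseteq> scalar_elts n A"
  proof clarify
    fix s1 s2 l
    assume s: "s1 \<in> S n" "s2 \<in> S n" "l \<in> L n"
      "mu G s1 \<otimes>\<^bsub>G\<^esub> l \<otimes>\<^bsub>G\<^esub> inv\<^bsub>G\<^esub> (mu G s2) \<in> A"
    have one: "id_blinfun = scaleC_op 1 (id_blinfun :: 'h \<Rightarrow>\<^sub>L 'h)"
      and zero: "0 = scaleC_op 0 (id_blinfun :: 'h \<Rightarrow>\<^sub>L 'h)" by simp_all
    have "\<exists>c. unit_el s1 s2 id_blinfun l s t l' = scaleC_op c (id_blinfun :: 'h \<Rightarrow>\<^sub>L 'h)" for s t l'
      unfolding unit_el_def using one zero by metis
    then show "unit_el s1 s2 id_blinfun l \<in> scalar_elts n A"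
      using s unit_el_tower [OF P_id s(1-3)] by (auto simp: scalar_elts_def unit_el_def)
  qed
  then show "cspan ?B \<subseteq> scalar_elts n A"
    by (rule elt.span_minimal [OF _ subspace_scalar_elts])
next
  show "scalar_elts n A \<subseteq> cspan ?B"
  proof
    fix f assume f: "f \<in> scalar_elts n A"
    then have ft: "f \<in> tower H K P n" by (simp add: scalar_elts_def)
    have eq: "f = (\<Sum>s\<in>S n. \<Sum>t\<in>S n. \<Sum>l\<in>L n. unit_el s t (f s t l) l)" (is "_ = ?sum")
    proof (rule tower_eqI [OF ft])
      show "?sum \<in> tower H K P n"
        by (intro elt.subspace_sum [OF subspace_tower] unit_el_tower tower_P [OF ft])
      fix s t l assume s: "s \<in> S n" "t \<in> S n" "l \<in> L n"
      have "?sum s t l = (\<Sum>s'\<in>S n. \<Sum>t'\<in>S n. \<Sum>l'\<in>L n.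
          if s' = s \<and> t' = t \<and> l' = l then f s' t' l' else 0)"
        unfolding sum_elt_apply3 unit_el_def by (intro sum.cong refl) auto
      then show "f s t l = ?sum s t l"
        using s by (simp add: sum3_delta)
    qed
    have mem: "unit_el s t (f s t l) l \<in> cspan ?B" if s: "s \<in> S n" "t \<in> S n" "l \<in> L n" for s t l
    proof (cases "mu G s \<otimes>\<^bsub>G\<^esub> l \<otimes>\<^bsub>G\<^esub> inv\<^bsub>G\<^esub> (mu G t) \<in> A")
      case True
      obtain c where "f s t l = scaleC_op c id_blinfun" using scalar_eltsD(1) [OF f s] by blast
      then have "unit_el s t (f s t l) l = scaleC_elt c (unit_el s t id_blinfun l)"
        by (simp add: scaleC_elt_unit_el)
      moreover have "unit_el s t id_blinfun l \<in> cspan ?B"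
        using s True by (intro elt.span_base) blast
      ultimately show ?thesis by (simp add: elt.span_scale)
    next
      case False
      then have "f s t l = 0" by (rule scalar_eltsD(2) [OF f s])
      then have "unit_el s t (f s t l) l = 0" by (simp add: unit_el_def fun_eq_iff)
      then show ?thesis by (simp only: elt.span_zero)
    qed
    show "f \<in> cspan ?B"
      by (subst eq) (intro elt.span_sum mem)
  qed
qed

text \<open>The only index at level 0 is the empty tuple, so the group element attached to a
  coefficient is l itself and only the unit survives.\<close>

lemma scalar_elts_0:
  assumes "f \<in> scalar_elts 0 {\<one>\<^bsub>G\<^esub>}"
  shows "\<exists>c. f = scaleC_elt c (unit_el [] [] id_blinfun \<one>\<^bsub>G\<^esub>)"
proof -
  have ft: "f \<in> tower H K P 0" using assms by (simp add: scalar_elts_def)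
  obtain c where c: "f [] [] \<one>\<^bsub>G\<^esub> = scaleC_op c id_blinfun"
    using scalar_eltsD(1) [OF assms, of "[]" "[]" "\<one>\<^bsub>G\<^esub>"] by (auto simp: S_0)
  have z: "f [] [] l = 0" if "l \<in> L 0" "l \<noteq> \<one>\<^bsub>G\<^esub>" for l
    using scalar_eltsD(2) [OF assms, of "[]" "[]" l] that by (simp add: S_0)
  have "f = scaleC_elt c (unit_el [] [] id_blinfun \<one>\<^bsub>G\<^esub>)"
    unfolding scaleC_elt_unit_el
    by (rule tower_eqI [OF ft unit_el_tower [OF scalar_P]]) (use c z in \<open>auto simp: S_0 unit_el_def\<close>)
  then show ?thesis by blast
qed

lemma scalar_central:
  assumes "f \<in> tower H K P n"
  shows "tmul n f (diag n (scaleC_op c id_blinfun)) = tmul n (diag n (scaleC_op c id_blinfun)) f"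
  using assms by (subst commutes_diag_iff) (auto simp: scalar_P \<alpha>_scalar scalar_commutes \<alpha>_P tower_P)

lemma relative_commutant_M_0:
  "relative_commutant (tmul 0) (subfactor_M H K P) (tower H K P 0)
    = range (\<lambda>c. scaleC_elt c (unit_el [] [] id_blinfun \<one>\<^bsub>G\<^esub>))"
proof (intro equalityI subsetI)
  fix f assume f: "f \<in> relative_commutant (tmul 0) (subfactor_M H K P) (tower H K P 0)"
  then have ft: "f \<in> tower H K P 0" by (simp add: relative_commutant_def)
  have "tmul 0 f (diag 0 x) = tmul 0 (diag 0 x) f" if x: "x \<in> P" for x
  proof -
    have "diag 0 x \<in> tower H K P 0"
      using tower_embed_P [OF x, of 0] x by (simp flip: tower_embed_P add: unit_el_tower S_0)
    then show ?thesis using f by (simp add: relative_commutant_def subfactor_M_def)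
  qed
  then have "f \<in> scalar_elts 0 {\<one>\<^bsub>G\<^esub>}"
    using commutes_fixed_points_iff [OF triv_subgroup _ ft] by (simp add: fixed_points_trivial)
  then show "f \<in> range (\<lambda>c. scaleC_elt c (unit_el [] [] id_blinfun \<one>\<^bsub>G\<^esub>))"
    using scalar_elts_0 by blast
next
  fix f :: "('g, 'h) elt" assume "f \<in> range (\<lambda>c. scaleC_elt c (unit_el [] [] id_blinfun \<one>\<^bsub>G\<^esub>))"
  then obtain c where f: "f = unit_el [] [] (scaleC_op c id_blinfun) \<one>\<^bsub>G\<^esub>"
    by (auto simp: scaleC_elt_unit_el)
  have "f = diag 0 (scaleC_op c id_blinfun)"
    using tower_embed_P [OF scalar_P, of 0 c] f by simp
  moreover have "f \<in> tower H K P 0"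
    unfolding f by (rule unit_el_tower [OF scalar_P]) (simp_all add: S_0)
  ultimately show "f \<in> relative_commutant (tmul 0) (subfactor_M H K P) (tower H K P 0)"
    using scalar_central [of _ 0 c] by (auto simp: relative_commutant_def subfactor_M_def)
qed

text \<open>The commutant of N in M also contains the elements l in the intersection of H and K.
  Intersecting with N removes those other than the unit, because elements of N are supported at the
  unit.\<close>

lemma relative_commutant_N_N:
  "relative_commutant (tmul 0) (subfactor_N G H P \<alpha>) (subfactor_N G H P \<alpha>)
    = range (\<lambda>c. scaleC_elt c (unit_el [] [] id_blinfun \<one>\<^bsub>G\<^esub>))"
proof -
  have "subfactor_N G H P \<alpha> \<subseteq> tower H K P 0"
    by (auto simp: subfactor_N_def fixed_points_def S_0 intro!: unit_el_tower)
  then have rel: "relative_commutant (tmul 0) (subfactor_N G H P \<alpha>) (subfactor_N G H P \<alpha>)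
      = scalar_elts 0 H \<inter> subfactor_N G H P \<alpha>"
    using relative_commutant_N [of 0] by (auto simp: relative_commutant_def)
  show ?thesis
    unfolding rel
  proof (intro equalityI subsetI)
    fix f assume f: "f \<in> scalar_elts 0 H \<inter> subfactor_N G H P \<alpha>"
    then obtain x where x: "f = unit_el [] [] x \<one>\<^bsub>G\<^esub>" by (auto simp: subfactor_N_def)
    have "\<exists>c. f [] [] \<one>\<^bsub>G\<^esub> = scaleC_op c id_blinfun"
      using f by (intro scalar_eltsD(1) [of f 0 H]) (simp_all add: S_0)
    then show "f \<in> range (\<lambda>c. scaleC_elt c (unit_el [] [] id_blinfun \<one>\<^bsub>G\<^esub>))"
      using x by (auto simp: unit_el_def scaleC_elt_def fun_eq_iff)
  next
    fix f :: "('g, 'h) elt" assume "f \<in> range (\<lambda>c. scaleC_elt c (unit_el [] [] id_blinfun \<one>\<^bsub>G\<^esub>))"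
    then obtain c where f: "f = scaleC_elt c (unit_el [] [] id_blinfun \<one>\<^bsub>G\<^esub>)" by blast
    have "unit_el [] [] id_blinfun \<one>\<^bsub>G\<^esub> \<in> scalar_elts 0 H"
      unfolding span_scalar_elts [symmetric]
      using subgroup.one_closed [OF H] by (intro elt.span_base) (force simp: S_0)
    then have "f \<in> scalar_elts 0 H"
      unfolding f by (rule elt.subspace_scale [OF subspace_scalar_elts])
    moreover have "scaleC_op c id_blinfun \<in> fixed_points H P \<alpha>"
      using subgroup.mem_carrier [OF H] by (auto simp: fixed_points_def scalar_P \<alpha>_scalar)
    then have "f \<in> subfactor_N G H P \<alpha>"
      unfolding f scaleC_elt_unit_el subfactor_N_def by blast
    ultimately show "f \<in> scalar_elts 0 H \<inter> subfactor_N G H P \<alpha>" by blast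
  qed
qed

section \<open>Commutation with the group K and the commutant of M\<close>

abbreviation "T \<equiv> Tset H K"

lemma fin_T [simp]: "finite (T n)"
  by (simp add: Tset_eq_Sset finite_Sset finite_H finite_K)

lemma one_K [simp]: "\<one>\<^bsub>G\<^esub> \<in> K"
  using K by (rule subgroup.one_closed)

lemma K_mult [simp]: "a \<in> K \<Longrightarrow> b \<in> K \<Longrightarrow> a \<otimes>\<^bsub>G\<^esub> b \<in> K"
  using K by (rule subgroup.m_closed)

lemma K_inv [simp]: "a \<in> K \<Longrightarrow> inv\<^bsub>G\<^esub> a \<in> K"
  using K by (rule subgroup.m_inv_closed)

lemma mu_T [simp]: "t \<in> T n \<Longrightarrow> mu G t \<in> carrier G"
  using S_carrier [of "\<one>\<^bsub>G\<^esub> # t" "Suc n"] by (intro mu_closed) (simp add: S_Cons)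

lemma sum_S_Suc: "(\<Sum>r\<in>S (Suc m). g r) = (\<Sum>k\<in>K. \<Sum>t\<in>T m. g (k # t))"
proof -
  have "bij_betw (\<lambda>(k, t). k # t) (K \<times> T m) (S (Suc m))"
    by (auto simp: bij_betw_def inj_on_def Sset_Suc_Tset)
  then have "(\<Sum>r\<in>S (Suc m). g r) = (\<Sum>p\<in>K \<times> T m. g (case p of (k, t) \<Rightarrow> k # t))"
    by (rule sum.reindex_bij_betw [symmetric])
  then show ?thesis by (simp add: sum.cartesian_product split_def)
qed

lemma mu_conj_Cons:
  assumes "p \<in> K" "q \<in> K" "t \<in> T m" "u \<in> T m" "l \<in> carrier G"
  shows "mu G (p # t) \<otimes>\<^bsub>G\<^esub> l \<otimes>\<^bsub>G\<^esub> inv\<^bsub>G\<^esub> (mu G (q # u))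
    = p \<otimes>\<^bsub>G\<^esub> (mu G t \<otimes>\<^bsub>G\<^esub> l \<otimes>\<^bsub>G\<^esub> inv\<^bsub>G\<^esub> (mu G u)) \<otimes>\<^bsub>G\<^esub> inv\<^bsub>G\<^esub> q"
  using assms by (simp add: m_assoc inv_mult_group)

text \<open>Invariance under conjugation by \<lambda>_k in the first coordinate. At these levels k
  is a permutation matrix supported at the unit, so no automorphism enters.\<close>

definition K_invariant :: "nat \<Rightarrow> ('g, 'h) elt \<Rightarrow> bool" where
  "K_invariant m f \<longleftrightarrow> (\<forall>k\<in>K. \<forall>p\<in>K. \<forall>q\<in>K. \<forall>t\<in>T m. \<forall>u\<in>T m. \<forall>l\<in>L (Suc m).
     f ((k \<otimes>\<^bsub>G\<^esub> p) # t) ((k \<otimes>\<^bsub>G\<^esub> q) # u) l = f (p # t) (q # u) l)"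

lemma K_invariantD:
  "K_invariant m f \<Longrightarrow> k \<in> K \<Longrightarrow> p \<in> K \<Longrightarrow> q \<in> K \<Longrightarrow> t \<in> T m \<Longrightarrow> u \<in> T m \<Longrightarrow> l \<in> L (Suc m) \<Longrightarrow>
    f ((k \<otimes>\<^bsub>G\<^esub> p) # t) ((k \<otimes>\<^bsub>G\<^esub> q) # u) l = f (p # t) (q # u) l"
  by (simp add: K_invariant_def)

lemma embM_Cons:
  assumes "p \<in> K" "q \<in> K" "t \<in> T m" "u \<in> T m"
  shows "embM (Suc m) f (p # t) (q # u) \<one>\<^bsub>G\<^esub>
    = (if t = u then \<alpha> (inv\<^bsub>G\<^esub> (mu G (p # t))) (f [] [] (p \<otimes>\<^bsub>G\<^esub> inv\<^bsub>G\<^esub> q)) else 0)"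
  using assms by (simp add: embM_def S_Cons)

text \<open>An entry of \<open>embM\<close> vanishes unless the tails agree, so the sum over
  intermediate tuples reduces to a sum over their heads.\<close>

lemma mult_embM:
  assumes f: "f \<in> tower H K P (Suc m)" and f0: "f0 \<in> tower H K P 0"
    and p: "p \<in> K" "q \<in> K" "t \<in> T m" "u \<in> T m" "l \<in> L (Suc m)"
  shows "tmul (Suc m) f (embM (Suc m) f0) (p # t) (q # u) l
      = (\<Sum>k\<in>K. f (p # t) (k # u) l o\<^sub>L
          \<alpha> (l \<otimes>\<^bsub>G\<^esub> inv\<^bsub>G\<^esub> (mu G (k # u))) (f0 [] [] (k \<otimes>\<^bsub>G\<^esub> inv\<^bsub>G\<^esub> q)))"
    and "tmul (Suc m) (embM (Suc m) f0) f (p # t) (q # u) l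
      = (\<Sum>k\<in>K. \<alpha> (inv\<^bsub>G\<^esub> (mu G (p # t))) (f0 [] [] (p \<otimes>\<^bsub>G\<^esub> inv\<^bsub>G\<^esub> k)) o\<^sub>L f (k # t) (q # u) l)"
proof -
  have S: "p # t \<in> S (Suc m)" "q # u \<in> S (Suc m)" using p by (simp_all add: S_Cons)
  have lc: "l \<in> carrier G" using p(5) by simp
  have r: "(\<Sum>v\<in>T m. f (p # t) (k # v) l o\<^sub>L \<alpha> l (embM (Suc m) f0 (k # v) (q # u) \<one>\<^bsub>G\<^esub>))
      = f (p # t) (k # u) l o\<^sub>L
          \<alpha> (l \<otimes>\<^bsub>G\<^esub> inv\<^bsub>G\<^esub> (mu G (k # u))) (f0 [] [] (k \<otimes>\<^bsub>G\<^esub> inv\<^bsub>G\<^esub> q))" if k: "k \<in> K" for k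
  proof -
    have "(\<Sum>v\<in>T m. f (p # t) (k # v) l o\<^sub>L \<alpha> l (embM (Suc m) f0 (k # v) (q # u) \<one>\<^bsub>G\<^esub>))
        = (\<Sum>v\<in>T m. if v = u then f (p # t) (k # u) l o\<^sub>L
          \<alpha> (l \<otimes>\<^bsub>G\<^esub> inv\<^bsub>G\<^esub> (mu G (k # u))) (f0 [] [] (k \<otimes>\<^bsub>G\<^esub> inv\<^bsub>G\<^esub> q)) else 0)"
    proof (intro sum.cong refl)
      fix v assume "v \<in> T m"
      then show "f (p # t) (k # v) l o\<^sub>L \<alpha> l (embM (Suc m) f0 (k # v) (q # u) \<one>\<^bsub>G\<^esub>)
        = (if v = u then f (p # t) (k # u) l o\<^sub>L
          \<alpha> (l \<otimes>\<^bsub>G\<^esub> inv\<^bsub>G\<^esub> (mu G (k # u))) (f0 [] [] (k \<otimes>\<^bsub>G\<^esub> inv\<^bsub>G\<^esub> q)) else 0)"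
        using k p lc by (cases "v = u") (simp_all add: embM_Cons \<alpha>_mult \<alpha>_zero tower_P [OF f0])
    qed
    then show ?thesis using p by simp
  qed
  show "tmul (Suc m) f (embM (Suc m) f0) (p # t) (q # u) l
      = (\<Sum>k\<in>K. f (p # t) (k # u) l o\<^sub>L
          \<alpha> (l \<otimes>\<^bsub>G\<^esub> inv\<^bsub>G\<^esub> (mu G (k # u))) (f0 [] [] (k \<otimes>\<^bsub>G\<^esub> inv\<^bsub>G\<^esub> q)))"
    unfolding mult_base_right [OF embM_base [OF f0] S p(5)] sum_S_Suc
    by (intro sum.cong refl r)
  have r': "(\<Sum>v\<in>T m. embM (Suc m) f0 (p # t) (k # v) \<one>\<^bsub>G\<^esub> o\<^sub>L f (k # v) (q # u) l)
      = \<alpha> (inv\<^bsub>G\<^esub> (mu G (p # t))) (f0 [] [] (p \<otimes>\<^bsub>G\<^esub> inv\<^bsub>G\<^esub> k)) o\<^sub>L f (k # t) (q # u) l" if k: "k \<in> K" for k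
  proof -
    have "(\<Sum>v\<in>T m. embM (Suc m) f0 (p # t) (k # v) \<one>\<^bsub>G\<^esub> o\<^sub>L f (k # v) (q # u) l)
      = (\<Sum>v\<in>T m. if v = t then
          \<alpha> (inv\<^bsub>G\<^esub> (mu G (p # t))) (f0 [] [] (p \<otimes>\<^bsub>G\<^esub> inv\<^bsub>G\<^esub> k)) o\<^sub>L f (k # t) (q # u) l else 0)"
      using k p by (intro sum.cong refl) (simp add: embM_Cons)
    then show ?thesis using p by simp
  qed
  show "tmul (Suc m) (embM (Suc m) f0) f (p # t) (q # u) l
      = (\<Sum>k\<in>K. \<alpha> (inv\<^bsub>G\<^esub> (mu G (p # t))) (f0 [] [] (p \<otimes>\<^bsub>G\<^esub> inv\<^bsub>G\<^esub> k)) o\<^sub>L f (k # t) (q # u) l)"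
    unfolding mult_base_left [OF embM_base [OF f0] tower_P [OF f] S p(5)] sum_S_Suc
    by (intro sum.cong refl r')
qed

text \<open>The test element is k itself. In the entry with first coordinates k p and q, the sum
  over intermediate heads r keeps only r = k q in one product and only r = p in the other.\<close>

lemma commutes_K_invariant:
  assumes f: "f \<in> tower H K P (Suc m)"
    and comm: "\<And>f0. f0 \<in> tower H K P 0 \<Longrightarrow> tmul (Suc m) f (embM (Suc m) f0) = tmul (Suc m) (embM (Suc m) f0) f"
  shows "K_invariant m f"
  unfolding K_invariant_def
proof (intro ballI)
  fix k p q t u l
  assume k: "k \<in> K" "p \<in> K" "q \<in> K" "t \<in> T m" "u \<in> T m" "l \<in> L (Suc m)"
  let ?f0 = "unit_el [] [] id_blinfun k"
  have f0: "?f0 \<in> tower H K P 0"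
    using k by (intro unit_el_tower P_id) (simp_all add: S_0 Lgrp_def)
  have kp: "k \<otimes>\<^bsub>G\<^esub> p \<in> K" using k by simp
  have inj1: "r \<otimes>\<^bsub>G\<^esub> inv\<^bsub>G\<^esub> q = k \<longleftrightarrow> r = k \<otimes>\<^bsub>G\<^esub> q" if "r \<in> K" for r
    using that k by (metis K_carrier inv_solve_right)
  have inj2: "k \<otimes>\<^bsub>G\<^esub> p \<otimes>\<^bsub>G\<^esub> inv\<^bsub>G\<^esub> r = k \<longleftrightarrow> r = p" if "r \<in> K" for r
    using that k mult_inv_eq_one_iff [of p r] by (auto simp: m_assoc)
  have "tmul (Suc m) f (embM (Suc m) ?f0) ((k \<otimes>\<^bsub>G\<^esub> p) # t) (q # u) l
      = (\<Sum>r\<in>K. if r = k \<otimes>\<^bsub>G\<^esub> q then f ((k \<otimes>\<^bsub>G\<^esub> p) # t) ((k \<otimes>\<^bsub>G\<^esub> q) # u) l else 0)"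
    unfolding mult_embM(1) [OF f f0 kp k(3-6)]
  proof (intro sum.cong refl)
    fix r assume r: "r \<in> K"
    have c: "l \<otimes>\<^bsub>G\<^esub> inv\<^bsub>G\<^esub> (mu G (r # u)) \<in> carrier G"
      using r k L_carrier [OF k(6)] by simp
    show "f ((k \<otimes>\<^bsub>G\<^esub> p) # t) (r # u) l o\<^sub>L
        \<alpha> (l \<otimes>\<^bsub>G\<^esub> inv\<^bsub>G\<^esub> (mu G (r # u))) (?f0 [] [] (r \<otimes>\<^bsub>G\<^esub> inv\<^bsub>G\<^esub> q))
      = (if r = k \<otimes>\<^bsub>G\<^esub> q then f ((k \<otimes>\<^bsub>G\<^esub> p) # t) ((k \<otimes>\<^bsub>G\<^esub> q) # u) l else 0)"
      unfolding unit_el_def using inj1 [OF r] \<alpha>_id [OF c] \<alpha>_zero [OF c]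
      by (auto intro!: blinfun_eqI)
  qed
  also have "\<dots> = f ((k \<otimes>\<^bsub>G\<^esub> p) # t) ((k \<otimes>\<^bsub>G\<^esub> q) # u) l"
    using k finite_K by simp
  finally have left: "tmul (Suc m) f (embM (Suc m) ?f0) ((k \<otimes>\<^bsub>G\<^esub> p) # t) (q # u) l
      = f ((k \<otimes>\<^bsub>G\<^esub> p) # t) ((k \<otimes>\<^bsub>G\<^esub> q) # u) l" .
  have "tmul (Suc m) (embM (Suc m) ?f0) f ((k \<otimes>\<^bsub>G\<^esub> p) # t) (q # u) l
      = (\<Sum>r\<in>K. if r = p then f (p # t) (q # u) l else 0)"
    unfolding mult_embM(2) [OF f f0 kp k(3-6)]
  proof (intro sum.cong refl)
    fix r assume r: "r \<in> K"
    have c: "inv\<^bsub>G\<^esub> (mu G ((k \<otimes>\<^bsub>G\<^esub> p) # t)) \<in> carrier G" using k by simp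
    show "\<alpha> (inv\<^bsub>G\<^esub> (mu G ((k \<otimes>\<^bsub>G\<^esub> p) # t))) (?f0 [] [] (k \<otimes>\<^bsub>G\<^esub> p \<otimes>\<^bsub>G\<^esub> inv\<^bsub>G\<^esub> r)) o\<^sub>L f (r # t) (q # u) l
      = (if r = p then f (p # t) (q # u) l else 0)"
      unfolding unit_el_def using inj2 [OF r] \<alpha>_id [OF c] \<alpha>_zero [OF c]
      by (auto intro!: blinfun_eqI)
  qed
  also have "\<dots> = f (p # t) (q # u) l"
    using k finite_K by simp
  finally show "f ((k \<otimes>\<^bsub>G\<^esub> p) # t) ((k \<otimes>\<^bsub>G\<^esub> q) # u) l = f (p # t) (q # u) l"
    using left comm [OF f0] by simp
qed

text \<open>All of M is treated at once: the support condition makes the automorphisms on both sides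
  equal, and K-invariance matches the two sums over heads.\<close>

lemma K_invariant_commutes:
  assumes sc: "f \<in> scalar_elts (Suc m) {\<one>\<^bsub>G\<^esub>}" and inv: "K_invariant m f" and f0: "f0 \<in> tower H K P 0"
  shows "tmul (Suc m) f (embM (Suc m) f0) = tmul (Suc m) (embM (Suc m) f0) f"
proof -
  have f: "f \<in> tower H K P (Suc m)" using sc by (simp add: scalar_elts_def)
  have entry: "tmul (Suc m) f (embM (Suc m) f0) (p # t) (q # u) l
      = tmul (Suc m) (embM (Suc m) f0) f (p # t) (q # u) l"
    if p: "p \<in> K" "q \<in> K" "t \<in> T m" "u \<in> T m" "l \<in> L (Suc m)" for p q t u l
  proof -
    let ?z = "\<lambda>k. \<alpha> (inv\<^bsub>G\<^esub> (mu G (p # t))) (f0 [] [] k)"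
    have lc: "l \<in> carrier G" using p(5) by simp
    have mc: "mu G (p # t) \<in> carrier G" using p by simp
    have "tmul (Suc m) f (embM (Suc m) f0) (p # t) (q # u) l
        = (\<Sum>k\<in>K. ?z (k \<otimes>\<^bsub>G\<^esub> inv\<^bsub>G\<^esub> q) o\<^sub>L f (p # t) (k # u) l)"
      unfolding mult_embM(1) [OF f f0 p]
    proof (intro sum.cong refl)
      fix k assume k: "k \<in> K"
      have S: "p # t \<in> S (Suc m)" "k # u \<in> S (Suc m)" using k p by (simp_all add: S_Cons)
      have uc: "mu G (k # u) \<in> carrier G" using S(2) by (rule mu_S)
      show "f (p # t) (k # u) l o\<^sub>L \<alpha> (l \<otimes>\<^bsub>G\<^esub> inv\<^bsub>G\<^esub> (mu G (k # u))) (f0 [] [] (k \<otimes>\<^bsub>G\<^esub> inv\<^bsub>G\<^esub> q))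
          = ?z (k \<otimes>\<^bsub>G\<^esub> inv\<^bsub>G\<^esub> q) o\<^sub>L f (p # t) (k # u) l"
      \<comment> \<open>Where the coefficient may be nonzero, l mu(k # u)^-1 equals mu(p # t)^-1, so
        it can be replaced by the automorphism on the other side; the scalar coefficient then moves
        across.\<close>
      proof (cases "mu G (p # t) \<otimes>\<^bsub>G\<^esub> l \<otimes>\<^bsub>G\<^esub> inv\<^bsub>G\<^esub> (mu G (k # u)) = \<one>\<^bsub>G\<^esub>")
        case True
        have "inv\<^bsub>G\<^esub> (mu G (p # t)) = l \<otimes>\<^bsub>G\<^esub> inv\<^bsub>G\<^esub> (mu G (k # u))"
        proof -
          have "(l \<otimes>\<^bsub>G\<^esub> inv\<^bsub>G\<^esub> (mu G (k # u))) \<otimes>\<^bsub>G\<^esub> mu G (p # t) = \<one>\<^bsub>G\<^esub>"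
            by (rule inv_comm) (use True lc mc uc in \<open>simp_all add: m_assoc del: mu_Cons\<close>)
          then show ?thesis using lc mc uc by - (rule inv_equality, simp_all del: mu_Cons)
        qed
        moreover obtain c where "f (p # t) (k # u) l = scaleC_op c id_blinfun"
          using scalar_eltsD(1) [OF sc S p(5)] by blast
        moreover have "\<alpha> (inv\<^bsub>G\<^esub> (mu G (p # t))) (f0 [] [] (k \<otimes>\<^bsub>G\<^esub> inv\<^bsub>G\<^esub> q)) \<in> P"
          using mc by (intro \<alpha>_P tower_P [OF f0] inv_closed)
        ultimately show ?thesis by (simp add: scalar_commutes del: mu_Cons)
      next
        case False
        then have "f (p # t) (k # u) l = 0" by (intro scalar_eltsD(2) [OF sc S p(5)]) simp
        then show ?thesis by (simp add: blinfun_eqI)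
      qed
    qed
    \<comment> \<open>The substitution k |-> p k^-1 q turns k q^-1 into p k^-1, the argument on the
      other side. Translation by p k^-1 then carries the heads (k, q) to (p, p k^-1 q).\<close>
    also have "\<dots> = (\<Sum>k\<in>K. ?z ((p \<otimes>\<^bsub>G\<^esub> inv\<^bsub>G\<^esub> k \<otimes>\<^bsub>G\<^esub> q) \<otimes>\<^bsub>G\<^esub> inv\<^bsub>G\<^esub> q) o\<^sub>L
        f (p # t) ((p \<otimes>\<^bsub>G\<^esub> inv\<^bsub>G\<^esub> k \<otimes>\<^bsub>G\<^esub> q) # u) l)"
    proof (rule sum.reindex_bij_betw [symmetric])
      show "bij_betw (\<lambda>k. p \<otimes>\<^bsub>G\<^esub> inv\<^bsub>G\<^esub> k \<otimes>\<^bsub>G\<^esub> q) K K"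
        by (rule bij_betw_byWitness [where f' = "\<lambda>k. q \<otimes>\<^bsub>G\<^esub> inv\<^bsub>G\<^esub> k \<otimes>\<^bsub>G\<^esub> p"])
          (use p in \<open>auto simp: inv_mult_group m_assoc mult_inv_cancel\<close>)
    qed
    also have "\<dots> = (\<Sum>k\<in>K. ?z (p \<otimes>\<^bsub>G\<^esub> inv\<^bsub>G\<^esub> k) o\<^sub>L f (k # t) (q # u) l)"
    proof (intro sum.cong refl)
      fix k assume k: "k \<in> K"
      have "(p \<otimes>\<^bsub>G\<^esub> inv\<^bsub>G\<^esub> k \<otimes>\<^bsub>G\<^esub> q) \<otimes>\<^bsub>G\<^esub> inv\<^bsub>G\<^esub> q = p \<otimes>\<^bsub>G\<^esub> inv\<^bsub>G\<^esub> k"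
        using k p by (simp add: m_assoc)
      moreover have "f (p # t) ((p \<otimes>\<^bsub>G\<^esub> inv\<^bsub>G\<^esub> k \<otimes>\<^bsub>G\<^esub> q) # u) l = f (k # t) (q # u) l"
        using K_invariantD [OF inv, of "p \<otimes>\<^bsub>G\<^esub> inv\<^bsub>G\<^esub> k" k q t u l] k p by (simp add: m_assoc)
      ultimately show "?z ((p \<otimes>\<^bsub>G\<^esub> inv\<^bsub>G\<^esub> k \<otimes>\<^bsub>G\<^esub> q) \<otimes>\<^bsub>G\<^esub> inv\<^bsub>G\<^esub> q) o\<^sub>L
          f (p # t) ((p \<otimes>\<^bsub>G\<^esub> inv\<^bsub>G\<^esub> k \<otimes>\<^bsub>G\<^esub> q) # u) l
        = ?z (p \<otimes>\<^bsub>G\<^esub> inv\<^bsub>G\<^esub> k) o\<^sub>L f (k # t) (q # u) l" by simp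
    qed
    also have "\<dots> = tmul (Suc m) (embM (Suc m) f0) f (p # t) (q # u) l"
      by (rule mult_embM(2) [OF f f0 p, symmetric])
    finally show ?thesis .
  qed
  show ?thesis
  proof (intro ext)
    fix s t l
    show "tmul (Suc m) f (embM (Suc m) f0) s t l = tmul (Suc m) (embM (Suc m) f0) f s t l"
    proof (cases "s \<in> S (Suc m) \<and> t \<in> S (Suc m) \<and> l \<in> L (Suc m)")
      case True
      then obtain p s' q t' where "s = p # s'" "t = q # t'" "p \<in> K" "q \<in> K" "s' \<in> T m" "t' \<in> T m"
        by (auto simp: Sset_Suc_Tset)
      then show ?thesis using entry True by simp
    next
      case False
      show ?thesis unfolding tower_mult_def if_not_P [OF False] by (rule refl)
    qed
  qed
qed

lemma relative_commutant_M_Suc: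
  "relative_commutant (tmul (Suc m)) (tower_embed G H K \<alpha> (Suc m) ` subfactor_M H K P) (tower H K P (Suc m))
    = {f \<in> scalar_elts (Suc m) {\<one>\<^bsub>G\<^esub>}. K_invariant m f}"
proof -
  have emb: "tower_embed G H K \<alpha> (Suc m) ` subfactor_M H K P = embM (Suc m) ` tower H K P 0"
    unfolding subfactor_M_def by (intro image_cong refl tower_embed_M)
  have diag_embM: "diag (Suc m) x \<in> embM (Suc m) ` tower H K P 0" if x: "x \<in> P" for x
  proof -
    have u: "unit_el [] [] x \<one>\<^bsub>G\<^esub> \<in> tower H K P 0"
      using x by (intro unit_el_tower) (simp_all add: S_0)
    then have "diag (Suc m) x = embM (Suc m) (unit_el [] [] x \<one>\<^bsub>G\<^esub>)"
      using tower_embed_M [OF u, of m] tower_embed_P [OF x, of "Suc m"] by simp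
    then show ?thesis using u by blast
  qed
  show ?thesis
    unfolding emb
  proof (intro equalityI subsetI)
    fix f assume "f \<in> relative_commutant (tmul (Suc m)) (embM (Suc m) ` tower H K P 0) (tower H K P (Suc m))"
    then have f: "f \<in> tower H K P (Suc m)"
      and comm: "\<And>b. b \<in> embM (Suc m) ` tower H K P 0 \<Longrightarrow> tmul (Suc m) f b = tmul (Suc m) b f"
      unfolding relative_commutant_def by blast+
    have "f \<in> scalar_elts (Suc m) {\<one>\<^bsub>G\<^esub>}"
      using commutes_fixed_points_iff [OF triv_subgroup _ f] comm [OF diag_embM]
      by (simp add: fixed_points_trivial)
    moreover have "K_invariant m f"
      using commutes_K_invariant [OF f] comm by blast
    ultimately show "f \<in> {f \<in> scalar_elts (Suc m) {\<one>\<^bsub>G\<^esub>}. K_invariant m f}" by blast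
  next
    fix f assume "f \<in> {f \<in> scalar_elts (Suc m) {\<one>\<^bsub>G\<^esub>}. K_invariant m f}"
    then show "f \<in> relative_commutant (tmul (Suc m)) (embM (Suc m) ` tower H K P 0) (tower H K P (Suc m))"
      using K_invariant_commutes [of f m] by (auto simp: relative_commutant_def scalar_elts_def)
  qed
qed

text \<open>A sum over one orbit of left translation by K on pairs of heads. The parameter
  \<open>k0\<close> is kept free of \<open>t1\<close>, \<open>t2\<close> and \<open>l\<close>, so
  that their relation can be imposed separately.\<close>

definition orbit_el :: "'g list \<Rightarrow> 'g list \<Rightarrow> 'g \<Rightarrow> 'g \<Rightarrow> ('g, 'h) elt" where
  "orbit_el t1 t2 l k0 = (\<Sum>k\<in>K. unit_el (k # t1) ((k \<otimes>\<^bsub>G\<^esub> k0) # t2) id_blinfun l)"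

lemma orbit_el_apply:
  assumes "p \<in> K"
  shows "orbit_el t1 t2 l k0 (p # u1) (q # u2) l'
    = (if u1 = t1 \<and> u2 = t2 \<and> l' = l \<and> q = p \<otimes>\<^bsub>G\<^esub> k0 then id_blinfun else 0)"
proof -
  have "orbit_el t1 t2 l k0 (p # u1) (q # u2) l' = (\<Sum>k\<in>K. if k = p then
      if u1 = t1 \<and> u2 = t2 \<and> l' = l \<and> q = p \<otimes>\<^bsub>G\<^esub> k0 then id_blinfun else 0 else 0)"
    unfolding orbit_el_def sum_elt_apply unit_el_def by (intro sum.cong) auto
  then show ?thesis using assms finite_K by simp
qed

lemma orbit_el_tower:
  assumes "t1 \<in> T m" "t2 \<in> T m" "l \<in> L (Suc m)" "k0 \<in> K"
  shows "orbit_el t1 t2 l k0 \<in> tower H K P (Suc m)"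
  unfolding orbit_el_def
  using assms by (intro elt.subspace_sum [OF subspace_tower] unit_el_tower P_id) (simp_all add: S_Cons)

lemma orbit_el_mem:
  assumes t: "t1 \<in> T m" "t2 \<in> T m" "l \<in> L (Suc m)" and k0: "k0 = mu G t1 \<otimes>\<^bsub>G\<^esub> l \<otimes>\<^bsub>G\<^esub> inv\<^bsub>G\<^esub> (mu G t2)" "k0 \<in> K"
  shows "orbit_el t1 t2 l k0 \<in> {f \<in> scalar_elts (Suc m) {\<one>\<^bsub>G\<^esub>}. K_invariant m f}"
proof -
  let ?f = "orbit_el t1 t2 l k0"
  have "(\<exists>c. ?f s u l' = scaleC_op c id_blinfun) \<and>
     (mu G s \<otimes>\<^bsub>G\<^esub> l' \<otimes>\<^bsub>G\<^esub> inv\<^bsub>G\<^esub> (mu G u) \<notin> {\<one>\<^bsub>G\<^esub>} \<longrightarrow> ?f s u l' = 0)"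
    if "s \<in> S (Suc m)" "u \<in> S (Suc m)" "l' \<in> L (Suc m)" for s u l'
  proof -
    obtain p s' where s: "s = p # s'" "p \<in> K" "s' \<in> T m" using \<open>s \<in> S (Suc m)\<close> by (auto simp: Sset_Suc_Tset)
    obtain q u' where u: "u = q # u'" "q \<in> K" "u' \<in> T m" using \<open>u \<in> S (Suc m)\<close> by (auto simp: Sset_Suc_Tset)
    show ?thesis
    proof (cases "s' = t1 \<and> u' = t2 \<and> l' = l \<and> q = p \<otimes>\<^bsub>G\<^esub> k0")
      case True
      then have "?f s u l' = id_blinfun" using s u by (simp add: orbit_el_apply)
      then have "\<exists>c. ?f s u l' = scaleC_op c id_blinfun" by (intro exI [of _ 1]) simp
      \<comment> \<open>The support condition becomes q = p k0, which is exactly where the generator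
        is nonzero.\<close>
      moreover have "mu G s \<otimes>\<^bsub>G\<^esub> l' \<otimes>\<^bsub>G\<^esub> inv\<^bsub>G\<^esub> (mu G u) = p \<otimes>\<^bsub>G\<^esub> k0 \<otimes>\<^bsub>G\<^esub> inv\<^bsub>G\<^esub> q"
        unfolding s(1) u(1) using s u t True L_carrier [OF t(3)]
        by (subst mu_conj_Cons) (simp_all add: k0(1))
      ultimately show ?thesis using True s k0(2) by auto
    next
      case False
      then have "?f s u l' = 0" using s u by (auto simp: orbit_el_apply)
      then show ?thesis by (auto intro: exI [of _ 0])
    qed
  qed
  then have "?f \<in> scalar_elts (Suc m) {\<one>\<^bsub>G\<^esub>}"
    using orbit_el_tower [OF t k0(2)] by (simp add: scalar_elts_def)
  moreover have "k \<otimes>\<^bsub>G\<^esub> q = k \<otimes>\<^bsub>G\<^esub> p \<otimes>\<^bsub>G\<^esub> k0 \<longleftrightarrow> q = p \<otimes>\<^bsub>G\<^esub> k0" if "k \<in> K" "p \<in> K" "q \<in> K" for k p q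
    using that k0(2) by (simp add: m_assoc)
  then have "K_invariant m ?f"
    by (simp add: K_invariant_def orbit_el_apply)
  ultimately show ?thesis by blast
qed

lemma subspace_K_invariant: "elt.subspace {f \<in> scalar_elts (Suc m) {\<one>\<^bsub>G\<^esub>}. K_invariant m f}"
  using subspace_scalar_elts [of "Suc m" "{\<one>\<^bsub>G\<^esub>}"]
  unfolding elt.subspace_def K_invariant_def by (auto simp: scaleC_elt_apply)

text \<open>By K-invariance an element is determined by its entries in rows headed by the unit. In
  such a row the support condition allows only the column head \<kappa>, so there is one scalar for
  each triple with \<kappa> in K.\<close>

lemma span_orbit_els:
  "cspan {orbit_el t1 t2 l k0 | t1 t2 l k0. t1 \<in> T m \<and> t2 \<in> T m \<and> l \<in> L (Suc m) \<and>
      k0 = mu G t1 \<otimes>\<^bsub>G\<^esub> l \<otimes>\<^bsub>G\<^esub> inv\<^bsub>G\<^esub> (mu G t2) \<and> k0 \<in> K}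
    = {f \<in> scalar_elts (Suc m) {\<one>\<^bsub>G\<^esub>}. K_invariant m f}" (is "cspan ?B = ?X")
proof
  have "?B \<subseteq> ?X" using orbit_el_mem by auto
  then show "cspan ?B \<subseteq> ?X"
    by (rule elt.span_minimal [OF _ subspace_K_invariant])
next
  show "?X \<subseteq> cspan ?B"
  proof
    fix f assume "f \<in> ?X"
    then have sc: "f \<in> scalar_elts (Suc m) {\<one>\<^bsub>G\<^esub>}" and inv: "K_invariant m f" by auto
    have ft: "f \<in> tower H K P (Suc m)" using sc by (simp add: scalar_elts_def)
    define \<kappa> where "\<kappa> t1 t2 l = mu G t1 \<otimes>\<^bsub>G\<^esub> l \<otimes>\<^bsub>G\<^esub> inv\<^bsub>G\<^esub> (mu G t2)" for t1 t2 l
    have "\<exists>c. t1 \<in> T m \<and> t2 \<in> T m \<and> l \<in> L (Suc m) \<and> \<kappa> t1 t2 l \<in> K \<longrightarrow>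
        f (\<one>\<^bsub>G\<^esub> # t1) (\<kappa> t1 t2 l # t2) l = scaleC_op c id_blinfun" for t1 t2 l
      using scalar_eltsD(1) [OF sc, of "\<one>\<^bsub>G\<^esub> # t1" "\<kappa> t1 t2 l # t2" l] by (auto simp: S_Cons)
    then obtain c where c: "f (\<one>\<^bsub>G\<^esub> # t1) (\<kappa> t1 t2 l # t2) l = scaleC_op (c t1 t2 l) id_blinfun"
      if "t1 \<in> T m" "t2 \<in> T m" "l \<in> L (Suc m)" "\<kappa> t1 t2 l \<in> K" for t1 t2 l
      by metis
    \<comment> \<open>If \<kappa> is not in K, no column of the index set has that head, and the
      triple contributes nothing.\<close>
    define g where "g t1 t2 l =
      (if \<kappa> t1 t2 l \<in> K then scaleC_elt (c t1 t2 l) (orbit_el t1 t2 l (\<kappa> t1 t2 l)) else 0)" for t1 t2 l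
    have gt: "g t1 t2 l \<in> tower H K P (Suc m)" and gs: "g t1 t2 l \<in> cspan ?B"
      if "t1 \<in> T m" "t2 \<in> T m" "l \<in> L (Suc m)" for t1 t2 l
    proof -
      show "g t1 t2 l \<in> tower H K P (Suc m)"
        using that orbit_el_tower elt.subspace_scale [OF subspace_tower] elt.subspace_0 [OF subspace_tower]
        by (simp add: g_def)
      have "orbit_el t1 t2 l (\<kappa> t1 t2 l) \<in> cspan ?B" if "\<kappa> t1 t2 l \<in> K"
        by (rule elt.span_base)
          (use that \<open>t1 \<in> T m\<close> \<open>t2 \<in> T m\<close> \<open>l \<in> L (Suc m)\<close> in \<open>auto simp: \<kappa>_def\<close>)
      then show "g t1 t2 l \<in> cspan ?B"
        by (cases "\<kappa> t1 t2 l \<in> K") (simp_all only: g_def if_True if_False elt.span_scale elt.span_zero)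
    qed
    have eq: "f = (\<Sum>t1\<in>T m. \<Sum>t2\<in>T m. \<Sum>l\<in>L (Suc m). g t1 t2 l)" (is "_ = ?sum")
    proof (rule tower_eqI [OF ft])
      show "?sum \<in> tower H K P (Suc m)"
        by (intro elt.subspace_sum [OF subspace_tower] gt)
      fix s t l assume s: "s \<in> S (Suc m)" "t \<in> S (Suc m)" and l: "l \<in> L (Suc m)"
      obtain p u1 where p: "s = p # u1" "p \<in> K" "u1 \<in> T m" using s(1) by (auto simp: Sset_Suc_Tset)
      obtain q u2 where q: "t = q # u2" "q \<in> K" "u2 \<in> T m" using s(2) by (auto simp: Sset_Suc_Tset)
      let ?k = "\<kappa> u1 u2 l"
      have kc: "?k \<in> carrier G" using p q L_carrier [OF l] by (simp add: \<kappa>_def)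
      \<comment> \<open>Generators of different triples have disjoint supports, so a given entry
        sees a single summand.\<close>
      have "?sum s t l = (\<Sum>t1\<in>T m. \<Sum>t2\<in>T m. \<Sum>l'\<in>L (Suc m).
          if t1 = u1 \<and> t2 = u2 \<and> l' = l then g t1 t2 l' s t l else 0)"
        unfolding sum_elt_apply3
        by (intro sum.cong refl) (auto simp: g_def p q scaleC_elt_apply orbit_el_apply)
      also have "\<dots> = g u1 u2 l s t l"
        using p q l by (intro sum3_delta) simp_all
      also have "\<dots> = f s t l"
      proof (cases "q = p \<otimes>\<^bsub>G\<^esub> ?k")
        case True
        \<comment> \<open>Here \<kappa> is a product of elements of K, so the first branch in the
          definition of \<open>g\<close> applies.\<close>
        have "?k = inv\<^bsub>G\<^esub> p \<otimes>\<^bsub>G\<^esub> q" using True p kc by (simp flip: m_assoc)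
        then have kK: "?k \<in> K" using p q by simp
        have "f s t l = f ((p \<otimes>\<^bsub>G\<^esub> \<one>\<^bsub>G\<^esub>) # u1) ((p \<otimes>\<^bsub>G\<^esub> ?k) # u2) l"
          using p q True by simp
        also have "\<dots> = f (\<one>\<^bsub>G\<^esub> # u1) (?k # u2) l"
          using p q l kK by (intro K_invariantD [OF inv]) simp_all
        also have "\<dots> = scaleC_op (c u1 u2 l) id_blinfun"
          by (rule c [OF p(3) q(3) l kK])
        also have "\<dots> = g u1 u2 l s t l"
          using True kK p q by (simp add: g_def scaleC_elt_apply orbit_el_apply)
        finally show ?thesis by simp
      next
        case False
        then have "g u1 u2 l s t l = 0"
          using p q by (simp add: g_def scaleC_elt_apply orbit_el_apply)
        moreover have "f s t l = 0"
        proof (rule scalar_eltsD(2) [OF sc s l])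
          have "mu G s \<otimes>\<^bsub>G\<^esub> l \<otimes>\<^bsub>G\<^esub> inv\<^bsub>G\<^esub> (mu G t) = p \<otimes>\<^bsub>G\<^esub> ?k \<otimes>\<^bsub>G\<^esub> inv\<^bsub>G\<^esub> q"
            unfolding p(1) q(1) \<kappa>_def using p q L_carrier [OF l] by (intro mu_conj_Cons)
          then show "mu G s \<otimes>\<^bsub>G\<^esub> l \<otimes>\<^bsub>G\<^esub> inv\<^bsub>G\<^esub> (mu G t) \<notin> {\<one>\<^bsub>G\<^esub>}"
            using False mult_inv_eq_one_iff [of "p \<otimes>\<^bsub>G\<^esub> ?k" q] p q kc by auto
        qed
        ultimately show ?thesis by simp
      qed
      finally show "f s t l = ?sum s t l" by simp
    qed
    show "f \<in> cspan ?B"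
      by (subst eq) (intro elt.span_sum gs)
  qed
qed

end

theorem proposition4p9:
  fixes G :: "('g, 'm) monoid_scheme"
    and H K :: "'g set"
    and P :: "('h \<Rightarrow>\<^sub>L 'h :: complex_hilbert_space) set"
    and \<alpha> :: "'g \<Rightarrow> ('h \<Rightarrow>\<^sub>L 'h) \<Rightarrow> ('h \<Rightarrow>\<^sub>L 'h)"
  assumes "group G" and "countable (carrier G)"
    and "II1_factor P"
    and "outer_action G P \<alpha>"
    and "subgroup H G" and "finite H"
    and "subgroup K G" and "finite K"
    and "generate G (H \<union> K) = carrier G"
  shows
    "(relative_commutant (tower_mult G H K \<alpha> 0) (subfactor_N G H P \<alpha>) (subfactor_N G H P \<alpha>)
           = range (\<lambda>c. scaleC_elt c (unit_el [] [] id_blinfun \<one>\<^bsub>G\<^esub>))) \<and>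
    (\<forall>n. relative_commutant (tower_mult G H K \<alpha> n)
               (tower_embed G H K \<alpha> n ` subfactor_N G H P \<alpha>) (tower H K P n)
           = cspan {unit_el s1 s2 id_blinfun l | s1 s2 l.
               s1 \<in> Sset H K n \<and> s2 \<in> Sset H K n \<and> l \<in> Lgrp H K n \<and>
               mu G s1 \<otimes>\<^bsub>G\<^esub> l \<otimes>\<^bsub>G\<^esub> inv\<^bsub>G\<^esub> (mu G s2) \<in> H}) \<and>
    (relative_commutant (tower_mult G H K \<alpha> 0) (subfactor_M H K P) (tower H K P 0)
           = range (\<lambda>c. scaleC_elt c (unit_el [] [] id_blinfun \<one>\<^bsub>G\<^esub>))) \<and>
    (\<forall>n\<ge>1. relative_commutant (tower_mult G H K \<alpha> n)
               (tower_embed G H K \<alpha> n ` subfactor_M H K P) (tower H K P n)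
           = cspan {\<Sum>k\<in>K. unit_el (k # t1) ((k \<otimes>\<^bsub>G\<^esub> k0) # t2) id_blinfun l | t1 t2 l k0.
               t1 \<in> Tset H K (n - 1) \<and> t2 \<in> Tset H K (n - 1) \<and> l \<in> Lgrp H K n \<and>
               k0 = mu G t1 \<otimes>\<^bsub>G\<^esub> l \<otimes>\<^bsub>G\<^esub> inv\<^bsub>G\<^esub> (mu G t2) \<and> k0 \<in> K})"
proof -
  interpret group_type_tower G P \<alpha> H K
    using assms
    by (intro group_type_tower.intro outer_factor.intro outer_factor_axioms.intro
        group_type_tower_axioms.intro) (simp_all add: II1_factor_def)
  show ?thesis
  proof (intro conjI allI impI)
    fix n :: nat
    assume "1 \<le> n"
    then obtain m where "n = Suc m" by (cases n) auto
    then show "relative_commutant (tower_mult G H K \<alpha> n)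
               (tower_embed G H K \<alpha> n ` subfactor_M H K P) (tower H K P n)
           = cspan {\<Sum>k\<in>K. unit_el (k # t1) ((k \<otimes>\<^bsub>G\<^esub> k0) # t2) id_blinfun l | t1 t2 l k0.
               t1 \<in> Tset H K (n - 1) \<and> t2 \<in> Tset H K (n - 1) \<and> l \<in> Lgrp H K n \<and>
               k0 = mu G t1 \<otimes>\<^bsub>G\<^esub> l \<otimes>\<^bsub>G\<^esub> inv\<^bsub>G\<^esub> (mu G t2) \<and> k0 \<in> K}"
      using relative_commutant_M_Suc [of m] span_orbit_els [of m] by (simp add: orbit_el_def)
  qed (simp_all only: relative_commutant_N_N relative_commutant_N span_scalar_elts relative_commutant_M_0)
qed

end
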